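(* The Fourier transformation $f\mapsto\hat f$ establishes an isomorphism between $G(\mathcal{H})$ and $\mathcal{E}(\mathcal{H})$.
   Context: Notation: $n\in\mathbb{N}$ is fixed, $\|\cdot\|$ is the Euclidean norm, $\langle u,v\rangle=u_1v_1+\cdots+u_nv_n$; for multi-indices $\alpha\in\mathbb{Z}_+^n$: $|\alpha|=\alpha_1+\cdots+\alpha_n$, $\alpha!=\alpha_1!\cdots\alpha_n!$, $x^\alpha=x_1^{\alpha_1}\cdots x_n^{\alpha_n}$, $D^\alpha=\partial^{|\alpha|}/\partial x_1^{\alpha_1}\cdots\partial x_n^{\alpha_n}$. $\mathcal{H}=\{h_\nu\}_{\nu=1}^\infty$ is a fixed family of convex functions $h_\nu\colon\mathbb{R}^n\to\mathbb{R}$ such that for each $\nu\in\mathbb{N}$: 1) $h_\nu(x)=h_\nu(|x_1|,\ldots,|x_n|)$ for $x\in\mathbb{R}^n$; 2) the restriction of $h_\nu$ to $[0,\infty)^n$ is nondecreasing in each variable; 3) $\lim_{x\to\infty} h_\nu(x)/\|x\|=+\infty$; 4) for each $M>0$ there exists a constant $A_{\nu,M}>0$ such that $h_\nu(x)\le\sum_{1\le j\le n:\,x_j\ne0}x_j\ln\frac{x_j}{M}+A_{\nu,M}$ for $x\in[0,\infty)^n$; 5) there is a constant $\gamma_\nu$ with $h_\nu(x)-h_{\nu+1}(x)\ge\ln2\cdot\sum_{j=1}^n x_j-\gamma_\nu$ for $x\in[0,\infty)^n$; 6) there is a constant $l_\nu$ with $h_{\nu+1}(x+y)\le h_\nu(x)+h_\nu(y)+l_\nu$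 for $x,y\in[0,\infty)^n$. For $\nu\in\mathbb{N}$, $m\in\mathbb{Z}_+$, let $$G_m(h_\nu)=\Big\{f\in C^m(\mathbb{R}^n):\ \|f\|_{m,h_\nu}=\sup_{x\in\mathbb{R}^n,\ \beta\in\mathbb{Z}_+^n,\ |\alpha|\le m}\frac{|x^\beta(D^\alpha f)(x)|}{\beta!\,e^{-h_\nu(\beta)}}<\infty\Big\},$$ $G(h_\nu)=\bigcap_{m\ge0}G_m(h_\nu)$ with the topology defined by the norms $\|\cdot\|_{m,h_\nu}$ ($m\in\mathbb{Z}_+$), and $G(\mathcal{H})=\bigcup_{\nu\ge1}G(h_\nu)$ with the inductive limit topology of the spaces $G(h_\nu)$. For $\nu\in\mathbb{N}$, $m\in\mathbb{Z}_+$, let $$\mathcal{E}_m(h_\nu)=\Big\{f\in C^\infty(\mathbb{R}^n):\ \rho_{m,\nu}(f)=\sup_{x\in\mathbb{R}^n,\ \alpha\in\mathbb{Z}_+^n}\frac{(1+\|x\|)^m|(D^\alpha f)(x)|}{\alpha!\,e^{-h_\nu(\alpha)}}<\infty\Big\},$$ $\mathcal{E}(h_\nu)=\bigcap_{m\ge0}\mathcal{E}_m(h_\nu)$ with the topology defined by the norms $\rho_{m,\nu}$ ($m\in\mathbb{Z}_+$), and $\mathcal{E}(\mathcal{H})=\bigcup_{\nu\ge1}\mathcal{E}(h_\nu)$ with the inductive limit topology of the spaces $\mathcal{E}(h_\nu)$. For $f\in G(\mathcal{H})$, $\hat f(x)=\frac{1}{(\sqrt{2\pi})^n}\int_{\mathbb{R}^n}f(\xi)e^{i\langle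 x,\xi\rangle}\,d\xi$, $x\in\mathbb{R}^n$. "Isomorphism" means isomorphism of topological vector spaces; inductive limits are taken in the locally convex sense. *)

theory Defs
  imports "HOL-Analysis.Analysis"
begin

section \<open>Multi-indices and partial derivatives\<close>

text \<open>Points are of type \<open>real ^ 'n\<close> and multi-indices of type \<open>'n \<Rightarrow> nat\<close>, so the
  dimension is \<open>CARD('n)\<close>.\<close>

definition mi_order :: "('n::finite \<Rightarrow> nat) \<Rightarrow> nat" where
  "mi_order \<alpha> = (\<Sum>j\<in>UNIV. \<alpha> j)"

definition mi_fact :: "('n::finite \<Rightarrow> nat) \<Rightarrow> real" where
  "mi_fact \<alpha> = (\<Prod>j\<in>UNIV. fact (\<alpha> j))"

definition mi_power :: "real ^ 'n::finite \<Rightarrow> ('n \<Rightarrow> nat) \<Rightarrow> real" where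
  "mi_power x \<alpha> = (\<Prod>j\<in>UNIV. (x $ j) ^ \<alpha> j)"

definition mi_vec :: "('n::finite \<Rightarrow> nat) \<Rightarrow> real ^ 'n" where
  "mi_vec \<alpha> = (\<chi> j. real (\<alpha> j))"

definition partial_deriv :: "'n::finite \<Rightarrow> (real ^ 'n \<Rightarrow> complex) \<Rightarrow> real ^ 'n \<Rightarrow> complex" where
  "partial_deriv j f x = vector_derivative (\<lambda>t. f (x + t *\<^sub>R axis j 1)) (at 0)"

text \<open>\<open>C_class m f\<close>: all iterated partial derivatives of \<open>f\<close> up to order \<open>m\<close>, taken in any order
  of the variables, exist everywhere and are continuous.\<close>

primrec C_class :: "nat \<Rightarrow> (real ^ 'n::finite \<Rightarrow> complex) \<Rightarrow> bool" where
  "C_class 0 f \<longleftrightarrow> continuous_on UNIV f"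
| "C_class (Suc m) f \<longleftrightarrow> continuous_on UNIV f \<and>
     (\<forall>j. (\<forall>x. (\<lambda>t. f (x + t *\<^sub>R axis j 1)) differentiable (at (0::real))) \<and>
          C_class m (partial_deriv j f))"

definition coords :: "'n::finite list" where
  "coords = (SOME js. distinct js \<and> set js = UNIV)"

text \<open>The coordinates are ordered by the fixed enumeration \<open>coords\<close>. The order is immaterial for the
  functions below, whose mixed derivatives of the relevant orders are continuous.\<close>

definition mi_deriv :: "('n::finite \<Rightarrow> nat) \<Rightarrow> (real ^ 'n \<Rightarrow> complex) \<Rightarrow> real ^ 'n \<Rightarrow> complex" where
  "mi_deriv \<alpha> f = foldr (\<lambda>j. partial_deriv j ^^ \<alpha> j) coords f"


section \<open>Locally convex topologies on spaces of complex-valued functions\<close>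

text \<open>The functions \<open>p m\<close> are (extended-valued) norms that are finite on \<open>V\<close>.\<close>

definition norms_topology ::
    "('x \<Rightarrow> complex) set \<Rightarrow> (nat \<Rightarrow> ('x \<Rightarrow> complex) \<Rightarrow> ennreal) \<Rightarrow> ('x \<Rightarrow> complex) topology" where
  "norms_topology V p =
     topology_generated_by
       {{g \<in> V. p m (\<lambda>x. g x - f x) < ennreal \<epsilon>} | f m \<epsilon>. f \<in> V \<and> \<epsilon> > 0}"

definition locally_convex_topology ::
    "('x \<Rightarrow> complex) set \<Rightarrow> ('x \<Rightarrow> complex) topology \<Rightarrow> bool" where
  "locally_convex_topology V T \<longleftrightarrow>
     topspace T = V \<and>
     continuous_map (prod_topology T T) T (\<lambda>(f, g). \<lambda>x. f x + g x) \<and>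
     continuous_map (prod_topology euclidean T) T (\<lambda>(c, f). \<lambda>x. c * f x) \<and>
     (\<forall>U. openin T U \<and> (\<lambda>x. 0) \<in> U \<longrightarrow>
        (\<exists>W. openin T W \<and> (\<lambda>x. 0) \<in> W \<and> W \<subseteq> U \<and>
             (\<forall>f\<in>W. \<forall>g\<in>W. \<forall>t\<in>{0..1::real}.
                (\<lambda>x. of_real (1 - t) * f x + of_real t * g x) \<in> W)))"

text \<open>The finest locally convex topology on the union of the spaces \<open>V i\<close> that makes all inclusions
  continuous. It is generated by (in fact equal to) the union of all such topologies, since suprema
  of locally convex topologies are locally convex.\<close>

definition inductive_limit_topology ::
    "'i set \<Rightarrow> ('i \<Rightarrow> ('x \<Rightarrow> complex) set) \<Rightarrow> ('i \<Rightarrow> ('x \<Rightarrow> complex) topology) \<Rightarrow>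
     ('x \<Rightarrow> complex) topology" where
  "inductive_limit_topology I V T =
     topology_generated_by
       {U. \<exists>S. locally_convex_topology (\<Union>i\<in>I. V i) S \<and>
               (\<forall>i\<in>I. continuous_map (T i) S (\<lambda>f. f)) \<and> openin S U}"

definition tvs_isomorphism ::
    "('x \<Rightarrow> complex) set \<Rightarrow> ('x \<Rightarrow> complex) topology \<Rightarrow>
     ('y \<Rightarrow> complex) set \<Rightarrow> ('y \<Rightarrow> complex) topology \<Rightarrow>
     (('x \<Rightarrow> complex) \<Rightarrow> ('y \<Rightarrow> complex)) \<Rightarrow> bool" where
  "tvs_isomorphism V T W S F \<longleftrightarrow>
     topspace T = V \<and> topspace S = W \<and>
     (\<forall>f\<in>V. \<forall>g\<in>V. F (\<lambda>x. f x + g x) = (\<lambda>y. F f y + F g y)) \<and>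
     (\<forall>c. \<forall>f\<in>V. F (\<lambda>x. c * f x) = (\<lambda>y. c * F f y)) \<and>
     bij_betw F V W \<and>
     homeomorphic_map T S F"


section \<open>The spaces $G(\mathcal{H})$ and $\mathcal{E}(\mathcal{H})$\<close>

definition G_norm ::
    "(real ^ 'n::finite \<Rightarrow> real) \<Rightarrow> nat \<Rightarrow> (real ^ 'n \<Rightarrow> complex) \<Rightarrow> ennreal" where
  "G_norm h m f =
     (SUP x. SUP \<beta>. SUP \<alpha>\<in>{\<alpha>. mi_order \<alpha> \<le> m}.
        ennreal (cmod (of_real (mi_power x \<beta>) * mi_deriv \<alpha> f x) /
                 (mi_fact \<beta> * exp (- h (mi_vec \<beta>)))))"

definition G_m_space :: "nat \<Rightarrow> (real ^ 'n::finite \<Rightarrow> real) \<Rightarrow> (real ^ 'n \<Rightarrow> complex) set" where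
  "G_m_space m h = {f. C_class m f \<and> G_norm h m f < \<infinity>}"

definition G_space :: "(real ^ 'n::finite \<Rightarrow> real) \<Rightarrow> (real ^ 'n \<Rightarrow> complex) set" where
  "G_space h = (\<Inter>m. G_m_space m h)"

definition G_topology :: "(real ^ 'n::finite \<Rightarrow> real) \<Rightarrow> (real ^ 'n \<Rightarrow> complex) topology" where
  "G_topology h = norms_topology (G_space h) (G_norm h)"

definition G_union :: "(nat \<Rightarrow> real ^ 'n::finite \<Rightarrow> real) \<Rightarrow> (real ^ 'n \<Rightarrow> complex) set" where
  "G_union H = (\<Union>\<nu>\<in>{1..}. G_space (H \<nu>))"

definition G_lim_topology ::
    "(nat \<Rightarrow> real ^ 'n::finite \<Rightarrow> real) \<Rightarrow> (real ^ 'n \<Rightarrow> complex) topology" where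
  "G_lim_topology H =
     inductive_limit_topology {1..} (\<lambda>\<nu>. G_space (H \<nu>)) (\<lambda>\<nu>. G_topology (H \<nu>))"

definition E_norm ::
    "(real ^ 'n::finite \<Rightarrow> real) \<Rightarrow> nat \<Rightarrow> (real ^ 'n \<Rightarrow> complex) \<Rightarrow> ennreal" where
  "E_norm h m f =
     (SUP x. SUP \<alpha>.
        ennreal ((1 + norm x) ^ m * cmod (mi_deriv \<alpha> f x) /
                 (mi_fact \<alpha> * exp (- h (mi_vec \<alpha>)))))"

definition E_m_space :: "nat \<Rightarrow> (real ^ 'n::finite \<Rightarrow> real) \<Rightarrow> (real ^ 'n \<Rightarrow> complex) set" where
  "E_m_space m h = {f. (\<forall>k. C_class k f) \<and> E_norm h m f < \<infinity>}"

definition E_space :: "(real ^ 'n::finite \<Rightarrow> real) \<Rightarrow> (real ^ 'n \<Rightarrow> complex) set" where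
  "E_space h = (\<Inter>m. E_m_space m h)"

definition E_topology :: "(real ^ 'n::finite \<Rightarrow> real) \<Rightarrow> (real ^ 'n \<Rightarrow> complex) topology" where
  "E_topology h = norms_topology (E_space h) (E_norm h)"

definition E_union :: "(nat \<Rightarrow> real ^ 'n::finite \<Rightarrow> real) \<Rightarrow> (real ^ 'n \<Rightarrow> complex) set" where
  "E_union H = (\<Union>\<nu>\<in>{1..}. E_space (H \<nu>))"

definition E_lim_topology ::
    "(nat \<Rightarrow> real ^ 'n::finite \<Rightarrow> real) \<Rightarrow> (real ^ 'n \<Rightarrow> complex) topology" where
  "E_lim_topology H =
     inductive_limit_topology {1..} (\<lambda>\<nu>. E_space (H \<nu>)) (\<lambda>\<nu>. E_topology (H \<nu>))"

definition fourier :: "(real ^ 'n::finite \<Rightarrow> complex) \<Rightarrow> real ^ 'n \<Rightarrow> complex" where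
  "fourier f x =
     of_real (1 / sqrt (2 * pi) ^ CARD('n)) *
     (LINT \<xi>|lborel. f \<xi> * exp (\<i> * of_real (x \<bullet> \<xi>)))"

end

theory Submission
  imports Defs "HOL-Probability.Characteristic_Functions" "HOL-Probability.Sinc_Integral"
begin

text \<open>For rapidly decreasing smooth \<open>f\<close>, the identities
  \<open>D\<^sup>\<alpha> \<F>f = i\<^bsup>|\<alpha>|\<^esup> \<F>(\<xi>\<^sup>\<alpha> f)\<close> and \<open>x\<^sup>\<beta> \<F>g = i\<^bsup>|\<beta>|\<^esup> \<F>(D\<^sup>\<beta> g)\<close> bound \<open>|x\<^sup>\<beta> D\<^sup>\<alpha> \<F>f|\<close> by a
  weighted supremum of \<open>D\<^sup>\<beta>(\<xi>\<^sup>\<alpha> f)\<close>. Expanding this by the Leibniz rule, the subadditivity condition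
  on \<open>h\<close> trades the shifts of multi-indices by bounded amounts, and the decrease by
  \<open>ln 2 \<cdot> \<Sum> x\<^sub>j\<close> absorbs the resulting factors \<open>2\<^bsup>|\<alpha>|\<^esup>\<close>. Hence \<open>\<F>\<close> maps \<open>G(h\<^sub>\<nu>)\<close> into
  \<open>E(h\<^bsub>\<nu>+2\<^esub>)\<close> and \<open>E(h\<^sub>\<nu>)\<close> into \<open>G(h\<^bsub>\<nu>+2\<^esub>)\<close> continuously. By Fourier inversion the inverse of
  \<open>\<F>\<close> is \<open>\<F>\<close> followed by \<open>x \<mapsto> -x\<close>, so it is continuous on the inductive limits as well.\<close>

section \<open>Multi-indices\<close>

text \<open>In each direction one of the two multi-indices is bounded by the order \<open>m\<close>
  of the norm and the other is arbitrary. A Leibniz index \<gamma> lies below both, so only bounded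
  shifts of the arbitrary one occur, with constants depending on \<open>m\<close> alone. The powers
  of 2 have different sources: from \<open>G\<close> to \<open>E\<close> they pay for the monomial
  that makes the integrals converge and raises the factorials, from \<open>E\<close> to
  \<open>G\<close> for the number of Leibniz terms. The shift correction and the power of 2 each
  cost one index, whence \<nu> + 2 for every \<open>m\<close>; this uniformity sends a whole step
  space into a single one. Everything that does not involve the weights takes place in the Schwartz
  space. Continuity on the limits rests on a universal property: locally convex topologies pull back
  along linear maps.\<close>

lemma coords: "distinct (coords :: 'n::finite list)" "set (coords :: 'n list) = UNIV"
proof -
  have "\<exists>js :: 'n list. distinct js \<and> set js = UNIV"
    using finite_distinct_list[of "UNIV :: 'n set"] by auto
  from someI_ex[OF this] show "distinct (coords :: 'n list)" "set (coords :: 'n list) = UNIV"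
    by (simp_all add: coords_def)
qed

definition mi_inc :: "'n \<Rightarrow> ('n \<Rightarrow> nat) \<Rightarrow> 'n \<Rightarrow> nat" where
  "mi_inc j \<alpha> = \<alpha>(j := Suc (\<alpha> j))"

text \<open>\<open>mi_low j \<alpha>\<close> says that \<open>\<partial>\<^sub>j\<close> may be applied to \<open>mi_deriv \<alpha> f\<close> without
  leaving the order of differentiation prescribed by \<open>coords\<close>. Inductions along this relation
  make the symmetry of mixed partial derivatives unnecessary.\<close>

definition mi_low :: "'n::finite \<Rightarrow> ('n \<Rightarrow> nat) \<Rightarrow> bool" where
  "mi_low j \<alpha> \<longleftrightarrow> (\<exists>xs ys. coords = xs @ j # ys \<and> (\<forall>k\<in>set xs. \<alpha> k = 0))"

lemma mi_low_mono: "mi_low j \<alpha> \<Longrightarrow> (\<And>k. \<beta> k \<le> \<alpha> k) \<Longrightarrow> mi_low j \<beta>"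
  unfolding mi_low_def by (metis le_zero_eq)

lemma mi_deriv_0 [simp]: "mi_deriv (\<lambda>_. 0) f = f"
proof -
  have "foldr (\<lambda>j. partial_deriv j ^^ 0) xs f = f" for xs :: "'a list"
    by (induction xs) auto
  then show ?thesis by (simp add: mi_deriv_def)
qed

text \<open>Coordinates listed before \<open>j\<close> have exponent 0 and contribute identity
  operators, so the block of \<open>partial_deriv j\<close> is outermost in the \<open>foldr\<close>
  and one more factor can be split off in front.\<close>

lemma mi_deriv_inc:
  assumes "mi_low j \<alpha>"
  shows "mi_deriv (mi_inc j \<alpha>) f = partial_deriv j (mi_deriv \<alpha> f)"
proof -
  obtain xs ys where c: "coords = xs @ j # ys" and z: "\<forall>k\<in>set xs. \<alpha> k = 0"
    using assms by (auto simp: mi_low_def)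
  have d: "distinct (xs @ j # ys)" using coords(1) c by metis
  have id: "foldr (\<lambda>k. partial_deriv k ^^ \<beta> k) zs g = g"
    if "\<forall>k\<in>set zs. \<beta> k = 0" for \<beta> zs and g :: "real ^ 'a \<Rightarrow> complex"
    using that by (induction zs) auto
  have "foldr (\<lambda>k. partial_deriv k ^^ mi_inc j \<alpha> k) ys f = foldr (\<lambda>k. partial_deriv k ^^ \<alpha> k) ys f"
    by (rule foldr_cong) (use d in \<open>auto simp: mi_inc_def\<close>)
  moreover have "\<forall>k\<in>set xs. mi_inc j \<alpha> k = 0" using z d by (auto simp: mi_inc_def)
  ultimately show ?thesis
    using z by (simp add: mi_deriv_def c id) (simp add: mi_inc_def)
qed

lemma mi_order_inc [simp]: "mi_order (mi_inc j \<alpha>) = Suc (mi_order \<alpha>)"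
proof -
  have "mi_order (mi_inc j \<alpha>) = (\<Sum>k\<in>UNIV. \<alpha> k + (if k = j then 1 else 0))"
    unfolding mi_order_def mi_inc_def by (rule sum.cong) auto
  also have "\<dots> = Suc (mi_order \<alpha>)" by (simp add: sum.distrib mi_order_def)
  finally show ?thesis .
qed

text \<open>Lowering the first coordinate in \<open>coords\<close> that has a nonzero exponent
  leaves it \<open>mi_low\<close>, since that relation only concerns the coordinates listed before
  it. Every multi-index is thus reached from 0 by admissible increments.\<close>

lemma mi_induct [case_names zero inc]:
  fixes \<alpha> :: "'n::finite \<Rightarrow> nat"
  assumes zero: "P (\<lambda>_. 0)"
    and inc: "\<And>j \<alpha>. mi_low j \<alpha> \<Longrightarrow> P \<alpha> \<Longrightarrow> P (mi_inc j \<alpha>)"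
  shows "P \<alpha>"
proof (induction "mi_order \<alpha>" arbitrary: \<alpha>)
  case 0
  then have "\<alpha> = (\<lambda>_. 0)" by (auto simp: mi_order_def)
  then show ?case using zero by simp
next
  case (Suc n)
  have "\<exists>j\<in>set (coords :: 'n list). \<alpha> j \<noteq> 0"
  proof (rule ccontr)
    assume "\<not> ?thesis"
    then have "mi_order \<alpha> = 0" using coords(2)[where ?'n = 'n] by (simp add: mi_order_def)
    then show False using Suc.hyps(2) by simp
  qed
  then obtain xs j ys where c: "coords = xs @ j # ys" "\<alpha> j \<noteq> 0" "\<forall>k\<in>set xs. \<not> \<alpha> k \<noteq> 0"
    using split_list_first_prop[of coords "\<lambda>j. \<alpha> j \<noteq> 0"] by metis
  define \<beta> where "\<beta> = \<alpha>(j := \<alpha> j - 1)"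
  have a: "\<alpha> = mi_inc j \<beta>" using c by (auto simp: \<beta>_def mi_inc_def)
  have "mi_low j \<beta>" unfolding mi_low_def \<beta>_def using c by fastforce
  moreover have "P \<beta>"
    using Suc.hyps a by (metis mi_order_inc nat.inject)
  ultimately show ?case using inc a by metis
qed

lemma mi_fact_pos [simp]: "mi_fact \<alpha> > 0" "mi_fact \<alpha> \<noteq> 0" "mi_fact \<alpha> \<ge> 0"
proof -
  show *: "mi_fact \<alpha> > 0" by (simp add: mi_fact_def prod_pos)
  show "mi_fact \<alpha> \<noteq> 0" "mi_fact \<alpha> \<ge> 0" using * by linarith+
qed

lemma mi_fact_inc: "mi_fact (mi_inc j \<alpha>) = real (Suc (\<alpha> j)) * mi_fact \<alpha>"
proof -
  have "mi_fact (mi_inc j \<alpha>) = (\<Prod>k\<in>UNIV. (if k = j then real (Suc (\<alpha> j)) else 1) * fact (\<alpha> k))"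
    unfolding mi_fact_def mi_inc_def by (rule prod.cong) auto
  then show ?thesis by (simp add: prod.distrib mi_fact_def)
qed

lemma mi_fact_mono: "(\<And>j. \<alpha> j \<le> \<beta> j) \<Longrightarrow> mi_fact \<alpha> \<le> mi_fact \<beta>"
  unfolding mi_fact_def by (intro prod_mono) (auto intro: fact_mono)

lemma mi_power_0 [simp]: "mi_power x (\<lambda>_. 0) = 1"
  by (simp add: mi_power_def)

lemma mi_power_inc: "mi_power x (mi_inc j \<alpha>) = x $ j * mi_power x \<alpha>"
proof -
  have "mi_power x (mi_inc j \<alpha>) = (\<Prod>k\<in>UNIV. (if k = j then x $ j else 1) * x $ k ^ \<alpha> k)"
    unfolding mi_power_def mi_inc_def by (rule prod.cong) auto
  then show ?thesis by (simp add: prod.distrib mi_power_def)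
qed

lemma mi_power_add: "mi_power x (\<lambda>j. \<alpha> j + \<beta> j) = mi_power x \<alpha> * mi_power x \<beta>"
  by (simp add: mi_power_def power_add prod.distrib)

lemma abs_mi_power: "\<bar>mi_power x \<alpha>\<bar> = (\<Prod>j\<in>UNIV. \<bar>x $ j\<bar> ^ \<alpha> j)"
  by (simp add: mi_power_def abs_prod power_abs)

lemma abs_mi_power_minus [simp]: "\<bar>mi_power (- x) \<alpha>\<bar> = \<bar>mi_power x \<alpha>\<bar>"
  by (simp add: abs_mi_power)

lemma mi_le_order: "\<alpha> j \<le> mi_order \<alpha>"
  unfolding mi_order_def by (rule member_le_sum) auto

lemma mi_order_mono: "(\<And>j. \<alpha> j \<le> \<beta> j) \<Longrightarrow> mi_order \<alpha> \<le> mi_order \<beta>"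
  unfolding mi_order_def by (rule sum_mono) auto

lemma continuous_on_mi_power [continuous_intros]: "continuous_on A (\<lambda>x. mi_power x \<alpha>)"
  unfolding mi_power_def by (intro continuous_intros)

lemma abs_mi_power_le: "\<bar>mi_power x \<alpha>\<bar> \<le> (1 + norm x) ^ mi_order \<alpha>"
proof -
  have "\<bar>mi_power x \<alpha>\<bar> \<le> (\<Prod>j\<in>UNIV. (1 + norm x) ^ \<alpha> j)"
    unfolding abs_mi_power
    by (intro prod_mono conjI power_mono) (auto intro: order.trans[OF component_le_norm_cart])
  then show ?thesis by (simp add: mi_order_def power_sum)
qed

text \<open>Only large coordinates contribute to the weight, so up to a constant it is a monomial,
  which depends on the point.\<close>

lemma norm_power_le_mi_power:
  fixes x :: "real ^ 'n::finite"
  obtains \<beta> where "mi_order \<beta> \<le> m" "(1 + norm x) ^ m \<le> (1 + real CARD('n)) ^ m * \<bar>mi_power x \<beta>\<bar>"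
proof -
  obtain k where k: "\<And>j. \<bar>x $ j\<bar> \<le> \<bar>x $ k\<bar>"
    using finite_has_maximal[of "range (\<lambda>j. \<bar>x $ j\<bar>)"] 
    by (smt (verit, best) UNIV_I empty_iff finite finite_imageI imageE image_eqI)
  have n: "norm x \<le> real CARD('n) * \<bar>x $ k\<bar>"
    using order.trans[OF norm_le_l1_cart sum_bounded_above[of UNIV "\<lambda>j. \<bar>x $ j\<bar>" "\<bar>x $ k\<bar>"]] k
    by simp
  show thesis
  proof (cases "\<bar>x $ k\<bar> \<le> 1")
    case True
    have "(1 + norm x) ^ m \<le> (1 + real CARD('n)) ^ m"
      using order.trans[OF n mult_left_mono[OF True]] by (intro power_mono) auto
    then show ?thesis by (intro that[of "\<lambda>_. 0"]) (auto simp: mi_order_def)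
  next
    case False
    have "(1 + norm x) \<le> (1 + real CARD('n)) * \<bar>x $ k\<bar>"
      using n False by (simp add: algebra_simps)
    then have "(1 + norm x) ^ m \<le> ((1 + real CARD('n)) * \<bar>x $ k\<bar>) ^ m"
      by (intro power_mono) auto
    then show ?thesis
      by (intro that[of "\<lambda>j. if j = k then m else 0"])
        (auto simp: mi_order_def abs_mi_power if_distrib[of "\<lambda>i. _ ^ i"] power_mult_distrib
          cong: if_cong)
  qed
qed

text \<open>A product of one-variable factors, so that its reciprocal is integrable by a product
  formula. It has degree 2 in each variable, which keeps the loss in factorials polynomial.\<close>

definition weight :: "real ^ 'n::finite \<Rightarrow> real" where
  "weight x = (\<Prod>j\<in>UNIV. 1 + (x $ j)\<^sup>2)"

lemma weight_pos: "weight x > 0"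
  unfolding weight_def by (intro prod_pos) (auto intro: add_pos_nonneg)

lemma weight_le_norm: "weight (x :: real ^ 'n::finite) \<le> (1 + norm x) ^ (2 * CARD('n))"
proof -
  have "1 + (x $ j)\<^sup>2 \<le> (1 + norm x)\<^sup>2" for j
  proof -
    have "1 + (x $ j)\<^sup>2 \<le> (1 + \<bar>x $ j\<bar>)\<^sup>2" by (simp add: power2_sum)
    also have "\<dots> \<le> (1 + norm x)\<^sup>2" by (intro power_mono) (auto simp: component_le_norm_cart)
    finally show ?thesis .
  qed
  then have "weight x \<le> (\<Prod>j\<in>(UNIV :: 'n set). (1 + norm x)\<^sup>2)"
    unfolding weight_def by (intro prod_mono) auto
  then show ?thesis by (simp add: power_mult)
qed

text \<open>In each variable \<open>1 + t^2\<close> is at most 2 if |t| \<le> 1 and at most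
  \<open>2 * t^2\<close> otherwise, so exponents 0 and 2 suffice. Which of them occurs depends on
  \<open>x\<close>; the bound on \<sigma> does not.\<close>

lemma weight_le_mi_power:
  fixes x :: "real ^ 'n::finite"
  obtains \<sigma> where "\<And>j. \<sigma> j \<le> 2" "weight x \<le> 2 ^ CARD('n) * \<bar>mi_power x \<sigma>\<bar>"
proof
  define \<sigma> :: "'n \<Rightarrow> nat" where "\<sigma> = (\<lambda>j. if \<bar>x $ j\<bar> > 1 then 2 else 0)"
  show "\<sigma> j \<le> 2" for j by (simp add: \<sigma>_def)
  have "1 + (x $ j)\<^sup>2 \<le> 2 * \<bar>x $ j\<bar> ^ \<sigma> j" for j
    using power_mono[of 1 "\<bar>x $ j\<bar>" 2] power_mono[of "\<bar>x $ j\<bar>" 1 2] by (auto simp: \<sigma>_def)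
  then have "weight x \<le> (\<Prod>j\<in>UNIV. 2 * \<bar>x $ j\<bar> ^ \<sigma> j)"
    unfolding weight_def by (intro prod_mono) auto
  then show "weight x \<le> 2 ^ CARD('n) * \<bar>mi_power x \<sigma>\<bar>"
    by (simp add: abs_mi_power prod.distrib)
qed

section \<open>Smooth functions\<close>

definition smooth :: "(real ^ 'n::finite \<Rightarrow> complex) \<Rightarrow> bool" where
  "smooth f \<longleftrightarrow> (\<forall>k. C_class k f)"

text \<open>Smoothness is a greatest fixed point. Coinduction suits families closed under
  differentiation, such as multiples of Fourier transforms of moments, where no order has to be
  tracked.\<close>

lemma smooth_coinduct:
  assumes "f \<in> S"
    and "\<And>f. f \<in> S \<Longrightarrow> continuous_on UNIV f"
    and "\<And>f j x. f \<in> S \<Longrightarrow> (\<lambda>t. f (x + t *\<^sub>R axis j 1)) differentiable (at (0::real))"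
    and "\<And>f j. f \<in> S \<Longrightarrow> partial_deriv j f \<in> S"
  shows "smooth f"
proof -
  have "C_class k f" if "f \<in> S" for k f
    using that by (induction k arbitrary: f) (auto intro: assms)
  then show ?thesis using assms(1) by (auto simp: smooth_def)
qed

lemma smooth_continuous: "smooth f \<Longrightarrow> continuous_on UNIV f"
  unfolding smooth_def by (metis C_class.simps(1))

lemma smooth_partial_deriv: "smooth f \<Longrightarrow> smooth (partial_deriv j f)"
  unfolding smooth_def by (metis C_class.simps(2))

lemma smooth_has_partial_deriv_at_0:
  assumes "smooth f"
  shows "((\<lambda>t. f (x + t *\<^sub>R axis j 1)) has_vector_derivative partial_deriv j f x) (at 0)"
proof -
  have "(\<lambda>t. f (x + t *\<^sub>R axis j 1)) differentiable (at (0::real))"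
    using assms unfolding smooth_def by (metis C_class.simps(2))
  then show ?thesis
    unfolding partial_deriv_def by (metis vector_derivative_works)
qed

text \<open>Moving the base point turns the derivative at 0 into the derivative at an arbitrary
  parameter of the line, the form that the fundamental theorem of calculus requires.\<close>

lemma smooth_has_partial_deriv:
  assumes "smooth f"
  shows "((\<lambda>t. f (x + t *\<^sub>R axis j 1)) has_vector_derivative
           partial_deriv j f (x + s *\<^sub>R axis j 1)) (at s)"
proof -
  have "((\<lambda>t. f ((x + s *\<^sub>R axis j 1) + t *\<^sub>R axis j 1)) has_vector_derivative
      partial_deriv j f (x + s *\<^sub>R axis j 1)) (at (s - s))"
    using smooth_has_partial_deriv_at_0[OF assms] by simp
  then have "((\<lambda>t. f ((x + s *\<^sub>R axis j 1) + t *\<^sub>R axis j 1)) \<circ> (\<lambda>t. t - s) has_vector_derivative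
      1 *\<^sub>R partial_deriv j f (x + s *\<^sub>R axis j 1)) (at s)"
    by (intro vector_diff_chain_at) (auto intro!: derivative_eq_intros)
  then show ?thesis by (simp add: o_def algebra_simps)
qed

lemma partial_deriv_eqI:
  "((\<lambda>t. f (x + t *\<^sub>R axis j 1)) has_vector_derivative d) (at 0) \<Longrightarrow> partial_deriv j f x = d"
  unfolding partial_deriv_def by (rule vector_derivative_at)

lemma smooth_mi_deriv: "smooth f \<Longrightarrow> smooth (mi_deriv \<alpha> f)"
  by (induction \<alpha> rule: mi_induct) (auto simp: mi_deriv_inc smooth_partial_deriv)

lemma partial_deriv_zero [simp]: "partial_deriv j (\<lambda>x. 0) = (\<lambda>x. 0)"
  by (rule ext, rule partial_deriv_eqI) (auto intro!: derivative_eq_intros)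

lemma smooth_zero [simp]: "smooth (\<lambda>x. 0)"
  by (rule smooth_coinduct[of _ "{\<lambda>x. 0}"]) auto

lemma partial_deriv_add:
  "smooth f \<Longrightarrow> smooth g \<Longrightarrow>
    partial_deriv j (\<lambda>x. f x + g x) = (\<lambda>x. partial_deriv j f x + partial_deriv j g x)"
  by (rule ext, rule partial_deriv_eqI)
    (auto intro!: derivative_eq_intros smooth_has_partial_deriv_at_0)

lemma partial_deriv_cmult:
  "smooth f \<Longrightarrow> partial_deriv j (\<lambda>x. c * f x) = (\<lambda>x. c * partial_deriv j f x)"
  by (rule ext, rule partial_deriv_eqI)
    (auto intro!: derivative_eq_intros smooth_has_partial_deriv_at_0)

lemma partial_deriv_minus_arg:
  assumes "smooth f"
  shows "partial_deriv j (\<lambda>x. f (- x)) = (\<lambda>x. - partial_deriv j f (- x))"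
    and "(\<lambda>t. f (- (x + t *\<^sub>R axis j 1))) differentiable (at (0::real))"
proof -
  have *: "((\<lambda>t. f (- (x + t *\<^sub>R axis j 1))) has_vector_derivative - partial_deriv j f (- x)) (at 0)"
    for x
  proof -
    have "((\<lambda>t. f (- x + t *\<^sub>R axis j 1)) \<circ> uminus has_vector_derivative
        (- 1) *\<^sub>R partial_deriv j f (- x)) (at (0::real))"
      by (intro vector_diff_chain_at)
        (use smooth_has_partial_deriv_at_0[OF assms, of "- x" j] in
          \<open>auto intro!: derivative_eq_intros\<close>)
    moreover have "(\<lambda>t. f (- x + t *\<^sub>R axis j 1)) \<circ> uminus = (\<lambda>t. f (- (x + t *\<^sub>R axis j 1)))"
    proof
      fix t :: real
      have "- x + (- t) *\<^sub>R axis j 1 = - (x + t *\<^sub>R axis j 1)" by (simp add: vec_eq_iff)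
      then show "((\<lambda>t. f (- x + t *\<^sub>R axis j 1)) \<circ> uminus) t = f (- (x + t *\<^sub>R axis j 1))"
        unfolding o_def by presburger
    qed
    ultimately show ?thesis by simp
  qed
  show "partial_deriv j (\<lambda>x. f (- x)) = (\<lambda>x. - partial_deriv j f (- x))"
    by (rule ext, rule partial_deriv_eqI, rule *)
  show "(\<lambda>t. f (- (x + t *\<^sub>R axis j 1))) differentiable (at (0::real))"
    using * by (rule differentiableI_vector)
qed

text \<open>Kept at a fixed order \<open>k\<close>: the derivative of a monomial times a function is
  a sum of two such products, and the induction showing their smoothness adds them at the order
  reached so far.\<close>

lemma C_class_add:
  "C_class k f \<Longrightarrow> C_class k g \<Longrightarrow> C_class k (\<lambda>x. f x + g x)"
proof (induction k arbitrary: f g)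
  case 0
  then show ?case by (auto intro: continuous_intros)
next
  case (Suc k)
  have d: "(\<lambda>t. u (x + t *\<^sub>R axis j 1)) differentiable (at (0::real))"
    if "C_class (Suc k) u" for u :: "real ^ 'a \<Rightarrow> complex" and x j
    using that by simp
  have "partial_deriv j (\<lambda>x. f x + g x) = (\<lambda>x. partial_deriv j f x + partial_deriv j g x)" for j
    by (rule ext, rule partial_deriv_eqI) (auto simp: partial_deriv_def vector_derivative_works[symmetric]
        intro!: has_vector_derivative_add d Suc.prems)
  then show ?case using Suc by (auto intro!: continuous_intros)
qed

lemma smooth_add: "smooth f \<Longrightarrow> smooth g \<Longrightarrow> smooth (\<lambda>x. f x + g x)"
  by (auto simp: smooth_def intro: C_class_add)

lemma smooth_cmult:
  assumes "smooth f"
  shows "smooth (\<lambda>x. c * f x)"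
proof (rule smooth_coinduct[of _ "{\<lambda>x. c * f x | f. smooth f}"])
  fix u j assume "u \<in> {\<lambda>x. c * f x | f. smooth (f :: real ^ 'a \<Rightarrow> complex)}"
  then obtain f where u: "u = (\<lambda>x. c * f x)" and f: "smooth f" by auto
  show "continuous_on UNIV u" unfolding u by (intro continuous_intros smooth_continuous f)
  show "(\<lambda>t. u (x + t *\<^sub>R axis j 1)) differentiable (at (0::real))" for x
    unfolding u by (rule differentiableI_vector)
      (auto intro!: derivative_eq_intros smooth_has_partial_deriv_at_0 f)
  show "partial_deriv j u \<in> {\<lambda>x. c * f x | f. smooth f}"
    unfolding u partial_deriv_cmult[OF f] using smooth_partial_deriv f by blast
qed (use assms in auto)

lemma smooth_minus_arg:
  assumes "smooth f"
  shows "smooth (\<lambda>x. f (- x))"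
proof (rule smooth_coinduct[of _ "{\<lambda>x. f (- x) | f. smooth f}"])
  fix u j assume "u \<in> {\<lambda>x. f (- x) | f. smooth (f :: real ^ 'a \<Rightarrow> complex)}"
  then obtain f where u: "u = (\<lambda>x. f (- x))" and f: "smooth f" by auto
  show "continuous_on UNIV u" unfolding u
    using smooth_continuous[OF f]
    by (auto intro!: continuous_on_compose2[of UNIV f UNIV uminus] continuous_intros)
  show "(\<lambda>t. u (x + t *\<^sub>R axis j 1)) differentiable (at (0::real))" for x
    unfolding u using partial_deriv_minus_arg(2)[OF f] .
  have "partial_deriv j u = (\<lambda>x. (\<lambda>y. (- 1) * partial_deriv j f y) (- x))"
    unfolding u partial_deriv_minus_arg(1)[OF f] by simp
  moreover have "smooth (\<lambda>y. (- 1) * partial_deriv j f y)"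
    by (rule smooth_cmult[OF smooth_partial_deriv[OF f]])
  ultimately show "partial_deriv j u \<in> {\<lambda>x. f (- x) | f. smooth f}"
    by (intro CollectI exI[of _ "\<lambda>y. (- 1) * partial_deriv j f y"] conjI) simp_all
qed (use assms in auto)

lemma mi_deriv_add:
  "smooth f \<Longrightarrow> smooth g \<Longrightarrow>
    mi_deriv \<alpha> (\<lambda>x. f x + g x) = (\<lambda>x. mi_deriv \<alpha> f x + mi_deriv \<alpha> g x)"
  by (induction \<alpha> rule: mi_induct)
    (auto simp: mi_deriv_inc partial_deriv_add smooth_mi_deriv)

lemma mi_deriv_cmult:
  "smooth f \<Longrightarrow> mi_deriv \<alpha> (\<lambda>x. c * f x) = (\<lambda>x. c * mi_deriv \<alpha> f x)"
  by (induction \<alpha> rule: mi_induct)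
    (auto simp: mi_deriv_inc partial_deriv_cmult smooth_mi_deriv)

lemma mi_deriv_zero [simp]: "mi_deriv \<alpha> (\<lambda>x. 0) = (\<lambda>x. 0)"
  by (induction \<alpha> rule: mi_induct) (auto simp: mi_deriv_inc)

lemma mi_deriv_minus_arg:
  assumes "smooth f"
  shows "mi_deriv \<alpha> (\<lambda>x. f (- x)) = (\<lambda>x. (- 1) ^ mi_order \<alpha> * mi_deriv \<alpha> f (- x))"
proof (induction \<alpha> rule: mi_induct)
  case zero
  then show ?case by (simp add: mi_order_def)
next
  case (inc j \<alpha>)
  have "partial_deriv j (\<lambda>x. (- 1) ^ mi_order \<alpha> * mi_deriv \<alpha> f (- x))
      = (\<lambda>x. (- 1) ^ mi_order \<alpha> * - partial_deriv j (mi_deriv \<alpha> f) (- x))"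
    by (simp add: partial_deriv_cmult partial_deriv_minus_arg smooth_minus_arg smooth_mi_deriv assms)
  then show ?case using inc by (simp add: mi_deriv_inc)
qed

lemma mi_deriv_continuous: "smooth f \<Longrightarrow> continuous_on UNIV (mi_deriv \<alpha> f)"
  by (intro smooth_continuous smooth_mi_deriv)

section \<open>The Leibniz rule\<close>

lemma mi_power_axis:
  "mi_power (x + t *\<^sub>R axis j 1) \<alpha> = (x $ j + t) ^ \<alpha> j * (\<Prod>k\<in>UNIV - {j}. x $ k ^ \<alpha> k)"
proof -
  have "mi_power (x + t *\<^sub>R axis j 1) \<alpha> = (x $ j + t) ^ \<alpha> j *
      (\<Prod>k\<in>UNIV - {j}. (x + t *\<^sub>R axis j 1) $ k ^ \<alpha> k)"
    unfolding mi_power_def by (subst prod.remove[of UNIV j]) auto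
  also have "(\<Prod>k\<in>UNIV - {j}. (x + t *\<^sub>R axis j 1) $ k ^ \<alpha> k) = (\<Prod>k\<in>UNIV - {j}. x $ k ^ \<alpha> k)"
    by (rule prod.cong) (auto simp: axis_def)
  finally show ?thesis .
qed

text \<open>For \<alpha> j = 0 truncated subtraction leaves the exponent unchanged, but the
  coefficient \<open>real (\<alpha> j)\<close> is then 0.\<close>

lemma mi_power_has_derivative_axis:
  "((\<lambda>t. mi_power (x + t *\<^sub>R axis j 1) \<alpha>) has_real_derivative
      real (\<alpha> j) * mi_power x (\<alpha>(j := \<alpha> j - 1))) (at 0)"
proof -
  have "mi_power x (\<alpha>(j := \<alpha> j - 1)) = x $ j ^ (\<alpha> j - 1) * (\<Prod>k\<in>UNIV - {j}. x $ k ^ \<alpha> k)"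
    unfolding mi_power_def by (subst prod.remove[of UNIV j]) (auto intro!: prod.cong)
  then show ?thesis
    unfolding mi_power_axis by (auto intro!: derivative_eq_intros)
qed

lemma has_partial_deriv_mi_power_times:
  assumes "smooth f"
  shows "((\<lambda>t. of_real (mi_power (x + t *\<^sub>R axis j 1) \<alpha>) * f (x + t *\<^sub>R axis j 1))
     has_vector_derivative
       (of_real (real (\<alpha> j) * mi_power x (\<alpha>(j := \<alpha> j - 1))) * f x
        + of_real (mi_power x \<alpha>) * partial_deriv j f x)) (at 0)"
proof -
  have "((\<lambda>t. complex_of_real (mi_power (x + t *\<^sub>R axis j 1) \<alpha>)) has_vector_derivative
      of_real (real (\<alpha> j) * mi_power x (\<alpha>(j := \<alpha> j - 1)))) (at 0)"
    using mi_power_has_derivative_axis by (intro has_vector_derivative_of_real)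
      (simp add: has_real_derivative_iff_has_vector_derivative)
  from has_vector_derivative_mult[OF this smooth_has_partial_deriv_at_0[OF assms, of x j]]
  show ?thesis by (simp add: algebra_simps)
qed

lemma partial_deriv_mi_power_times:
  "smooth f \<Longrightarrow> partial_deriv j (\<lambda>x. of_real (mi_power x \<alpha>) * f x) =
    (\<lambda>x. of_real (real (\<alpha> j) * mi_power x (\<alpha>(j := \<alpha> j - 1))) * f x
        + of_real (mi_power x \<alpha>) * partial_deriv j f x)"
  by (rule ext, rule partial_deriv_eqI, rule has_partial_deriv_mi_power_times)

lemma smooth_mi_power_times:
  assumes "smooth f"
  shows "smooth (\<lambda>x. of_real (mi_power x \<alpha>) * f x)"
proof -
  have "C_class k (\<lambda>x. of_real (mi_power x \<alpha>) * f x)" for k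
    using assms
  proof (induction k arbitrary: \<alpha> f)
    case 0
    then show ?case by (simp, intro continuous_intros smooth_continuous)
  next
    case (Suc k)
    have "C_class k (partial_deriv j (\<lambda>x. of_real (mi_power x \<alpha>) * f x))" for j
    proof -
      have "C_class k (\<lambda>x. of_real (mi_power x (\<alpha>(j := \<alpha> j - 1))) * (of_real (real (\<alpha> j)) * f x))"
        by (intro Suc.IH smooth_cmult Suc.prems)
      moreover have "C_class k (\<lambda>x. of_real (mi_power x \<alpha>) * partial_deriv j f x)"
        by (intro Suc.IH smooth_partial_deriv Suc.prems)
      ultimately show ?thesis
        unfolding partial_deriv_mi_power_times[OF Suc.prems] by (auto dest: C_class_add simp: mult_ac)
    qed
    moreover have "(\<lambda>t. of_real (mi_power (x + t *\<^sub>R axis j 1) \<alpha>) * f (x + t *\<^sub>R axis j 1))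
        differentiable (at (0::real))" for x j
      by (rule differentiableI_vector, rule has_partial_deriv_mi_power_times, rule Suc.prems)
    moreover have "continuous_on UNIV (\<lambda>x. of_real (mi_power x \<alpha>) * f x)"
      by (intro continuous_intros smooth_continuous Suc.prems)
    ultimately show ?case by simp
  qed
  then show ?thesis by (simp add: smooth_def)
qed

lemma smooth_sum_list:
  "(\<And>i. i \<in> set L \<Longrightarrow> smooth (f i)) \<Longrightarrow> smooth (\<lambda>x. \<Sum>i\<leftarrow>L. f i x)"
  by (induction L) (auto intro!: smooth_add)

lemma partial_deriv_sum_list:
  "(\<And>i. i \<in> set L \<Longrightarrow> smooth (f i)) \<Longrightarrow>
    partial_deriv j (\<lambda>x. \<Sum>i\<leftarrow>L. f i x) = (\<lambda>x. \<Sum>i\<leftarrow>L. partial_deriv j (f i) x)"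
  by (induction L) (auto simp: partial_deriv_add smooth_sum_list)

text \<open>The multi-index \<gamma> counts the derivatives that fall on the monomial: coefficient
  and power together are \<open>D^\<gamma>\<close> of \<open>x^\<alpha>\<close>. There is no
  binomial coefficient, because repeated \<gamma> are kept as separate terms. The truncated
  differences are genuine as long as \<gamma> lies below both \<alpha> and \<beta>.\<close>

definition leibniz_term ::
    "('n::finite \<Rightarrow> nat) \<Rightarrow> ('n \<Rightarrow> nat) \<Rightarrow> (real ^ 'n \<Rightarrow> complex) \<Rightarrow> ('n \<Rightarrow> nat) \<Rightarrow> real ^ 'n \<Rightarrow> complex"
  where "leibniz_term \<beta> \<alpha> f \<gamma> x = of_real (mi_fact \<alpha> / mi_fact (\<lambda>j. \<alpha> j - \<gamma> j)) *
    (of_real (mi_power x (\<lambda>j. \<alpha> j - \<gamma> j)) * mi_deriv (\<lambda>j. \<beta> j - \<gamma> j) f x)"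

lemma smooth_leibniz_term: "smooth f \<Longrightarrow> smooth (leibniz_term \<beta> \<alpha> f \<gamma>)"
  unfolding leibniz_term_def by (intro smooth_cmult smooth_mi_power_times smooth_mi_deriv)

text \<open>A further derivative either hits \<open>f\<close>, raising \<beta> alone, or hits the
  monomial, raising \<beta> and \<gamma> together. If \<open>\<gamma> j = \<alpha> j\<close> the
  monomial no longer contains \<open>x $ j\<close>; truncated subtraction would not make the second
  term vanish by itself, hence the case distinction.\<close>

lemma partial_deriv_leibniz_term:
  assumes f: "smooth f" and low: "mi_low j \<beta>" and le: "\<And>k. \<gamma> k \<le> \<beta> k" "\<And>k. \<gamma> k \<le> \<alpha> k"
  shows "partial_deriv j (leibniz_term \<beta> \<alpha> f \<gamma>) =
    (\<lambda>x. leibniz_term (mi_inc j \<beta>) \<alpha> f \<gamma> x +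
      (if \<gamma> j < \<alpha> j then leibniz_term (mi_inc j \<beta>) \<alpha> f (mi_inc j \<gamma>) x else 0))"
proof -
  let ?a = "\<lambda>k. \<alpha> k - \<gamma> k" and ?b = "\<lambda>k. \<beta> k - \<gamma> k"
  have low': "mi_low j ?b" using low by (rule mi_low_mono) simp
  have b1: "(\<lambda>k. mi_inc j \<beta> k - \<gamma> k) = mi_inc j ?b"
    using le(1)[of j] by (auto simp: mi_inc_def Suc_diff_le)
  have b2: "(\<lambda>k. mi_inc j \<beta> k - mi_inc j \<gamma> k) = ?b" by (auto simp: mi_inc_def)
  have a2: "(\<lambda>k. \<alpha> k - mi_inc j \<gamma> k) = ?a(j := ?a j - 1)" by (auto simp: mi_inc_def)
  have fa: "mi_fact ?a = real (?a j) * mi_fact (?a(j := ?a j - 1))" if "\<gamma> j < \<alpha> j"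
  proof -
    have "?a = mi_inc j (?a(j := ?a j - 1))" using that by (auto simp: mi_inc_def Suc_diff_Suc)
    then have "mi_fact ?a = mi_fact (mi_inc j (?a(j := ?a j - 1)))" by simp
    then show ?thesis unfolding mi_fact_inc using that by simp
  qed
  have c: "real (?a j) * (mi_fact \<alpha> / mi_fact ?a) = mi_fact \<alpha> / mi_fact (?a(j := ?a j - 1))"
    if "\<gamma> j < \<alpha> j" unfolding fa[OF that] using that by simp
  show ?thesis
  proof
    fix x
    have "partial_deriv j (leibniz_term \<beta> \<alpha> f \<gamma>) x =
      of_real (mi_fact \<alpha> / mi_fact ?a) *
        (of_real (real (?a j) * mi_power x (?a(j := ?a j - 1))) * mi_deriv ?b f x
        + of_real (mi_power x ?a) * partial_deriv j (mi_deriv ?b f) x)"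
      unfolding leibniz_term_def
      by (simp only: partial_deriv_cmult partial_deriv_mi_power_times smooth_mi_power_times
          smooth_mi_deriv f)
    also have "\<dots> = leibniz_term (mi_inc j \<beta>) \<alpha> f \<gamma> x +
        of_real (real (?a j)) * of_real (mi_fact \<alpha> / mi_fact ?a) *
         (of_real (mi_power x (?a(j := ?a j - 1))) * mi_deriv ?b f x)"
      unfolding leibniz_term_def b1 mi_deriv_inc[OF low'] by (simp add: algebra_simps)
    also have "of_real (real (?a j)) * of_real (mi_fact \<alpha> / mi_fact ?a) *
         (of_real (mi_power x (?a(j := ?a j - 1))) * mi_deriv ?b f x) =
        (if \<gamma> j < \<alpha> j then leibniz_term (mi_inc j \<beta>) \<alpha> f (mi_inc j \<gamma>) x else 0)"
    proof (cases "\<gamma> j < \<alpha> j")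
      case True
      show ?thesis
        unfolding leibniz_term_def b2 a2 c[OF True, symmetric] if_P[OF True] of_real_mult
        by (rule refl)
    qed simp
    finally show "partial_deriv j (leibniz_term \<beta> \<alpha> f \<gamma>) x = leibniz_term (mi_inc j \<beta>) \<alpha> f \<gamma> x +
      (if \<gamma> j < \<alpha> j then leibniz_term (mi_inc j \<beta>) \<alpha> f (mi_inc j \<gamma>) x else 0)" .
  qed
qed

text \<open>Multiplicities are recorded by repetition in a list, whose length each differentiation
  at most doubles.\<close>

lemma leibniz_rule:
  assumes "smooth f"
  shows "\<exists>L. length L \<le> 2 ^ mi_order \<beta> \<and> (\<forall>\<gamma>\<in>set L. \<forall>k. \<gamma> k \<le> \<beta> k \<and> \<gamma> k \<le> \<alpha> k) \<and>
    mi_deriv \<beta> (\<lambda>x. of_real (mi_power x \<alpha>) * f x) = (\<lambda>x. \<Sum>\<gamma>\<leftarrow>L. leibniz_term \<beta> \<alpha> f \<gamma> x)"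
proof (induction \<beta> rule: mi_induct)
  case zero
  show ?case
    by (rule exI[of _ "[\<lambda>_. 0]"]) (simp add: leibniz_term_def)
next
  case (inc j \<beta>)
  then obtain L where L: "length L \<le> 2 ^ mi_order \<beta>" "\<And>\<gamma> k. \<gamma> \<in> set L \<Longrightarrow> \<gamma> k \<le> \<beta> k"
    "\<And>\<gamma> k. \<gamma> \<in> set L \<Longrightarrow> \<gamma> k \<le> \<alpha> k"
    "mi_deriv \<beta> (\<lambda>x. of_real (mi_power x \<alpha>) * f x) = (\<lambda>x. \<Sum>\<gamma>\<leftarrow>L. leibniz_term \<beta> \<alpha> f \<gamma> x)"
    by metis
  \<comment> \<open>The first copy collects the derivatives falling on \<open>f\<close>, the second
    those falling on a monomial that still contains \<open>x $ j\<close>.\<close>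
  let ?L' = "L @ map (mi_inc j) (filter (\<lambda>\<gamma>. \<gamma> j < \<alpha> j) L)"
  have "length ?L' \<le> 2 ^ mi_order (mi_inc j \<beta>)"
    by simp (use L(1) length_filter_le[of "\<lambda>\<gamma>. \<gamma> j < \<alpha> j" L] in linarith)
  moreover have "\<gamma> k \<le> mi_inc j \<beta> k \<and> \<gamma> k \<le> \<alpha> k" if "\<gamma> \<in> set ?L'" for \<gamma> k
    using that L(2,3) by (auto simp: mi_inc_def le_SucI Suc_le_eq less_Suc_eq_le)
  moreover have "mi_deriv (mi_inc j \<beta>) (\<lambda>x. of_real (mi_power x \<alpha>) * f x) =
      (\<lambda>x. \<Sum>\<gamma>\<leftarrow>?L'. leibniz_term (mi_inc j \<beta>) \<alpha> f \<gamma> x)"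
  proof
    fix x
    have "mi_deriv (mi_inc j \<beta>) (\<lambda>x. of_real (mi_power x \<alpha>) * f x) x =
        (\<Sum>\<gamma>\<leftarrow>L. partial_deriv j (leibniz_term \<beta> \<alpha> f \<gamma>) x)"
      unfolding mi_deriv_inc[OF inc(1)] L(4)
      by (subst partial_deriv_sum_list) (auto intro: smooth_leibniz_term assms)
    also have "\<dots> = (\<Sum>\<gamma>\<leftarrow>L. leibniz_term (mi_inc j \<beta>) \<alpha> f \<gamma> x +
      (if \<gamma> j < \<alpha> j then leibniz_term (mi_inc j \<beta>) \<alpha> f (mi_inc j \<gamma>) x else 0))"
      by (intro arg_cong[of _ _ sum_list] map_cong refl)
        (simp add: partial_deriv_leibniz_term assms inc L)
    also have "\<dots> = (\<Sum>\<gamma>\<leftarrow>?L'. leibniz_term (mi_inc j \<beta>) \<alpha> f \<gamma> x)"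
      by (simp add: sum_list_addf sum_list_map_filter' o_def)
    finally show "mi_deriv (mi_inc j \<beta>) (\<lambda>x. of_real (mi_power x \<alpha>) * f x) x =
      (\<Sum>\<gamma>\<leftarrow>?L'. leibniz_term (mi_inc j \<beta>) \<alpha> f \<gamma> x)" .
  qed
  ultimately show ?case by blast
qed

text \<open>Bounding the number of terms by \<open>2\<^bsup>|\<beta>|\<^esup>\<close> is enough, as such factors are absorbed by
  passing from \<open>h\<^sub>\<nu>\<close> to \<open>h\<^bsub>\<nu>+1\<^esub>\<close>.\<close>

lemma norm_mi_deriv_mi_power_times_le:
  assumes "smooth f"
    and B: "\<And>\<gamma>. (\<And>k. \<gamma> k \<le> \<beta> k) \<Longrightarrow> (\<And>k. \<gamma> k \<le> \<alpha> k) \<Longrightarrow>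
      w * (mi_fact \<alpha> / mi_fact (\<lambda>j. \<alpha> j - \<gamma> j)) *
        cmod (of_real (mi_power x (\<lambda>j. \<alpha> j - \<gamma> j)) * mi_deriv (\<lambda>j. \<beta> j - \<gamma> j) f x) \<le> B"
    and w: "w \<ge> 0"
  shows "w * cmod (mi_deriv \<beta> (\<lambda>x. of_real (mi_power x \<alpha>) * f x) x) \<le> 2 ^ mi_order \<beta> * B"
proof -
  obtain L where L: "length L \<le> 2 ^ mi_order \<beta>" "\<And>\<gamma> k. \<gamma> \<in> set L \<Longrightarrow> \<gamma> k \<le> \<beta> k"
    "\<And>\<gamma> k. \<gamma> \<in> set L \<Longrightarrow> \<gamma> k \<le> \<alpha> k"
    "mi_deriv \<beta> (\<lambda>x. of_real (mi_power x \<alpha>) * f x) = (\<lambda>x. \<Sum>\<gamma>\<leftarrow>L. leibniz_term \<beta> \<alpha> f \<gamma> x)"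
    using leibniz_rule[OF assms(1)] by metis
  have "w * cmod (leibniz_term \<beta> \<alpha> f \<gamma> x) \<le> B" if "\<gamma> \<in> set L" for \<gamma>
    using B[of \<gamma>] L(2,3)[OF that] by (simp add: leibniz_term_def norm_mult norm_divide mult_ac)
  then have "w * cmod (\<Sum>\<gamma>\<leftarrow>L. leibniz_term \<beta> \<alpha> f \<gamma> x) \<le> real (length L) * B"
  proof (induction L)
    case (Cons \<gamma> L)
    have "w * cmod (\<Sum>\<gamma>\<leftarrow>\<gamma> # L. leibniz_term \<beta> \<alpha> f \<gamma> x) \<le>
        w * (cmod (leibniz_term \<beta> \<alpha> f \<gamma> x) + cmod (\<Sum>\<gamma>\<leftarrow>L. leibniz_term \<beta> \<alpha> f \<gamma> x))"
      using w by (intro mult_left_mono) (auto intro: norm_triangle_ineq)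
    also have "\<dots> \<le> B + real (length L) * B"
      using Cons by (simp add: algebra_simps add_mono)
    finally show ?case by (simp add: algebra_simps)
  qed simp
  also have "\<dots> \<le> 2 ^ mi_order \<beta> * B"
  proof (intro mult_right_mono)
    show "real (length L) \<le> 2 ^ mi_order \<beta>" using L(1) by (metis of_nat_le_iff of_nat_numeral of_nat_power)
    \<comment> \<open>The index \<gamma> = 0 is always admissible, and the quantity bounded there is
      nonnegative.\<close>
    show "B \<ge> 0" using order.trans[OF _ B[of "\<lambda>_. 0"], of 0] w by simp
  qed
  finally show ?thesis unfolding L(4) .
qed

section \<open>Integration on $\mathbb{R}^n$\<close>

text \<open>Lebesgue measure on \<open>real ^ 'n\<close> is the image of a product measure indexed
  by \<open>Basis\<close>; the bijection sending \<open>j\<close> to \<open>axis j 1\<close>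
  translates this into coordinates.\<close>

lemma
  fixes f :: "'n::finite \<Rightarrow> real \<Rightarrow> 'b::{real_normed_field, banach, second_countable_topology}"
  assumes f: "\<And>j. integrable lborel (f j)"
  shows integrable_lborel_prod: "integrable lborel (\<lambda>x::real ^ 'n. \<Prod>j\<in>UNIV. f j (x $ j))"
    and integral_lborel_prod:
      "(LINT x|lborel. (\<Prod>j\<in>UNIV. f j ((x :: real ^ 'n) $ j))) = (\<Prod>j\<in>UNIV. (LINT t|lborel. f j t))"
proof -
  interpret product_sigma_finite "\<lambda>_ :: real ^ 'n. lborel :: real measure" ..
  define \<phi> where "\<phi> = (\<lambda>b :: real ^ 'n. f (axis_index b))"
  have bij: "bij_betw (\<lambda>j. axis j 1) (UNIV :: 'n set) (Basis :: (real ^ 'n) set)"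
    by (auto simp: bij_betw_def inj_on_def axis_eq_axis Basis_vec_def)
  have re: "(\<Prod>b\<in>Basis. g b) = (\<Prod>j\<in>UNIV. g (axis j 1))" for g :: "real ^ 'n \<Rightarrow> 'b"
    using prod.reindex_bij_betw[OF bij, of g] by simp
  have [measurable]: "f j \<in> borel_measurable borel" for j
    using borel_measurable_integrable[OF f[of j]] by simp
  have int: "integrable (\<Pi>\<^sub>M b\<in>Basis. lborel) (\<lambda>u. \<Prod>b\<in>Basis. \<phi> b (u b))"
    by (rule product_integrable_prod) (auto simp: \<phi>_def f)
  have cmp: "(\<Prod>j\<in>UNIV. f j ((\<Sum>b\<in>Basis. u b *\<^sub>R b) $ j)) = (\<Prod>b\<in>Basis. \<phi> b (u b))"
    for u :: "real ^ 'n \<Rightarrow> real"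
  proof -
    have "(\<Sum>b\<in>Basis. u b *\<^sub>R b) $ j = u (axis j 1)" for j
      unfolding cart_eq_inner_axis by (subst inner_sum_left_Basis) auto
    then show ?thesis unfolding re by (simp add: \<phi>_def)
  qed
  have m: "(\<lambda>u. \<Sum>b\<in>Basis. u b *\<^sub>R b) \<in> (\<Pi>\<^sub>M b\<in>Basis. lborel) \<rightarrow>\<^sub>M (borel :: (real ^ 'n) measure)"
    by measurable
  show "integrable lborel (\<lambda>x::real ^ 'n. \<Prod>j\<in>UNIV. f j (x $ j))"
    unfolding lborel_eq[where 'a = "real ^ 'n"] using int by (subst integrable_distr_eq[OF m], measurable, simp only: cmp)
  have "(LINT x|lborel. (\<Prod>j\<in>UNIV. f j ((x :: real ^ 'n) $ j))) =
      (LINT u|(\<Pi>\<^sub>M b\<in>Basis. lborel). (\<Prod>b\<in>Basis. \<phi> b (u b)))"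
    by (subst lborel_eq[where 'a = "real ^ 'n"], subst integral_distr[OF m], measurable, simp only: cmp)
  also have "\<dots> = (\<Prod>b\<in>Basis. (LINT t|lborel. \<phi> b t))"
    by (rule product_integral_prod) (auto simp: \<phi>_def f)
  finally show "(LINT x|lborel. (\<Prod>j\<in>UNIV. f j ((x :: real ^ 'n) $ j))) = (\<Prod>j\<in>UNIV. (LINT t|lborel. f j t))"
    unfolding re by (simp add: \<phi>_def)
qed

lemma lborel_integral_affine:
  fixes f :: "'a::euclidean_space \<Rightarrow> 'b::{banach, second_countable_topology}"
  assumes [measurable]: "f \<in> borel_measurable borel" and "c \<noteq> 0"
  shows "(LINT x|lborel. f x) = \<bar>c\<bar> ^ DIM('a) *\<^sub>R (LINT x|lborel. f (t + c *\<^sub>R x))"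
  using assms(2)
  by (subst lborel_affine[of c t]) (simp_all add: integral_density integral_distr)

lemma lborel_integrable_affine:
  fixes f :: "'a::euclidean_space \<Rightarrow> 'b::{banach, second_countable_topology}"
  assumes f: "integrable lborel f" and "c \<noteq> 0"
  shows "integrable lborel (\<lambda>x. f (t + c *\<^sub>R x))"
proof -
  have [measurable]: "f \<in> borel_measurable borel"
    using f by (auto dest!: borel_measurable_integrable)
  have "integrable lborel (\<lambda>x. \<bar>c\<bar> ^ DIM('a) *\<^sub>R f (t + c *\<^sub>R x))"
    using f assms(2)
    by (subst (asm) lborel_affine[of c t]) (simp_all add: integrable_density integrable_distr_eq)
  from integrable_scaleR_right[OF this, of "inverse (\<bar>c\<bar> ^ DIM('a))"] show ?thesis
    using assms(2) by simp
qed

lemma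
  fixes f :: "'a::euclidean_space \<Rightarrow> 'b::{banach, second_countable_topology}"
  assumes [measurable]: "f \<in> borel_measurable borel"
  shows lborel_integral_translate: "(LINT x|lborel. f (t + x)) = (LINT x|lborel. f x)"
    and lborel_integrable_translate: "integrable lborel (\<lambda>x. f (t + x)) \<longleftrightarrow> integrable lborel f"
proof -
  show "(LINT x|lborel. f (t + x)) = (LINT x|lborel. f x)"
    using lborel_integral_affine[OF assms, of 1 t] by simp
  show "integrable lborel (\<lambda>x. f (t + x)) \<longleftrightarrow> integrable lborel f"
    by (subst (2) lborel_distr_plus[of t, symmetric], subst integrable_distr_eq) auto
qed

lemma lborel_integral_uminus:
  fixes f :: "'a::euclidean_space \<Rightarrow> 'b::{banach, second_countable_topology}"
  assumes [measurable]: "f \<in> borel_measurable borel"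
  shows "(LINT x|lborel. f (- x)) = (LINT x|lborel. f x)"
  using lborel_integral_affine[OF assms, of "- 1" 0] by simp

lemma borel_measurable_weight [measurable]: "weight \<in> borel_measurable borel"
  unfolding weight_def[abs_def] by (intro borel_measurable_continuous_onI continuous_intros)

lemma integrable_inverse_weight: "integrable lborel (\<lambda>x. inverse (weight x))"
proof -
  have "integrable lborel (\<lambda>t::real. inverse (1 + t\<^sup>2))"
    using integrable_inverse_1_plus_square by (simp add: set_integrable_def)
  from integrable_lborel_prod[OF this] show ?thesis
    by (simp add: weight_def prod_inversef[symmetric] o_def)
qed

text \<open>Trades a weighted supremum, which the norms control, for an integral, which controls the
  Fourier transform.\<close>

lemma weight_bounded_imp_integrable:
  fixes f :: "real ^ 'n::finite \<Rightarrow> complex"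
  assumes [measurable]: "f \<in> borel_measurable borel" and B: "\<And>x. weight x * cmod (f x) \<le> B"
  shows "integrable lborel f"
    and "(LINT x|lborel. cmod (f x)) \<le> B * (LINT x|lborel. inverse (weight (x :: real ^ 'n)))"
proof -
  have le: "cmod (f x) \<le> B * inverse (weight x)" for x
    using B[of x] weight_pos[of x] by (simp add: field_simps)
  show int: "integrable lborel f"
    by (rule Bochner_Integration.integrable_bound[of _ "\<lambda>x. B * inverse (weight x)"])
      (auto intro!: AE_I2 integrable_mult_right integrable_inverse_weight order.trans[OF le])
  have "(LINT x|lborel. cmod (f x)) \<le> (LINT x|lborel. B * inverse (weight (x :: real ^ 'n)))"
    using int le by (intro integral_mono integrable_mult_right integrable_inverse_weight) auto
  then show "(LINT x|lborel. cmod (f x)) \<le> B * (LINT x|lborel. inverse (weight (x :: real ^ 'n)))"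
    by simp
qed

text \<open>A translation-invariance argument: integrate the fundamental theorem of calculus
  \<open>v (x + e\<^sub>j) - v x = \<integral>\<^sub>0\<^sup>1 v' (x + t e\<^sub>j) dt\<close> over all \<open>x\<close>.\<close>

lemma integral_partial_deriv_eq_0:
  fixes v v' :: "real ^ 'n::finite \<Rightarrow> complex"
  assumes d: "\<And>x s. ((\<lambda>t. v (x + t *\<^sub>R axis j 1)) has_vector_derivative
      v' (x + s *\<^sub>R axis j 1)) (at s)"
    and cont: "continuous_on UNIV v'" and v: "integrable lborel v" and v': "integrable lborel v'"
  shows "(LINT x|lborel. v' x) = 0"
proof -
  let ?e = "axis j 1 :: real ^ 'n"
  have [measurable]: "v \<in> borel_measurable borel" "v' \<in> borel_measurable borel"
    using v v' by (auto dest!: borel_measurable_integrable)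
  \<comment> \<open>The indicator turns the integral over [0,1] into one over the line, so that
    Fubini applies to \<open>lborel\<close> in both variables. By translation invariance the inner
    absolute integral is constant for \<open>t\<close> in [0,1].\<close>
  define \<Phi> where "\<Phi> = (\<lambda>(t::real) x. indicator {0..1} t *\<^sub>R v' (t *\<^sub>R ?e + x))"
  have "(\<lambda>(t, x). \<Phi> t x) \<in> borel_measurable (lborel \<Otimes>\<^sub>M lborel)"
    unfolding \<Phi>_def by measurable
  moreover have "integrable lborel (\<lambda>x. \<Phi> t x)" for t
    unfolding \<Phi>_def by (intro integrable_scaleR_right) (simp add: lborel_integrable_translate v')
  moreover have "integrable lborel (\<lambda>t. LINT x|lborel. norm (case (t, x) of (t, x) \<Rightarrow> \<Phi> t x))"
  proof -
    have "(LINT x|lborel. cmod (v' (t *\<^sub>R ?e + x))) = (LINT x|lborel. cmod (v' x))" for t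
      by (rule lborel_integral_translate) measurable
    then show ?thesis by (simp add: \<Phi>_def)
  qed
  ultimately have int: "integrable (lborel \<Otimes>\<^sub>M lborel) (\<lambda>(t, x). \<Phi> t x)"
    by (intro lborel_pair.Fubini_integrable) auto
  have "(LINT x|lborel. (LINT t|lborel. \<Phi> t x)) = (LINT t|lborel. (LINT x|lborel. \<Phi> t x))"
    using int by (rule lborel_pair.Fubini_integral)
  moreover have "(LINT t|lborel. \<Phi> t x) = v (?e + x) - v x" for x
  proof -
    have "(LINT t|lborel. indicator {0..1} t *\<^sub>R v' (x + t *\<^sub>R ?e)) = v (x + 1 *\<^sub>R ?e) - v (x + 0 *\<^sub>R ?e)"
      by (rule integral_FTC_Icc)
        (auto intro!: has_vector_derivative_at_within[OF d]
           continuous_on_compose2[OF cont] continuous_intros)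
    then show ?thesis by (simp add: \<Phi>_def add.commute)
  qed
  moreover have "(LINT x|lborel. \<Phi> t x) = indicator {0..1} t *\<^sub>R (LINT x|lborel. v' x)" for t
    unfolding \<Phi>_def by (simp add: lborel_integral_translate)
  moreover have "(LINT x|lborel. v (?e + x) - v x) = 0"
    using v by (simp add: lborel_integral_translate lborel_integrable_translate)
  ultimately show ?thesis by simp
qed

section \<open>The Fourier transformation\<close>

lemma cmod_exp_i_inner [simp]: "cmod (exp (\<i> * of_real (x \<bullet> \<xi>))) = 1"
  using norm_exp_i_times by blast

lemma borel_measurable_exp_i_inner [measurable]:
  "(\<lambda>\<xi>. exp (\<i> * of_real ((x :: real ^ 'n::finite) \<bullet> \<xi>))) \<in> borel_measurable borel"
  by (intro borel_measurable_continuous_onI continuous_intros)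

lemma integrable_times_exp_i_inner:
  assumes "integrable lborel (f :: real ^ 'n::finite \<Rightarrow> complex)"
  shows "integrable lborel (\<lambda>\<xi>. f \<xi> * exp (\<i> * of_real (x \<bullet> \<xi>)))"
proof -
  have [measurable]: "f \<in> borel_measurable borel"
    using assms by (auto dest!: borel_measurable_integrable)
  show ?thesis
    by (rule Bochner_Integration.integrable_bound[OF assms]) (auto simp: norm_mult)
qed

lemma norm_fourier_le:
  fixes f :: "real ^ 'n::finite \<Rightarrow> complex"
  assumes "integrable lborel f"
  shows "cmod (fourier f x) \<le> 1 / sqrt (2 * pi) ^ CARD('n) * (LINT \<xi>|lborel. cmod (f \<xi>))"
proof -
  have "cmod (fourier f x) = 1 / sqrt (2 * pi) ^ CARD('n) *
      cmod (LINT \<xi>|lborel. f \<xi> * exp (\<i> * of_real (x \<bullet> \<xi>)))"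
    unfolding fourier_def by (simp only: norm_mult norm_of_real) simp
  also have "\<dots> \<le> 1 / sqrt (2 * pi) ^ CARD('n) *
      (LINT \<xi>|lborel. cmod (f \<xi> * exp (\<i> * of_real (x \<bullet> \<xi>))))"
    by (intro mult_left_mono integral_norm_bound) auto
  finally show ?thesis by (simp add: norm_mult)
qed

lemma fourier_add:
  "integrable lborel f \<Longrightarrow> integrable lborel g \<Longrightarrow>
    fourier (\<lambda>x. f x + g x) = (\<lambda>x. fourier f x + fourier g x)"
  by (rule ext) (simp add: fourier_def ring_distribs integrable_times_exp_i_inner)

lemma fourier_cmult: "fourier (\<lambda>x. c * f x) = (\<lambda>x. c * fourier f x)"
proof
  fix x
  have "(LINT \<xi>|lborel. c * f \<xi> * exp (\<i> * of_real (x \<bullet> \<xi>))) =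
      c * (LINT \<xi>|lborel. f \<xi> * exp (\<i> * of_real (x \<bullet> \<xi>)))"
    unfolding mult.assoc by (rule integral_mult_right_zero)
  then show "fourier (\<lambda>x. c * f x) x = c * fourier f x"
    unfolding fourier_def by (simp only: mult_ac)
qed

lemma fourier_minus_arg:
  assumes "integrable lborel f"
  shows "fourier (\<lambda>x. f (- x)) = (\<lambda>x. fourier f (- x))"
proof
  fix x
  have [measurable]: "f \<in> borel_measurable borel"
    using assms by (auto dest!: borel_measurable_integrable)
  have "(LINT \<xi>|lborel. (\<lambda>\<xi>. f \<xi> * exp (\<i> * of_real ((- x) \<bullet> \<xi>))) (- \<xi>)) =
      (LINT \<xi>|lborel. f \<xi> * exp (\<i> * of_real ((- x) \<bullet> \<xi>)))"
    by (rule lborel_integral_uminus) measurable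
  then show "fourier (\<lambda>x. f (- x)) x = fourier f (- x)"
    unfolding fourier_def by simp
qed

lemma continuous_on_fourier:
  fixes f :: "real ^ 'n::finite \<Rightarrow> complex"
  assumes "integrable lborel f"
  shows "continuous_on UNIV (fourier f)"
  unfolding continuous_on_sequentially o_def
proof (intro ballI allI impI)
  fix y u assume u: "(\<forall>n. u n \<in> UNIV) \<and> u \<longlonglongrightarrow> (y :: real ^ 'n)"
  have [measurable]: "f \<in> borel_measurable borel"
    using assms by (auto dest!: borel_measurable_integrable)
  have "(\<lambda>n. LINT \<xi>|lborel. f \<xi> * exp (\<i> * of_real (u n \<bullet> \<xi>)))
      \<longlonglongrightarrow> (LINT \<xi>|lborel. f \<xi> * exp (\<i> * of_real (y \<bullet> \<xi>)))"
  proof (rule integral_dominated_convergence)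
    show "integrable lborel (\<lambda>\<xi>. cmod (f \<xi>))" using assms by (rule integrable_norm)
    show "AE \<xi> in lborel. (\<lambda>n. f \<xi> * exp (\<i> * of_real (u n \<bullet> \<xi>)))
      \<longlonglongrightarrow> f \<xi> * exp (\<i> * of_real (y \<bullet> \<xi>))"
      using u by (auto intro!: tendsto_intros)
  qed (auto simp: norm_mult)
  then show "(\<lambda>n. fourier f (u n)) \<longlonglongrightarrow> fourier f y"
    unfolding fourier_def by (rule tendsto_mult_left)
qed

text \<open>Integration by parts without boundary term: the derivative of \<open>g\<close> times the
  exponential has integral 0.\<close>

lemma fourier_partial_deriv:
  fixes g :: "real ^ 'n::finite \<Rightarrow> complex"
  assumes g: "smooth g" and int: "integrable lborel g" "integrable lborel (partial_deriv j g)"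
  shows "fourier (partial_deriv j g) x = - \<i> * of_real (x $ j) * fourier g x"
proof -
  let ?E = "\<lambda>\<xi>. exp (\<i> * complex_of_real (x \<bullet> \<xi>))"
  have "(LINT \<xi>|lborel. partial_deriv j g \<xi> * ?E \<xi> + g \<xi> * (\<i> * of_real (x $ j) * ?E \<xi>)) = 0"
  proof (rule integral_partial_deriv_eq_0)
    show "((\<lambda>t. g (\<xi> + t *\<^sub>R axis j 1) * ?E (\<xi> + t *\<^sub>R axis j 1)) has_vector_derivative
      (partial_deriv j g (\<xi> + s *\<^sub>R axis j 1) * ?E (\<xi> + s *\<^sub>R axis j 1)
         + g (\<xi> + s *\<^sub>R axis j 1) * (\<i> * of_real (x $ j) * ?E (\<xi> + s *\<^sub>R axis j 1)))) (at s)" for \<xi> s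
    proof -
      have "((\<lambda>t. \<i> * complex_of_real (x \<bullet> \<xi> + t * x $ j)) has_vector_derivative \<i> * of_real (x $ j)) (at s)"
        by (auto intro!: derivative_eq_intros has_vector_derivative_of_real
            simp: has_real_derivative_iff_has_vector_derivative[symmetric])
      from field_vector_diff_chain_at[OF this DERIV_exp]
      have "((\<lambda>t. ?E (\<xi> + t *\<^sub>R axis j 1)) has_vector_derivative
          \<i> * of_real (x $ j) * ?E (\<xi> + s *\<^sub>R axis j 1)) (at s)"
        by (simp add: o_def inner_add_right inner_axis)
      from has_vector_derivative_mult[OF smooth_has_partial_deriv[OF g] this]
      show ?thesis by (simp add: add.commute)
    qed
    show "continuous_on UNIV
       (\<lambda>\<xi>. partial_deriv j g \<xi> * ?E \<xi> + g \<xi> * (\<i> * complex_of_real (x $ j) * ?E \<xi>))"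
      by (intro continuous_intros smooth_continuous smooth_partial_deriv g)
    show "integrable lborel (\<lambda>\<xi>. g \<xi> * ?E \<xi>)"
      by (rule integrable_times_exp_i_inner[OF int(1)])
    show "integrable lborel (\<lambda>\<xi>. partial_deriv j g \<xi> * ?E \<xi> + g \<xi> * (\<i> * complex_of_real (x $ j) * ?E \<xi>))"
      using integrable_mult_right[OF integrable_times_exp_i_inner[OF int(1), of x], of "\<i> * of_real (x $ j)"]
      by (intro Bochner_Integration.integrable_add integrable_times_exp_i_inner int) (simp add: mult_ac)
  qed
  moreover have "(LINT \<xi>|lborel. partial_deriv j g \<xi> * ?E \<xi> + g \<xi> * (\<i> * of_real (x $ j) * ?E \<xi>)) =
     (LINT \<xi>|lborel. partial_deriv j g \<xi> * ?E \<xi>) + \<i> * of_real (x $ j) * (LINT \<xi>|lborel. g \<xi> * ?E \<xi>)"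
  proof -
    have e: "g \<xi> * (\<i> * of_real (x $ j) * ?E \<xi>) = \<i> * of_real (x $ j) * (g \<xi> * ?E \<xi>)" for \<xi>
      by simp
    note i1 = integrable_times_exp_i_inner[OF int(2), of x]
    note i2 = integrable_mult_right[OF integrable_times_exp_i_inner[OF int(1), of x], of "\<i> * of_real (x $ j)"]
    show ?thesis
      unfolding e Bochner_Integration.integral_add[OF i1 i2] integral_mult_right_zero ..
  qed
  ultimately show ?thesis
    unfolding fourier_def by (simp add: add_eq_0_iff mult_ac)
qed

text \<open>Differentiation under the integral by the second-order estimate for exp(iu) - 1 - iu,
  which makes the remainder quadratic in the increment. This is where the second moment in the
  assumptions comes from.\<close>

lemma fourier_has_partial_deriv:
  fixes f :: "real ^ 'n::finite \<Rightarrow> complex"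
  assumes int: "integrable lborel f" "integrable lborel (\<lambda>\<xi>. of_real (\<xi> $ j) * f \<xi>)"
    "integrable lborel (\<lambda>\<xi>. of_real (\<xi> $ j) * (of_real (\<xi> $ j) * f \<xi>))"
  shows "((\<lambda>t. fourier f (x + t *\<^sub>R axis j 1)) has_vector_derivative
    \<i> * fourier (\<lambda>\<xi>. of_real (\<xi> $ j) * f \<xi>) x) (at 0)"
proof -
  let ?E = "\<lambda>\<xi>. exp (\<i> * complex_of_real (x \<bullet> \<xi>))"
  define c where "c = 1 / sqrt (2 * pi) ^ CARD('n)"
  define K where "K = (LINT \<xi>|lborel. cmod (of_real (\<xi> $ j) * (of_real (\<xi> $ j) * f \<xi>)))"
  have c: "c \<ge> 0" by (simp add: c_def)
  let ?R = "\<lambda>h. fourier f (x + h *\<^sub>R axis j 1) - fourier f x - h *\<^sub>R (\<i> * fourier (\<lambda>\<xi>. of_real (\<xi> $ j) * f \<xi>) x)"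
  have R: "cmod (?R h) \<le> c * (K * h\<^sup>2)" for h
  proof -
    \<comment> \<open>Once the common factor \<open>f \<xi> * ?E \<xi>\<close> is taken out, what
      remains of the integrand is this Taylor remainder of the exponential in direction
      \<open>j\<close>.\<close>
    let ?r = "\<lambda>\<xi>. iexp (h * \<xi> $ j) - (1 + \<i> * of_real (h * \<xi> $ j))"
    have eE: "exp (\<i> * complex_of_real ((x + h *\<^sub>R axis j 1) \<bullet> \<xi>)) = ?E \<xi> * iexp (h * \<xi> $ j)" for \<xi>
      by (simp add: inner_add_left inner_axis' ring_distribs exp_add)
    have i1: "integrable lborel (\<lambda>\<xi>. f \<xi> * ?E \<xi>)"
      "integrable lborel (\<lambda>\<xi>. (of_real (\<xi> $ j) * f \<xi>) * ?E \<xi>)"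
      "integrable lborel (\<lambda>\<xi>. f \<xi> * (?E \<xi> * iexp (h * \<xi> $ j)))"
      using integrable_times_exp_i_inner[OF int(1), of x] integrable_times_exp_i_inner[OF int(2), of x]
        integrable_times_exp_i_inner[OF int(1), of "x + h *\<^sub>R axis j 1"] by (simp_all only: eE)
    have "?R h = of_real c * ((LINT \<xi>|lborel. f \<xi> * (?E \<xi> * iexp (h * \<xi> $ j)))
        - (LINT \<xi>|lborel. f \<xi> * ?E \<xi>) - (\<i> * of_real h) * (LINT \<xi>|lborel. (of_real (\<xi> $ j) * f \<xi>) * ?E \<xi>))"
      unfolding fourier_def eE c_def by (simp add: scaleR_conv_of_real algebra_simps)
    also have "(\<i> * of_real h) * (LINT \<xi>|lborel. (of_real (\<xi> $ j) * f \<xi>) * ?E \<xi>) =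
        (LINT \<xi>|lborel. (\<i> * of_real h) * ((of_real (\<xi> $ j) * f \<xi>) * ?E \<xi>))"
      by (rule integral_mult_right_zero[symmetric])
    also have "(LINT \<xi>|lborel. f \<xi> * (?E \<xi> * iexp (h * \<xi> $ j)))
        - (LINT \<xi>|lborel. f \<xi> * ?E \<xi>) - (LINT \<xi>|lborel. (\<i> * of_real h) * ((of_real (\<xi> $ j) * f \<xi>) * ?E \<xi>)) =
        (LINT \<xi>|lborel. f \<xi> * (?E \<xi> * iexp (h * \<xi> $ j)) - f \<xi> * ?E \<xi>
          - (\<i> * of_real h) * ((of_real (\<xi> $ j) * f \<xi>) * ?E \<xi>))"
      using i1 integrable_mult_right[OF i1(2), of "\<i> * of_real h"]
      by (subst Bochner_Integration.integral_diff Bochner_Integration.integrable_diff;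
          (intro Bochner_Integration.integrable_diff)?; simp?)+
    also have "(\<lambda>\<xi>. f \<xi> * (?E \<xi> * iexp (h * \<xi> $ j)) - f \<xi> * ?E \<xi>
          - (\<i> * of_real h) * ((of_real (\<xi> $ j) * f \<xi>) * ?E \<xi>)) = (\<lambda>\<xi>. f \<xi> * ?E \<xi> * ?r \<xi>)"
      by (rule ext) (simp add: algebra_simps)
    finally have "cmod (?R h) = c * cmod (LINT \<xi>|lborel. f \<xi> * ?E \<xi> * ?r \<xi>)"
      using c by (simp add: norm_mult)
    moreover have "cmod (LINT \<xi>|lborel. f \<xi> * ?E \<xi> * ?r \<xi>) \<le>
        (LINT \<xi>|lborel. h\<^sup>2 * cmod (of_real (\<xi> $ j) * (of_real (\<xi> $ j) * f \<xi>)))"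
    proof (rule Bochner_Integration.integral_norm_bound_integral)
      show "integrable lborel (\<lambda>\<xi>. h\<^sup>2 * cmod (of_real (\<xi> $ j) * (of_real (\<xi> $ j) * f \<xi>)))"
        by (intro integrable_mult_right integrable_norm int)
      have "(\<lambda>\<xi>. f \<xi> * (?E \<xi> * iexp (h * \<xi> $ j)) - f \<xi> * ?E \<xi>
          - (\<i> * of_real h) * ((of_real (\<xi> $ j) * f \<xi>) * ?E \<xi>)) = (\<lambda>\<xi>. f \<xi> * ?E \<xi> * ?r \<xi>)"
        by (rule ext) (simp add: algebra_simps)
      moreover have "integrable lborel (\<lambda>\<xi>. f \<xi> * (?E \<xi> * iexp (h * \<xi> $ j)) - f \<xi> * ?E \<xi>
          - (\<i> * of_real h) * ((of_real (\<xi> $ j) * f \<xi>) * ?E \<xi>))"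
        by (intro Bochner_Integration.integrable_diff integrable_mult_right i1)
      ultimately show "integrable lborel (\<lambda>\<xi>. f \<xi> * ?E \<xi> * ?r \<xi>)" by simp
      fix \<xi>
      have "cmod (?r \<xi>) \<le> \<bar>h * \<xi> $ j\<bar> ^ 2 / 2"
        using iexp_approx1[of "h * \<xi> $ j" 1] by (simp add: numeral_2_eq_2)
      also have "\<dots> \<le> h\<^sup>2 * (\<xi> $ j)\<^sup>2" by (simp add: power_mult_distrib)
      finally have "cmod (f \<xi>) * cmod (?r \<xi>) \<le> cmod (f \<xi>) * (h\<^sup>2 * (\<xi> $ j)\<^sup>2)"
        by (rule mult_left_mono) simp
      then show "cmod (f \<xi> * ?E \<xi> * ?r \<xi>) \<le> h\<^sup>2 * cmod (of_real (\<xi> $ j) * (of_real (\<xi> $ j) * f \<xi>))"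
        by (simp add: norm_mult power2_eq_square mult_ac)
    qed
    from mult_left_mono[OF this c] have "c * cmod (LINT \<xi>|lborel. f \<xi> * ?E \<xi> * ?r \<xi>) \<le> c * (K * h\<^sup>2)"
      unfolding K_def integral_mult_right_zero by (simp only: mult.commute[of "h\<^sup>2"])
    ultimately show ?thesis by simp
  qed
  have "((\<lambda>h. norm (?R h) / norm h) \<longlongrightarrow> 0) (at 0)"
  proof (rule tendsto_sandwich[of "\<lambda>_. 0" _ _ "\<lambda>h. c * (K * \<bar>h\<bar>)"])
    show "((\<lambda>h. c * (K * \<bar>h\<bar>)) \<longlongrightarrow> 0) (at 0)"
      by (auto intro!: tendsto_eq_intros)
    show "\<forall>\<^sub>F h in at 0. cmod (?R h) / norm h \<le> c * (K * \<bar>h\<bar>)"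
      using eventually_at_ball'[of 1 "0::real" UNIV]
    proof (rule eventually_mono)
      fix h :: real assume "h \<in> ball 0 1 \<and> h \<noteq> 0 \<and> h \<in> UNIV"
      then show "cmod (?R h) / norm h \<le> c * (K * \<bar>h\<bar>)"
        using R[of h] by (simp add: divide_le_eq power2_eq_square mult_ac abs_mult_self_eq)
    qed simp
  qed auto
  then show ?thesis
    unfolding has_vector_derivative_def has_derivative_at by (auto intro: bounded_linear_intros)
qed

section \<open>Fourier inversion\<close>

definition gauss :: "real ^ 'n::finite \<Rightarrow> real" where
  "gauss x = exp (- (norm x)\<^sup>2 / 2)"

lemma gauss_bounds: "gauss x > 0" "gauss x \<le> 1"
  by (simp_all add: gauss_def)

lemma borel_measurable_gauss [measurable]: "gauss \<in> borel_measurable borel"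
  unfolding gauss_def[abs_def] by measurable

lemma continuous_on_gauss: "continuous_on UNIV gauss"
  unfolding gauss_def[abs_def] by (intro continuous_intros) auto

text \<open>Up to the factor \<open>sqrt (2 * pi)\<close> this is the characteristic function of the
  standard normal distribution.\<close>

lemma
  fixes t :: real
  shows integrable_gauss_iexp: "integrable lborel (\<lambda>x. of_real (exp (- x\<^sup>2 / 2)) * iexp (t * x))"
    and integral_gauss_iexp: "(LINT x|lborel. of_real (exp (- x\<^sup>2 / 2)) * iexp (t * x)) =
      of_real (sqrt (2 * pi) * exp (- t\<^sup>2 / 2))"
proof -
  have e: "of_real (exp (- x\<^sup>2 / 2)) * z = of_real (sqrt (2 * pi)) * (std_normal_density x *\<^sub>R z)"
    for x :: real and z :: complex
    unfolding std_normal_density_def scaleR_conv_of_real by (simp add: field_simps)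
  have int: "integrable lborel (\<lambda>x. std_normal_density x *\<^sub>R iexp (t * x))"
    by (rule Bochner_Integration.integrable_bound[of _ std_normal_density]) (auto simp: norm_mult)
  show "integrable lborel (\<lambda>x. of_real (exp (- x\<^sup>2 / 2)) * iexp (t * x))"
    unfolding e by (intro integrable_mult_right int)
  have "(LINT x|lborel. std_normal_density x *\<^sub>R iexp (t * x)) = char std_normal_distribution t"
    unfolding char_def by (subst integral_density) auto
  then show "(LINT x|lborel. of_real (exp (- x\<^sup>2 / 2)) * iexp (t * x)) =
      of_real (sqrt (2 * pi) * exp (- t\<^sup>2 / 2))"
    unfolding e integral_mult_right_zero char_std_normal_distribution by simp
qed

lemma
  fixes y :: "real ^ 'n::finite"
  shows integrable_gauss_exp_i_inner:
      "integrable lborel (\<lambda>x. of_real (gauss x) * exp (\<i> * of_real (y \<bullet> x)))"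
    and integral_gauss_exp_i_inner:
      "(LINT x|lborel. of_real (gauss x) * exp (\<i> * of_real (y \<bullet> x))) =
        of_real (sqrt (2 * pi) ^ CARD('n) * gauss y)"
proof -
  have g: "gauss x = (\<Prod>j\<in>UNIV. exp (- (x $ j)\<^sup>2 / 2))" for x :: "real ^ 'n"
    unfolding gauss_def norm_vec_def L2_set_def
    by (simp add: sum_nonneg exp_sum[symmetric] sum_negf sum_divide_distrib)
  have e: "of_real (gauss x) * exp (\<i> * of_real (y \<bullet> x)) =
      (\<Prod>j\<in>UNIV. of_real (exp (- (x $ j)\<^sup>2 / 2)) * iexp (y $ j * x $ j))" for x :: "real ^ 'n"
    unfolding g by (simp add: inner_vec_def sum_distrib_left exp_sum prod.distrib)
  show "integrable lborel (\<lambda>x. of_real (gauss x) * exp (\<i> * of_real (y \<bullet> x)))"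
    unfolding e by (rule integrable_lborel_prod, rule integrable_gauss_iexp)
  have "(LINT x|lborel. of_real (gauss x) * exp (\<i> * of_real (y \<bullet> x))) =
      (\<Prod>j\<in>(UNIV :: 'n set). of_real (sqrt (2 * pi) * exp (- (y $ j)\<^sup>2 / 2)))"
    unfolding e by (subst integral_lborel_prod, rule integrable_gauss_iexp)
      (simp only: integral_gauss_iexp)
  then show "(LINT x|lborel. of_real (gauss x) * exp (\<i> * of_real (y \<bullet> x))) =
        of_real (sqrt (2 * pi) ^ CARD('n) * gauss y)"
    by (simp add: g prod.distrib)
qed

lemma integrable_gauss: "integrable lborel gauss"
  using integrable_gauss_exp_i_inner[of 0] by (simp add: complex_of_real_integrable_eq)

text \<open>The Gaussian factor makes the double integral over \<open>x\<close> and \<xi> absolutely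
  convergent. After the exchange the inner integral is a rescaled Gaussian around \<open>t\<close>,
  and the substitution \<xi> = t + \<epsilon> u turns the outer one into an average of
  \<open>f\<close> near \<open>t\<close>.\<close>

lemma integral_fourier_gauss:
  fixes f :: "real ^ 'n::finite \<Rightarrow> complex"
  assumes f: "integrable lborel f" and \<epsilon>: "\<epsilon> > 0"
  shows "(LINT x|lborel. of_real (gauss (\<epsilon> *\<^sub>R x)) * (fourier f x * exp (\<i> * of_real ((- t) \<bullet> x)))) =
    (LINT u|lborel. f (t + \<epsilon> *\<^sub>R u) * of_real (gauss u))"
proof -
  let ?n = "CARD('n)"
  define c where "c = 1 / sqrt (2 * pi) ^ ?n"
  have c: "c * sqrt (2 * pi) ^ ?n = 1" by (simp add: c_def)
  have [measurable]: "f \<in> borel_measurable borel"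
    using f by (auto dest!: borel_measurable_integrable)
  define \<Psi> where "\<Psi> = (\<lambda>x \<xi>. f \<xi> * (of_real (gauss (\<epsilon> *\<^sub>R x)) * exp (\<i> * of_real ((\<xi> - t) \<bullet> x))))"
  have m: "(\<lambda>(\<xi>, x). \<Psi> x \<xi>) \<in> borel_measurable (lborel \<Otimes>\<^sub>M lborel)"
    unfolding \<Psi>_def by measurable
  have gt: "integrable lborel (\<lambda>x :: real ^ 'n. gauss (\<epsilon> *\<^sub>R x))"
    using lborel_integrable_affine[OF integrable_gauss, of \<epsilon> 0] \<epsilon> by simp
  have int: "integrable (lborel \<Otimes>\<^sub>M lborel) (\<lambda>(\<xi>, x). \<Psi> x \<xi>)"
  proof (rule lborel_pair.Fubini_integrable[OF m])
    have "(\<lambda>\<xi>. LINT x|lborel. cmod (case (\<xi>, x) of (\<xi>, x) \<Rightarrow> \<Psi> x \<xi>)) =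
        (\<lambda>\<xi>. (LINT x|lborel. gauss (\<epsilon> *\<^sub>R (x :: real ^ 'n))) * cmod (f \<xi>))"
      by (simp add: \<Psi>_def norm_mult abs_of_pos[OF gauss_bounds(1)] mult.commute)
    then show "integrable lborel (\<lambda>\<xi>. LINT x|lborel. cmod (case (\<xi>, x) of (\<xi>, x) \<Rightarrow> \<Psi> x \<xi>))"
      using integrable_norm[OF f] by (simp only: integrable_mult_right)
    have "integrable lborel (\<Psi>' \<xi>)" if "\<Psi>' = (\<lambda>\<xi> x. \<Psi> x \<xi>)" for \<xi> \<Psi>'
      unfolding that \<Psi>_def
      by (intro integrable_mult_right integrable_times_exp_i_inner)
        (simp add: complex_of_real_integrable_eq gt)
    then show "AE \<xi> in lborel. integrable lborel (\<lambda>x. case (\<xi>, x) of (\<xi>, x) \<Rightarrow> \<Psi> x \<xi>)"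
      by simp
  qed
  have "(LINT x|lborel. of_real (gauss (\<epsilon> *\<^sub>R x)) * (fourier f x * exp (\<i> * of_real ((- t) \<bullet> x)))) =
      (LINT x|lborel. of_real c * (LINT \<xi>|lborel. \<Psi> x \<xi>))"
  proof (rule Bochner_Integration.integral_cong[OF refl])
    fix x :: "real ^ 'n"
    have "exp (\<i> * of_real ((\<xi> - t) \<bullet> x)) = exp (\<i> * of_real ((- t) \<bullet> x)) * exp (\<i> * of_real (x \<bullet> \<xi>))"
      for \<xi>
    proof -
      have "(\<xi> - t) \<bullet> x = (- t) \<bullet> x + x \<bullet> \<xi>" by (simp add: inner_diff_left inner_commute[of x \<xi>])
      then show ?thesis by (simp only: of_real_add ring_distribs exp_add)
    qed
    then have "(\<lambda>\<xi>. \<Psi> x \<xi>) = (\<lambda>\<xi>. (of_real (gauss (\<epsilon> *\<^sub>R x)) * exp (\<i> * of_real ((- t) \<bullet> x))) *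
        (f \<xi> * exp (\<i> * of_real (x \<bullet> \<xi>))))"
      by (simp only: \<Psi>_def mult_ac)
    then have "(LINT \<xi>|lborel. \<Psi> x \<xi>) = (of_real (gauss (\<epsilon> *\<^sub>R x)) * exp (\<i> * of_real ((- t) \<bullet> x))) *
        (LINT \<xi>|lborel. f \<xi> * exp (\<i> * of_real (x \<bullet> \<xi>)))"
      by (simp only: integral_mult_right_zero)
    then show "of_real (gauss (\<epsilon> *\<^sub>R x)) * (fourier f x * exp (\<i> * of_real ((- t) \<bullet> x))) =
        of_real c * (LINT \<xi>|lborel. \<Psi> x \<xi>)"
      unfolding fourier_def c_def by (simp only: mult_ac)
  qed
  also have "\<dots> = of_real c * (LINT x|lborel. (LINT \<xi>|lborel. \<Psi> x \<xi>))"
    by (rule integral_mult_right_zero)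
  also have "(LINT x|lborel. (LINT \<xi>|lborel. \<Psi> x \<xi>)) = (LINT \<xi>|lborel. (LINT x|lborel. \<Psi> x \<xi>))"
    using int by (rule lborel_pair.Fubini_integral)
  also have "(\<lambda>\<xi>. LINT x|lborel. \<Psi> x \<xi>) =
      (\<lambda>\<xi>. of_real ((1 / \<epsilon>) ^ ?n * sqrt (2 * pi) ^ ?n) * (f \<xi> * of_real (gauss ((1 / \<epsilon>) *\<^sub>R (\<xi> - t)))))"
  proof
    fix \<xi> :: "real ^ 'n"
    have "(LINT x|lborel. of_real (gauss (\<epsilon> *\<^sub>R x)) * exp (\<i> * of_real ((\<xi> - t) \<bullet> x))) =
       \<bar>1 / \<epsilon>\<bar> ^ DIM(real ^ 'n) *\<^sub>R (LINT x|lborel. of_real (gauss (\<epsilon> *\<^sub>R (0 + (1 / \<epsilon>) *\<^sub>R x))) *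
          exp (\<i> * of_real ((\<xi> - t) \<bullet> (0 + (1 / \<epsilon>) *\<^sub>R x))))"
      using \<epsilon> by (intro lborel_integral_affine) auto
    also have "\<dots> = (1 / \<epsilon>) ^ ?n *\<^sub>R (LINT x|lborel. of_real (gauss x) *
          exp (\<i> * of_real (((1 / \<epsilon>) *\<^sub>R (\<xi> - t)) \<bullet> x)))"
      using \<epsilon> by simp
    also have "\<dots> = of_real ((1 / \<epsilon>) ^ ?n * sqrt (2 * pi) ^ ?n) * of_real (gauss ((1 / \<epsilon>) *\<^sub>R (\<xi> - t)))"
      unfolding integral_gauss_exp_i_inner scaleR_conv_of_real by simp
    finally have "(LINT x|lborel. of_real (gauss (\<epsilon> *\<^sub>R x)) * exp (\<i> * of_real ((\<xi> - t) \<bullet> x))) =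
      of_real ((1 / \<epsilon>) ^ ?n * sqrt (2 * pi) ^ ?n) * complex_of_real (gauss ((1 / \<epsilon>) *\<^sub>R (\<xi> - t)))" .
    then show "(LINT x|lborel. \<Psi> x \<xi>) = of_real ((1 / \<epsilon>) ^ ?n * sqrt (2 * pi) ^ ?n) *
        (f \<xi> * of_real (gauss ((1 / \<epsilon>) *\<^sub>R (\<xi> - t))))"
      unfolding \<Psi>_def integral_mult_right_zero by (simp only: mult_ac)
  qed
  also have "(LINT \<xi>|lborel. of_real ((1 / \<epsilon>) ^ ?n * sqrt (2 * pi) ^ ?n) *
        (f \<xi> * complex_of_real (gauss ((1 / \<epsilon>) *\<^sub>R (\<xi> - t))))) =
      of_real ((1 / \<epsilon>) ^ ?n * sqrt (2 * pi) ^ ?n) *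
        (LINT \<xi>|lborel. f \<xi> * complex_of_real (gauss ((1 / \<epsilon>) *\<^sub>R (\<xi> - t))))"
    by (rule integral_mult_right_zero)
  also have "(LINT \<xi>|lborel. f \<xi> * complex_of_real (gauss ((1 / \<epsilon>) *\<^sub>R (\<xi> - t)))) =
      \<bar>\<epsilon>\<bar> ^ DIM(real ^ 'n) *\<^sub>R
        (LINT u|lborel. f (t + \<epsilon> *\<^sub>R u) * of_real (gauss ((1 / \<epsilon>) *\<^sub>R ((t + \<epsilon> *\<^sub>R u) - t))))"
    using \<epsilon> by (intro lborel_integral_affine) auto
  also have "\<dots> = of_real (\<epsilon> ^ ?n) * (LINT u|lborel. f (t + \<epsilon> *\<^sub>R u) * of_real (gauss u))"
    using \<epsilon> by (simp add: scaleR_conv_of_real[where 'a = complex])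
  \<comment> \<open>The Jacobians of the two rescalings, by 1 / \<epsilon> in \<open>x\<close> and
    by \<epsilon> in \<xi>, cancel, and \<open>c\<close> cancels the constant of the Gaussian
    transform.\<close>
  also have "of_real c * (of_real ((1 / \<epsilon>) ^ ?n * sqrt (2 * pi) ^ ?n) *
      (of_real (\<epsilon> ^ ?n) * (LINT u|lborel. f (t + \<epsilon> *\<^sub>R u) * of_real (gauss u)))) =
      of_real (c * sqrt (2 * pi) ^ ?n * ((1 / \<epsilon>) ^ ?n * \<epsilon> ^ ?n)) *
      (LINT u|lborel. f (t + \<epsilon> *\<^sub>R u) * complex_of_real (gauss u))"
    by (simp only: of_real_mult mult_ac)
  also have "c * sqrt (2 * pi) ^ ?n * ((1 / \<epsilon>) ^ ?n * \<epsilon> ^ ?n) = 1"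
    using \<epsilon> c by (simp add: power_mult_distrib[symmetric])
  finally show ?thesis by simp
qed

text \<open>Let \<epsilon> tend to 0 in the regularised identity. The integrable function
  \<open>fourier f\<close> dominates the left side and a multiple of the Gaussian the right side,
  where continuity of \<open>f\<close> picks out its value at the centre.\<close>

theorem fourier_fourier:
  fixes f :: "real ^ 'n::finite \<Rightarrow> complex"
  assumes cont: "continuous_on UNIV f" and bdd: "\<And>x. cmod (f x) \<le> B"
    and f: "integrable lborel f" and f': "integrable lborel (fourier f)"
  shows "fourier (fourier f) x = f (- x)"
proof -
  \<comment> \<open>With \<open>?t = - x\<close> the exponent becomes \<open>x \<bullet> y\<close>,
    so the limit on the left is the outer Fourier integral; its normalisation cancels the integral
    of \<open>gauss\<close> on the right.\<close>
  let ?n = "CARD('n)" and ?t = "- x"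
  define \<epsilon> where "\<epsilon> = (\<lambda>k. 1 / real (Suc k))"
  have \<epsilon>: "\<epsilon> k > 0" for k by (simp add: \<epsilon>_def)
  have \<epsilon>0: "\<epsilon> \<longlonglongrightarrow> 0" unfolding \<epsilon>_def by (rule LIMSEQ_Suc, rule lim_1_over_n)
  have [measurable]: "f \<in> borel_measurable borel" "fourier f \<in> borel_measurable borel"
    using f f' by (auto dest!: borel_measurable_integrable)
  have g0: "gauss (0 :: real ^ 'n) = 1" by (simp add: gauss_def)
  have "(\<lambda>k. LINT y|lborel. of_real (gauss (\<epsilon> k *\<^sub>R y)) * (fourier f y * exp (\<i> * of_real ((- ?t) \<bullet> y))))
      \<longlonglongrightarrow> (LINT y|lborel. fourier f y * exp (\<i> * of_real ((- ?t) \<bullet> y)))"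
  proof (rule integral_dominated_convergence)
    show "integrable lborel (\<lambda>y. cmod (fourier f y))" using f' by (rule integrable_norm)
    show "AE y in lborel. (\<lambda>k. of_real (gauss (\<epsilon> k *\<^sub>R y)) * (fourier f y * exp (\<i> * of_real ((- ?t) \<bullet> y))))
      \<longlonglongrightarrow> fourier f y * exp (\<i> * of_real ((- ?t) \<bullet> y))"
    proof (rule AE_I2)
      fix y :: "real ^ 'n"
      have "(\<lambda>k. gauss (\<epsilon> k *\<^sub>R y)) \<longlonglongrightarrow> gauss (0 *\<^sub>R y)"
        by (rule continuous_on_tendsto_compose[OF continuous_on_gauss])
          (auto intro!: tendsto_eq_intros \<epsilon>0)
      then have "(\<lambda>k. of_real (gauss (\<epsilon> k *\<^sub>R y)) * (fourier f y * exp (\<i> * of_real ((- ?t) \<bullet> y))))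
        \<longlonglongrightarrow> of_real (gauss (0 *\<^sub>R y)) * (fourier f y * exp (\<i> * of_real ((- ?t) \<bullet> y)))"
        by (intro tendsto_intros)
      then show "(\<lambda>k. of_real (gauss (\<epsilon> k *\<^sub>R y)) * (fourier f y * exp (\<i> * of_real ((- ?t) \<bullet> y))))
        \<longlonglongrightarrow> fourier f y * exp (\<i> * of_real ((- ?t) \<bullet> y))"
        by (simp add: g0)
    qed
    show "AE y in lborel. cmod (of_real (gauss (\<epsilon> k *\<^sub>R y)) * (fourier f y * exp (\<i> * of_real ((- ?t) \<bullet> y))))
      \<le> cmod (fourier f y)" for k
      by (simp add: norm_mult abs_of_pos[OF gauss_bounds(1)] mult_left_le_one_le gauss_bounds less_imp_le)
  qed measurable
  moreover have "(\<lambda>k. LINT u|lborel. f (?t + \<epsilon> k *\<^sub>R u) * of_real (gauss u))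
      \<longlonglongrightarrow> (LINT u|lborel. f ?t * of_real (gauss (u :: real ^ 'n)))"
  proof (rule integral_dominated_convergence)
    show "integrable lborel (\<lambda>u :: real ^ 'n. B * gauss u)"
      by (intro integrable_mult_right integrable_gauss)
    show "AE u in lborel. (\<lambda>k. f (?t + \<epsilon> k *\<^sub>R u) * of_real (gauss u))
      \<longlonglongrightarrow> f ?t * of_real (gauss u)"
    proof (intro AE_I2 tendsto_intros)
      fix u :: "real ^ 'n"
      have "(\<lambda>k. f (?t + \<epsilon> k *\<^sub>R u)) \<longlonglongrightarrow> f (?t + 0 *\<^sub>R u)"
        by (rule continuous_on_tendsto_compose[OF cont])
          (auto intro!: tendsto_eq_intros \<epsilon>0)
      then show "(\<lambda>k. f (?t + \<epsilon> k *\<^sub>R u)) \<longlonglongrightarrow> f ?t" by simp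
    qed
    show "AE u in lborel. cmod (f (?t + \<epsilon> k *\<^sub>R u) * of_real (gauss u)) \<le> B * gauss u" for k
      by (simp add: norm_mult abs_of_pos[OF gauss_bounds(1)] mult_right_mono bdd gauss_bounds less_imp_le)
  qed measurable
  ultimately have "(LINT y|lborel. fourier f y * exp (\<i> * of_real ((- ?t) \<bullet> y))) =
      (LINT u|lborel. f ?t * of_real (gauss (u :: real ^ 'n)))"
    unfolding integral_fourier_gauss[OF f \<epsilon>] by (rule LIMSEQ_unique)
  also have "\<dots> = f ?t * of_real (sqrt (2 * pi) ^ ?n)"
    using integral_gauss_exp_i_inner[of "0 :: real ^ 'n"] by (simp add: g0)
  finally show ?thesis
    unfolding fourier_def[of "fourier f"] by simp
qed

section \<open>Rapidly decreasing functions\<close>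

text \<open>The Schwartz space: a common home of all \<open>G_space (h \<nu>)\<close> and
  \<open>E_space (h \<nu>)\<close> with \<nu> \<ge> 1 that does not mention the weights.\<close>

definition rapid :: "(real ^ 'n::finite \<Rightarrow> complex) \<Rightarrow> bool" where
  "rapid f \<longleftrightarrow> smooth f \<and> (\<forall>\<alpha> m. \<exists>C. \<forall>x. (1 + norm x) ^ m * cmod (mi_deriv \<alpha> f x) \<le> C)"

lemma rapid_smooth: "rapid f \<Longrightarrow> smooth f"
  by (simp add: rapid_def)

lemma finite_mi_le: "finite {\<gamma> :: 'n::finite \<Rightarrow> nat. \<forall>k. \<gamma> k \<le> \<beta> k}"
proof -
  have "{\<gamma>. \<forall>k. \<gamma> k \<le> \<beta> k} = (\<Pi>\<^sub>E k\<in>UNIV. {..\<beta> k})"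
    by (auto simp: PiE_UNIV_domain Pi_def)
  then show ?thesis by (simp add: finite_PiE)
qed

lemma finite_mi_order_le: "finite {\<gamma> :: 'n::finite \<Rightarrow> nat. mi_order \<gamma> \<le> m}"
  by (rule finite_subset[OF _ finite_mi_le[of "\<lambda>_. m"]]) (auto intro: order.trans[OF mi_le_order])

lemma mi_fact_ge_1: "mi_fact \<alpha> \<ge> 1"
  unfolding mi_fact_def by (intro prod_ge_1) (simp add: fact_ge_1)

text \<open>Every factor except the derivative is absorbed into one power of
  \<open>1 + norm x\<close>, at the cost of \<open>mi_fact \<alpha>\<close>. That cost is harmless
  in both uses, where \<alpha> is fixed or has order at most \<open>m\<close>. The exponent is the
  origin of \<open>2 * CARD('n) + m\<close> in the estimate from \<open>E\<close> to
  \<open>G\<close>.\<close>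

lemma weight_leibniz_coefficient_le:
  fixes x :: "real ^ 'n::finite"
  shows "weight x * (mi_fact \<alpha> / mi_fact (\<lambda>j. \<alpha> j - \<gamma> j)) * cmod (of_real (mi_power x (\<lambda>j. \<alpha> j - \<gamma> j)) * z)
    \<le> mi_fact \<alpha> * ((1 + norm x) ^ (2 * CARD('n) + mi_order \<alpha>) * cmod z)"
proof -
  let ?a = "\<lambda>j. \<alpha> j - \<gamma> j"
  have "mi_fact \<alpha> / mi_fact ?a \<le> mi_fact \<alpha>"
    using mult_left_mono[OF mi_fact_ge_1[of ?a], of "mi_fact \<alpha>"] by (simp add: divide_le_eq)
  moreover have "\<bar>mi_power x ?a\<bar> \<le> (1 + norm x) ^ mi_order \<alpha>"
    by (rule order.trans[OF abs_mi_power_le power_increasing]) (auto intro: mi_order_mono)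
  ultimately have "weight x * (mi_fact \<alpha> / mi_fact ?a) * \<bar>mi_power x ?a\<bar> \<le>
      (1 + norm x) ^ (2 * CARD('n)) * mi_fact \<alpha> * (1 + norm x) ^ mi_order \<alpha>"
    using weight_le_norm[of x] weight_pos[of x] by (intro mult_mono) auto
  from mult_right_mono[OF this norm_ge_zero[of z]] show ?thesis
    by (simp add: norm_mult power_add mult_ac)
qed

text \<open>Only the finitely many indices below \<beta> occur in the Leibniz expansion, so their
  separate bounds have a common one.\<close>

lemma rapid_moment_bounded:
  fixes f :: "real ^ 'n::finite \<Rightarrow> complex"
  assumes "rapid f"
  shows "\<exists>B. \<forall>x. weight x * cmod (mi_deriv \<beta> (\<lambda>x. of_real (mi_power x \<alpha>) * f x) x) \<le> B"
proof -
  let ?M = "2 * CARD('n) + mi_order \<alpha>"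
  have "\<forall>\<gamma>. \<exists>C. \<forall>x. (1 + norm x) ^ ?M * cmod (mi_deriv \<gamma> f x) \<le> C"
    using assms unfolding rapid_def by blast
  then obtain C where C: "\<And>\<gamma> x. (1 + norm x) ^ ?M * cmod (mi_deriv \<gamma> f x) \<le> C \<gamma>" by metis
  obtain B where B: "\<And>\<gamma>. (\<forall>k. \<gamma> k \<le> \<beta> k) \<Longrightarrow> C \<gamma> \<le> B"
    using bdd_above_finite[OF finite_imageI[OF finite_mi_le[of \<beta>], of C]] unfolding bdd_above_def by blast
  have "weight x * cmod (mi_deriv \<beta> (\<lambda>x. of_real (mi_power x \<alpha>) * f x) x) \<le> 2 ^ mi_order \<beta> * (mi_fact \<alpha> * B)" for x
  proof (rule norm_mi_deriv_mi_power_times_le)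
    fix \<gamma> :: "'n \<Rightarrow> nat"
    have "(1 + norm x) ^ ?M * cmod (mi_deriv (\<lambda>j. \<beta> j - \<gamma> j) f x) \<le> B"
      using C B[of "\<lambda>j. \<beta> j - \<gamma> j"] by (meson diff_le_self order.trans)
    then show "weight x * (mi_fact \<alpha> / mi_fact (\<lambda>j. \<alpha> j - \<gamma> j)) *
        cmod (of_real (mi_power x (\<lambda>j. \<alpha> j - \<gamma> j)) * mi_deriv (\<lambda>j. \<beta> j - \<gamma> j) f x) \<le> mi_fact \<alpha> * B"
      by (intro order.trans[OF weight_leibniz_coefficient_le mult_left_mono]) auto
  qed (use assms weight_pos[of x] in \<open>auto simp: rapid_def\<close>)
  then show ?thesis by blast
qed

lemma rapid_moment_integrable:
  assumes "rapid f"
  shows "integrable lborel (mi_deriv \<beta> (\<lambda>x. of_real (mi_power x \<alpha>) * f x))"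
proof -
  obtain B where B: "\<And>x. weight x * cmod (mi_deriv \<beta> (\<lambda>x. of_real (mi_power x \<alpha>) * f x) x) \<le> B"
    using rapid_moment_bounded[OF assms] by blast
  have "mi_deriv \<beta> (\<lambda>x. of_real (mi_power x \<alpha>) * f x) \<in> borel_measurable borel"
    by (intro borel_measurable_continuous_onI mi_deriv_continuous smooth_mi_power_times
        rapid_smooth assms)
  then show ?thesis using B by (rule weight_bounded_imp_integrable(1))
qed

lemma rapid_integrable: "rapid f \<Longrightarrow> integrable lborel f"
  using rapid_moment_integrable[of f "\<lambda>_. 0" "\<lambda>_. 0"] by simp

lemma fourier_moment_has_partial_deriv:
  assumes "rapid f"
  shows "((\<lambda>t. fourier (\<lambda>\<xi>. of_real (mi_power \<xi> \<alpha>) * f \<xi>) (x + t *\<^sub>R axis j 1)) has_vector_derivative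
    \<i> * fourier (\<lambda>\<xi>. of_real (mi_power \<xi> (mi_inc j \<alpha>)) * f \<xi>) x) (at 0)"
proof -
  have e: "of_real (\<xi> $ j) * (of_real (mi_power \<xi> \<alpha>) * f \<xi>) =
      of_real (mi_power \<xi> (mi_inc j \<alpha>)) * f \<xi>" for \<alpha> \<xi>
    by (simp add: mi_power_inc)
  have i: "integrable lborel (\<lambda>\<xi>. of_real (mi_power \<xi> \<alpha>) * f \<xi>)" for \<alpha>
    using rapid_moment_integrable[OF assms, of "\<lambda>_. 0" \<alpha>] by simp
  show ?thesis
    using fourier_has_partial_deriv[of "\<lambda>\<xi>. of_real (mi_power \<xi> \<alpha>) * f \<xi>" j x] unfolding e
    by (simp add: i)
qed

text \<open>Multiples of transforms of moments are closed under differentiation: the scalar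
  \<open>c\<close> collects the factors \<i> while the exponent \<alpha> grows.\<close>

lemma smooth_fourier:
  assumes "rapid f"
  shows "smooth (fourier f)"
proof (rule smooth_coinduct[of _ "{\<lambda>x. c * fourier (\<lambda>\<xi>. of_real (mi_power \<xi> \<alpha>) * f \<xi>) x | c \<alpha>. True}"])
  show "fourier f \<in> {\<lambda>x. c * fourier (\<lambda>\<xi>. of_real (mi_power \<xi> \<alpha>) * f \<xi>) x | c \<alpha>. True}"
    by (intro CollectI exI[of _ 1] exI[of _ "\<lambda>_. 0"]) simp
next
  fix u j assume "u \<in> {\<lambda>x. c * fourier (\<lambda>\<xi>. of_real (mi_power \<xi> \<alpha>) * f \<xi>) x | c \<alpha>. True}"
  then obtain c \<alpha> where u: "u = (\<lambda>x. c * fourier (\<lambda>\<xi>. of_real (mi_power \<xi> \<alpha>) * f \<xi>) x)" by blast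
  have i: "integrable lborel (\<lambda>\<xi>. of_real (mi_power \<xi> \<alpha>) * f \<xi>)"
    using rapid_moment_integrable[OF assms, of "\<lambda>_. 0" \<alpha>] by simp
  show "continuous_on UNIV u"
    unfolding u by (intro continuous_intros continuous_on_fourier i)
  have d: "((\<lambda>t. u (x + t *\<^sub>R axis j 1)) has_vector_derivative
      c * (\<i> * fourier (\<lambda>\<xi>. of_real (mi_power \<xi> (mi_inc j \<alpha>)) * f \<xi>) x)) (at 0)" for x
    unfolding u by (intro has_vector_derivative_mult_right fourier_moment_has_partial_deriv assms)
  show "(\<lambda>t. u (x + t *\<^sub>R axis j 1)) differentiable (at (0::real))" for x
    using d by (rule differentiableI_vector)
  have "partial_deriv j u = (\<lambda>x. (c * \<i>) * fourier (\<lambda>\<xi>. of_real (mi_power \<xi> (mi_inc j \<alpha>)) * f \<xi>) x)"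
    by (rule ext) (simp add: partial_deriv_eqI[OF d])
  then show "partial_deriv j u \<in> {\<lambda>x. c * fourier (\<lambda>\<xi>. of_real (mi_power \<xi> \<alpha>) * f \<xi>) x | c \<alpha>. True}"
    by blast
qed

lemma mi_deriv_fourier:
  assumes "rapid f"
  shows "mi_deriv \<alpha> (fourier f) = (\<lambda>x. \<i> ^ mi_order \<alpha> * fourier (\<lambda>\<xi>. of_real (mi_power \<xi> \<alpha>) * f \<xi>) x)"
proof (induction \<alpha> rule: mi_induct)
  case zero
  then show ?case by (simp add: mi_order_def)
next
  case (inc j \<alpha>)
  have "((\<lambda>t. \<i> ^ mi_order \<alpha> * fourier (\<lambda>\<xi>. of_real (mi_power \<xi> \<alpha>) * f \<xi>) (x + t *\<^sub>R axis j 1))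
      has_vector_derivative
      \<i> ^ mi_order \<alpha> * (\<i> * fourier (\<lambda>\<xi>. of_real (mi_power \<xi> (mi_inc j \<alpha>)) * f \<xi>) x)) (at 0)" for x
    by (intro has_vector_derivative_mult_right fourier_moment_has_partial_deriv assms)
  from partial_deriv_eqI[OF this] show ?case
    by (simp add: mi_deriv_inc inc fun_eq_iff)
qed

lemma fourier_mi_deriv_moment:
  assumes "rapid f"
  shows "fourier (mi_deriv \<beta> (\<lambda>\<xi>. of_real (mi_power \<xi> \<alpha>) * f \<xi>)) x =
    (- \<i>) ^ mi_order \<beta> * of_real (mi_power x \<beta>) * fourier (\<lambda>\<xi>. of_real (mi_power \<xi> \<alpha>) * f \<xi>) x"
proof (induction \<beta> rule: mi_induct)
  case zero
  then show ?case by (simp add: mi_order_def)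
next
  case (inc j \<beta>)
  let ?g = "mi_deriv \<beta> (\<lambda>\<xi>. of_real (mi_power \<xi> \<alpha>) * f \<xi>)"
  have "fourier (mi_deriv (mi_inc j \<beta>) (\<lambda>\<xi>. of_real (mi_power \<xi> \<alpha>) * f \<xi>)) x =
      fourier (partial_deriv j ?g) x"
    by (simp add: mi_deriv_inc inc)
  also have "\<dots> = - \<i> * of_real (x $ j) * fourier ?g x"
  proof (rule fourier_partial_deriv)
    show "smooth ?g" by (intro smooth_mi_deriv smooth_mi_power_times rapid_smooth assms)
    show "integrable lborel ?g" by (rule rapid_moment_integrable[OF assms])
    show "integrable lborel (partial_deriv j ?g)"
      unfolding mi_deriv_inc[OF inc(1), symmetric] by (rule rapid_moment_integrable[OF assms])
  qed
  finally show ?case by (simp add: inc mi_power_inc)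
qed

text \<open>A bound for the supremum of \<open>fourier g\<close> when \<open>weight\<close> times
  the modulus of \<open>g\<close> is at most 1. The type argument carries the dimension, its only
  parameter.\<close>

definition fourier_const :: "'n::finite itself \<Rightarrow> real" where
  "fourier_const _ = 1 / sqrt (2 * pi) ^ CARD('n) * (LINT x|lborel. inverse (weight (x :: real ^ 'n)))"

lemma fourier_const_nonneg: "fourier_const TYPE('n::finite) \<ge> 0"
proof -
  have "(LINT x|lborel. inverse (weight (x :: real ^ 'n))) \<ge> 0"
    by (intro integral_nonneg_AE AE_I2) (simp add: weight_pos less_imp_le)
  then show ?thesis by (simp add: fourier_const_def)
qed

text \<open>The analytic input to both norm estimates: what remains is to bound derivatives of
  moments, a matter of multi-indices. The derivative is taken after the multiplication by the
  monomial, which is what calls for the Leibniz expansion.\<close>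

lemma norm_mi_power_fourier_le:
  fixes f :: "real ^ 'n::finite \<Rightarrow> complex"
  assumes f: "rapid f"
    and B: "\<And>\<xi>. weight \<xi> * cmod (mi_deriv \<beta> (\<lambda>\<xi>. of_real (mi_power \<xi> \<alpha>) * f \<xi>) \<xi>) \<le> B"
  shows "cmod (of_real (mi_power x \<beta>) * mi_deriv \<alpha> (fourier f) x) \<le> fourier_const TYPE('n) * B"
proof -
  let ?g = "mi_deriv \<beta> (\<lambda>\<xi>. of_real (mi_power \<xi> \<alpha>) * f \<xi>)"
  have "cmod (of_real (mi_power x \<beta>) * mi_deriv \<alpha> (fourier f) x) = cmod (fourier ?g x)"
    unfolding mi_deriv_fourier[OF f] fourier_mi_deriv_moment[OF f] by (simp add: norm_mult norm_power)
  also have "\<dots> \<le> 1 / sqrt (2 * pi) ^ CARD('n) * (LINT \<xi>|lborel. cmod (?g \<xi>))"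
    by (rule norm_fourier_le[OF rapid_moment_integrable[OF f]])
  also have "\<dots> \<le> 1 / sqrt (2 * pi) ^ CARD('n) * (B * (LINT x|lborel. inverse (weight (x :: real ^ 'n))))"
    using rapid_moment_integrable[OF f] B
    by (intro mult_left_mono weight_bounded_imp_integrable(2)) (auto dest!: borel_measurable_integrable)
  finally show ?thesis by (simp add: fourier_const_def mult_ac)
qed

text \<open>The monomial dominating \<open>(1 + norm x) ^ m\<close> varies with \<open>x\<close>,
  but its order is at most \<open>m\<close>. It is one of finitely many, so a bound for all of them
  exists.\<close>

lemma rapid_fourier:
  fixes f :: "real ^ 'n::finite \<Rightarrow> complex"
  assumes "rapid f"
  shows "rapid (fourier f)"
proof -
  have "\<exists>C. \<forall>x. (1 + norm x) ^ m * cmod (mi_deriv \<alpha> (fourier f) x) \<le> C" for \<alpha> m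
  proof -
    have "\<forall>\<beta>. \<exists>B. \<forall>x. cmod (of_real (mi_power x \<beta>) * mi_deriv \<alpha> (fourier f) x) \<le> B"
      using rapid_moment_bounded[OF assms] norm_mi_power_fourier_le[OF assms] by meson
    then obtain B where B: "\<And>\<beta> x. cmod (of_real (mi_power x \<beta>) * mi_deriv \<alpha> (fourier f) x) \<le> B \<beta>"
      by metis
    obtain C where C: "\<And>\<beta>. mi_order \<beta> \<le> m \<Longrightarrow> B \<beta> \<le> C"
      using bdd_above_finite[OF finite_imageI[OF finite_mi_order_le[of m], of B]]
      unfolding bdd_above_def by blast
    have "(1 + norm x) ^ m * cmod (mi_deriv \<alpha> (fourier f) x) \<le> (1 + real CARD('n)) ^ m * C" for x
    proof -
      obtain \<beta> where \<beta>: "mi_order \<beta> \<le> m"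
        "(1 + norm x) ^ m \<le> (1 + real CARD('n)) ^ m * \<bar>mi_power x \<beta>\<bar>"
        by (rule norm_power_le_mi_power)
      have "(1 + norm x) ^ m * cmod (mi_deriv \<alpha> (fourier f) x) \<le>
          (1 + real CARD('n)) ^ m * \<bar>mi_power x \<beta>\<bar> * cmod (mi_deriv \<alpha> (fourier f) x)"
        by (rule mult_right_mono[OF \<beta>(2)]) simp
      also have "\<dots> = (1 + real CARD('n)) ^ m * cmod (of_real (mi_power x \<beta>) * mi_deriv \<alpha> (fourier f) x)"
        by (simp add: norm_mult)
      also have "\<dots> \<le> (1 + real CARD('n)) ^ m * C"
        by (intro mult_left_mono order.trans[OF B C] \<beta>) auto
      finally show ?thesis .
    qed
    then show ?thesis by blast
  qed
  then show ?thesis using smooth_fourier[OF assms] by (simp add: rapid_def)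
qed

lemma rapid_fourier_fourier:
  assumes "rapid f"
  shows "fourier (fourier f) = (\<lambda>x. f (- x))"
proof
  fix x
  obtain B where "\<And>x. cmod (f x) \<le> B"
    using assms[unfolded rapid_def, THEN conjunct2, rule_format, of 0 "\<lambda>_. 0"] by auto
  then show "fourier (fourier f) x = f (- x)"
    by (intro fourier_fourier smooth_continuous rapid_smooth rapid_integrable rapid_fourier assms)
qed

section \<open>Norm estimates\<close>

text \<open>Fixing a finite bound \<open>N\<close> turns the extended-valued supremum into pointwise
  real inequalities, the form in which the estimates are carried out.\<close>

lemma G_norm_le_iff:
  assumes "N \<ge> 0"
  shows "G_norm h m f \<le> ennreal N \<longleftrightarrow> (\<forall>x \<beta> \<alpha>. mi_order \<alpha> \<le> m \<longrightarrow>
    cmod (of_real (mi_power x \<beta>) * mi_deriv \<alpha> f x) \<le> N * (mi_fact \<beta> * exp (- h (mi_vec \<beta>))))"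
  using assms by (simp add: G_norm_def SUP_le_iff ennreal_le_iff pos_divide_le_eq)

lemma E_norm_le_iff:
  assumes "N \<ge> 0"
  shows "E_norm h m f \<le> ennreal N \<longleftrightarrow> (\<forall>x \<alpha>.
    (1 + norm x) ^ m * cmod (mi_deriv \<alpha> f x) \<le> N * (mi_fact \<alpha> * exp (- h (mi_vec \<alpha>))))"
  using assms by (simp add: E_norm_def SUP_le_iff ennreal_le_iff pos_divide_le_eq)

text \<open>Reflection changes derivatives and monomials only by signs.\<close>

lemma G_norm_minus_arg:
  assumes "smooth f"
  shows "G_norm h m (\<lambda>x. f (- x)) \<le> G_norm h m f"
proof (cases "G_norm h m f")
  case (real N)
  then show ?thesis
    using G_norm_le_iff[of N h m f] by (auto simp: G_norm_le_iff mi_deriv_minus_arg[OF assms] norm_mult norm_power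
        split: if_splits) (metis abs_mi_power_minus)
qed simp

lemma ennreal_finite_le: "a < \<infinity> \<Longrightarrow> \<exists>N\<ge>0. a = ennreal N"
  by (cases a) auto

lemma G_space_iff: "f \<in> G_space h \<longleftrightarrow> smooth f \<and> (\<forall>m. G_norm h m f < \<infinity>)"
  by (auto simp: G_space_def G_m_space_def smooth_def)

lemma E_space_iff: "f \<in> E_space h \<longleftrightarrow> smooth f \<and> (\<forall>m. E_norm h m f < \<infinity>)"
  by (auto simp: E_space_def E_m_space_def smooth_def)

lemma E_space_rapid:
  assumes "f \<in> E_space h"
  shows "rapid f"
proof -
  have "\<exists>C. \<forall>x. (1 + norm x) ^ m * cmod (mi_deriv \<alpha> f x) \<le> C" for \<alpha> m
  proof -
    obtain N where "N \<ge> 0" "E_norm h m f = ennreal N"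
      using assms ennreal_finite_le unfolding E_space_iff by blast
    then show ?thesis using E_norm_le_iff[of N h m f] by auto
  qed
  then show ?thesis using assms by (simp add: rapid_def E_space_iff)
qed

section \<open>Weight sequences: exponentiated conditions and bounded shifts of
  multi-indices\<close>

locale weight_sequence =
  fixes h :: "nat \<Rightarrow> real ^ 'n::finite \<Rightarrow> real"
  assumes nondecreasing: "\<And>\<nu> x i t. \<nu> \<ge> 1 \<Longrightarrow> (\<forall>j. 0 \<le> x $ j) \<Longrightarrow> x $ i \<le> t \<Longrightarrow>
      h \<nu> x \<le> h \<nu> (\<chi> j. if j = i then t else x $ j)"
    and decreasing: "\<And>\<nu>. \<nu> \<ge> 1 \<Longrightarrow> \<exists>\<gamma>. \<forall>x. (\<forall>j. 0 \<le> x $ j) \<longrightarrow>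
      h \<nu> x - h (\<nu> + 1) x \<ge> ln 2 * (\<Sum>j\<in>UNIV. x $ j) - \<gamma>"
    and subadditive: "\<And>\<nu>. \<nu> \<ge> 1 \<Longrightarrow> \<exists>l. \<forall>x y. (\<forall>j. 0 \<le> x $ j) \<longrightarrow> (\<forall>j. 0 \<le> y $ j) \<longrightarrow>
      h (\<nu> + 1) (x + y) \<le> h \<nu> x + h \<nu> y + l"
begin

text \<open>Monotonicity is given one variable at a time, so the coordinates are raised from
  \<alpha> to \<beta> in succession; \<open>A\<close> collects those already raised.\<close>

lemma h_mono:
  assumes "\<nu> \<ge> 1" and le: "\<And>j. \<alpha> j \<le> \<beta> j"
  shows "h \<nu> (mi_vec \<alpha>) \<le> h \<nu> (mi_vec \<beta>)"
proof -
  have "h \<nu> (mi_vec \<alpha>) \<le> h \<nu> (mi_vec (\<lambda>j. if j \<in> A then \<beta> j else \<alpha> j))" if "finite A" for A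
    using that
  proof (induction A)
    case (insert i A)
    have "h \<nu> (mi_vec (\<lambda>j. if j \<in> A then \<beta> j else \<alpha> j)) \<le>
        h \<nu> (\<chi> j. if j = i then real (\<beta> i) else mi_vec (\<lambda>j. if j \<in> A then \<beta> j else \<alpha> j) $ j)"
      using assms insert by (intro nondecreasing) (auto simp: mi_vec_def)
    also have "(\<chi> j. if j = i then real (\<beta> i) else mi_vec (\<lambda>j. if j \<in> A then \<beta> j else \<alpha> j) $ j) =
        mi_vec (\<lambda>j. if j \<in> insert i A then \<beta> j else \<alpha> j)"
      by (auto simp: mi_vec_def vec_eq_iff)
    finally show ?case using insert by linarith
  qed simp
  from this[of UNIV] show ?thesis by simp
qed

text \<open>After exponentiation the coefficient \<open>ln 2\<close> becomes exactly the factor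
  \<open>2 ^ mi_order \<alpha>\<close>, and \<gamma> becomes the constant.\<close>

lemma h_decreasing:
  assumes "\<nu> \<ge> 1"
  shows "\<exists>c>0. \<forall>\<alpha>. 2 ^ mi_order \<alpha> * exp (- h \<nu> (mi_vec \<alpha>)) \<le> c * exp (- h (\<nu> + 1) (mi_vec \<alpha>))"
proof -
  obtain \<gamma> where \<gamma>: "\<And>x. (\<forall>j. 0 \<le> x $ j) \<Longrightarrow> h \<nu> x - h (\<nu> + 1) x \<ge> ln 2 * (\<Sum>j\<in>UNIV. x $ j) - \<gamma>"
    using decreasing[OF assms] by blast
  have "2 ^ mi_order \<alpha> * exp (- h \<nu> (mi_vec \<alpha>)) \<le> exp \<gamma> * exp (- h (\<nu> + 1) (mi_vec \<alpha>))" for \<alpha>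
  proof -
    have "(2::real) ^ mi_order \<alpha> = exp (ln 2 * real (mi_order \<alpha>))"
      by (metis exp_ln exp_of_nat2_mult zero_less_numeral)
    then have "2 ^ mi_order \<alpha> * exp (- h \<nu> (mi_vec \<alpha>)) = exp (ln 2 * real (mi_order \<alpha>) - h \<nu> (mi_vec \<alpha>))"
      by (simp add: exp_diff exp_minus field_simps)
    also have "\<dots> \<le> exp (\<gamma> - h (\<nu> + 1) (mi_vec \<alpha>))"
      using \<gamma>[of "mi_vec \<alpha>"] by (simp add: mi_vec_def mi_order_def)
    finally show ?thesis by (simp add: exp_diff exp_minus field_simps)
  qed
  then show ?thesis by (intro exI[of _ "exp \<gamma>"]) simp
qed

lemma h_decreasing':
  assumes "\<nu> \<ge> 1"
  shows "\<exists>c>0. \<forall>\<alpha>. exp (- h \<nu> (mi_vec \<alpha>)) \<le> c * exp (- h (\<nu> + 1) (mi_vec \<alpha>))"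
proof -
  obtain c where c: "c > 0"
    "\<And>\<alpha>. 2 ^ mi_order \<alpha> * exp (- h \<nu> (mi_vec \<alpha>)) \<le> c * exp (- h (\<nu> + 1) (mi_vec \<alpha>))"
    using h_decreasing[OF assms] by blast
  have "exp (- h \<nu> (mi_vec \<alpha>)) \<le> 2 ^ mi_order \<alpha> * exp (- h \<nu> (mi_vec \<alpha>))" for \<alpha>
    by (simp add: mult_le_cancel_right1)
  then show ?thesis using c by (meson order.trans)
qed

text \<open>Split \<alpha> into \<alpha> - \<gamma> and \<gamma>. As \<gamma> stays below
  \<open>m\<close> in each coordinate, monotonicity bounds its contribution by \<open>H\<close>, so
  the constant depends on \<open>m\<close> but on neither multi-index.\<close>

lemma h_subadditive:
  assumes "\<nu> \<ge> 1"
  shows "\<exists>c>0. \<forall>\<alpha> \<gamma>. (\<forall>k. \<gamma> k \<le> \<alpha> k) \<longrightarrow> (\<forall>k. \<gamma> k \<le> m) \<longrightarrow>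
      exp (- h \<nu> (mi_vec (\<lambda>k. \<alpha> k - \<gamma> k))) \<le> c * exp (- h (\<nu> + 1) (mi_vec \<alpha>))"
proof -
  obtain l where l: "\<And>x y. (\<forall>j. 0 \<le> x $ j) \<Longrightarrow> (\<forall>j. 0 \<le> y $ j) \<Longrightarrow>
      h (\<nu> + 1) (x + y) \<le> h \<nu> x + h \<nu> y + l"
    using subadditive[OF assms] by metis
  define H where "H = h \<nu> (mi_vec (\<lambda>_. m))"
  have "exp (- h \<nu> (mi_vec (\<lambda>k. \<alpha> k - \<gamma> k))) \<le> exp (H + l) * exp (- h (\<nu> + 1) (mi_vec \<alpha>))"
    if "\<And>k. \<gamma> k \<le> \<alpha> k" "\<And>k. \<gamma> k \<le> m" for \<alpha> \<gamma>
  proof -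
    have "mi_vec (\<lambda>k. \<alpha> k - \<gamma> k) + mi_vec \<gamma> = mi_vec \<alpha>"
      using that by (simp add: mi_vec_def vec_eq_iff of_nat_diff)
    moreover have "h (\<nu> + 1) (mi_vec (\<lambda>k. \<alpha> k - \<gamma> k) + mi_vec \<gamma>) \<le>
        h \<nu> (mi_vec (\<lambda>k. \<alpha> k - \<gamma> k)) + h \<nu> (mi_vec \<gamma>) + l"
      by (rule l) (auto simp: mi_vec_def)
    moreover have "h \<nu> (mi_vec \<gamma>) \<le> H"
      unfolding H_def by (rule h_mono[OF assms that(2)])
    ultimately show ?thesis by (simp add: exp_add[symmetric])
  qed
  then show ?thesis by (intro exI[of _ "exp (H + l)"]) simp
qed

text \<open>The monomial that replaces \<open>(1 + norm x) ^ m\<close> depends on \<open>x\<close>,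
  so the bound must be freed of its exponent \<beta>: the coordinates of \<beta> are at most
  \<open>m\<close>, which bounds the factorial, and monotonicity compares the weight at \<beta> with
  the weight at 0.\<close>

lemma G_space_rapid:
  assumes "\<nu> \<ge> 1" and f: "f \<in> G_space (h \<nu>)"
  shows "rapid f"
proof -
  have "\<exists>C. \<forall>x. (1 + norm x) ^ m * cmod (mi_deriv \<alpha> f x) \<le> C" for \<alpha> m
  proof -
    obtain N where N: "N \<ge> 0" "G_norm (h \<nu>) (mi_order \<alpha>) f = ennreal N"
      using f ennreal_finite_le unfolding G_space_iff by blast
    have b: "cmod (of_real (mi_power x \<beta>) * mi_deriv \<alpha> f x) \<le> N * (mi_fact \<beta> * exp (- h \<nu> (mi_vec \<beta>)))" for x \<beta>
      using N G_norm_le_iff[of N "h \<nu>" "mi_order \<alpha>" f] by simp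
    have "(1 + norm x) ^ m * cmod (mi_deriv \<alpha> f x) \<le>
        (1 + real CARD('n)) ^ m * (N * (mi_fact (\<lambda>_ :: 'n. m) * exp (- h \<nu> (mi_vec (\<lambda>_. 0)))))" for x
    proof -
      obtain \<beta> where \<beta>: "mi_order \<beta> \<le> m"
        "(1 + norm x) ^ m \<le> (1 + real CARD('n)) ^ m * \<bar>mi_power x \<beta>\<bar>"
        by (rule norm_power_le_mi_power)
      have "(1 + norm x) ^ m * cmod (mi_deriv \<alpha> f x) \<le>
          (1 + real CARD('n)) ^ m * \<bar>mi_power x \<beta>\<bar> * cmod (mi_deriv \<alpha> f x)"
        by (rule mult_right_mono[OF \<beta>(2)]) simp
      also have "\<dots> = (1 + real CARD('n)) ^ m * cmod (of_real (mi_power x \<beta>) * mi_deriv \<alpha> f x)"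
        by (simp add: norm_mult)
      also have "\<dots> \<le> (1 + real CARD('n)) ^ m * (N * (mi_fact \<beta> * exp (- h \<nu> (mi_vec \<beta>))))"
        by (intro mult_left_mono b) auto
      also have "\<dots> \<le> (1 + real CARD('n)) ^ m * (N * (mi_fact (\<lambda>_ :: 'n. m) * exp (- h \<nu> (mi_vec (\<lambda>_. 0)))))"
        using N(1) assms(1) \<beta>(1)
        by (intro mult_left_mono mult_mono mi_fact_mono)
          (auto intro: h_mono order.trans[OF mi_le_order])
      finally show ?thesis .
    qed
    then show ?thesis by blast
  qed
  then show ?thesis using f by (simp add: rapid_def G_space_iff)
qed

text \<open>Raising an exponent by at most 2 multiplies its factorial by at most a quadratic
  polynomial. A multiple of a power of 2 dominates it, and such growth is absorbed by one step in
  the weight sequence.\<close>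

lemma mi_fact_add_le:
  assumes "\<And>j. \<sigma> j \<le> 2"
  shows "mi_fact (\<lambda>j. \<delta> j + \<sigma> j) \<le> 6 ^ CARD('n) * 2 ^ mi_order \<delta> * mi_fact (\<delta> :: 'n \<Rightarrow> nat)"
proof -
  have d: "(real d + 1) * (real d + 2) \<le> 6 * 2 ^ d" for d
  proof (induction d)
    case (Suc d)
    show ?case
    \<comment> \<open>From \<open>d\<close> to \<open>Suc d\<close> the left side grows by the
      factor (d + 3) / (d + 1), which is at most 2 once d \<ge> 1.\<close>
    proof (cases "d \<le> 1")
      case True
      then have "d = 0 \<or> d = 1" by auto
      then show ?thesis by auto
    next
      case False
      then have "(real d + 2) * (real d + 3) \<le> 2 * ((real d + 1) * (real d + 2))"
        by (auto simp: algebra_simps intro!: add_increasing2)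
      then show ?thesis using Suc by (simp add: algebra_simps)
    qed
  qed simp
  have "fact (\<delta> j + \<sigma> j) \<le> 6 * 2 ^ \<delta> j * (fact (\<delta> j) :: real)" for j
  proof -
    have "fact (\<delta> j + \<sigma> j) \<le> (fact (\<delta> j + 2) :: real)"
      using assms by (intro fact_mono) auto
    also have "\<dots> = (real (\<delta> j) + 1) * (real (\<delta> j) + 2) * fact (\<delta> j)"
      by (simp add: algebra_simps)
    also have "\<dots> \<le> 6 * 2 ^ \<delta> j * fact (\<delta> j)" by (intro mult_right_mono d) auto
    finally show ?thesis .
  qed
  then have "mi_fact (\<lambda>j. \<delta> j + \<sigma> j) \<le> (\<Prod>j\<in>UNIV. 6 * 2 ^ \<delta> j * fact (\<delta> j))"
    unfolding mi_fact_def by (intro prod_mono) auto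
  then show ?thesis
    by (simp add: prod.distrib mi_fact_def mi_order_def power_sum)
qed

text \<open>Here \<alpha> is arbitrary while \<beta> has order at most \<open>m\<close>, as it stems
  from \<open>(1 + norm x) ^ m\<close>; hence there are at most \<open>2 ^ m\<close> Leibniz terms.
  The growing factor \<open>2 ^ mi_order \<alpha>\<close> comes from the integrability weight
  instead, whose monomial raises the exponent of \<xi> and with it the factorial in the bound for
  \<open>f\<close>.\<close>

theorem fourier_G_E:
  assumes "\<nu> \<ge> 1"
  shows "\<exists>C\<ge>0. \<forall>f N. rapid f \<longrightarrow> N \<ge> 0 \<longrightarrow> G_norm (h \<nu>) m f \<le> ennreal N \<longrightarrow>
    E_norm (h (\<nu> + 2)) m (fourier f) \<le> ennreal (C * N)"
proof -
  define K where "K = fourier_const TYPE('n)"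
  have K: "K \<ge> 0" by (simp add: K_def fourier_const_nonneg)
  obtain c1 where c1: "c1 > 0"
    "\<And>\<alpha> \<gamma>. (\<And>k. \<gamma> k \<le> \<alpha> k) \<Longrightarrow> (\<And>k. \<gamma> k \<le> m) \<Longrightarrow>
      exp (- h \<nu> (mi_vec (\<lambda>k. \<alpha> k - \<gamma> k))) \<le> c1 * exp (- h (\<nu> + 1) (mi_vec \<alpha>))"
    using h_subadditive[OF assms, of m] by blast
  obtain c2 where c2: "c2 > 0"
    "\<And>\<alpha>. 2 ^ mi_order \<alpha> * exp (- h (\<nu> + 1) (mi_vec \<alpha>)) \<le> c2 * exp (- h (\<nu> + 2) (mi_vec \<alpha>))"
    using h_decreasing[of "\<nu> + 1"] assms by (auto simp: numeral_2_eq_2)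
  let ?n = "CARD('n)"
  define C where "C = (1 + real ?n) ^ m * (K * (2 ^ m * (2 ^ ?n * 6 ^ ?n * c1 * c2)))"
  have "C \<ge> 0" using K c1(1) c2(1) by (simp add: C_def)
  moreover have "E_norm (h (\<nu> + 2)) m (fourier f) \<le> ennreal (C * N)"
    if f: "rapid f" and N: "N \<ge> 0" "G_norm (h \<nu>) m f \<le> ennreal N" for f :: "real ^ 'n \<Rightarrow> complex" and N
  proof -
    have Nb: "\<bar>mi_power x \<beta>\<bar> * cmod (mi_deriv \<alpha> f x) \<le> N * (mi_fact \<beta> * exp (- h \<nu> (mi_vec \<beta>)))"
      if "mi_order \<alpha> \<le> m" for x \<beta> \<alpha>
      using N that by (simp add: G_norm_le_iff norm_mult)
    have "(1 + norm x) ^ m * cmod (mi_deriv \<alpha> (fourier f) x) \<le> C * N * (mi_fact \<alpha> * exp (- h (\<nu> + 2) (mi_vec \<alpha>)))"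
      for x \<alpha>
    proof -
      obtain \<beta> where \<beta>: "mi_order \<beta> \<le> m"
        "(1 + norm x) ^ m \<le> (1 + real ?n) ^ m * \<bar>mi_power x \<beta>\<bar>"
        by (rule norm_power_le_mi_power)
      define B where "B = 2 ^ ?n * 6 ^ ?n * c1 * c2 * N * (mi_fact \<alpha> * exp (- h (\<nu> + 2) (mi_vec \<alpha>)))"
      have "weight \<xi> * cmod (mi_deriv \<beta> (\<lambda>\<xi>. of_real (mi_power \<xi> \<alpha>) * f \<xi>) \<xi>) \<le> 2 ^ mi_order \<beta> * B" for \<xi>
      proof (rule norm_mi_deriv_mi_power_times_le)
        fix \<gamma> :: "'n \<Rightarrow> nat"
        assume \<gamma>: "\<And>k. \<gamma> k \<le> \<beta> k" "\<And>k. \<gamma> k \<le> \<alpha> k"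
        let ?d = "\<lambda>j. \<alpha> j - \<gamma> j" and ?D = "cmod (mi_deriv (\<lambda>j. \<beta> j - \<gamma> j) f \<xi>)"
        obtain \<sigma> where \<sigma>: "\<And>j. \<sigma> j \<le> 2" "weight \<xi> \<le> 2 ^ ?n * \<bar>mi_power \<xi> \<sigma>\<bar>"
          using weight_le_mi_power[of \<xi>] by blast
        have ord: "mi_order (\<lambda>j. \<beta> j - \<gamma> j) \<le> m" "mi_order ?d \<le> mi_order \<alpha>" "\<gamma> k \<le> m" for k
          using \<beta>(1) order.trans[OF mi_order_mono[of "\<lambda>j. \<beta> j - \<gamma> j" \<beta>]] mi_order_mono[of ?d \<alpha>]
            \<gamma>(1)[of k] mi_le_order[of \<beta> k] by auto
        have "weight \<xi> * (mi_fact \<alpha> / mi_fact ?d) * cmod (of_real (mi_power \<xi> ?d) * mi_deriv (\<lambda>j. \<beta> j - \<gamma> j) f \<xi>)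
            = weight \<xi> * ((mi_fact \<alpha> / mi_fact ?d) * (\<bar>mi_power \<xi> ?d\<bar> * ?D))"
          by (simp add: norm_mult)
        also have "\<dots> \<le> 2 ^ ?n * \<bar>mi_power \<xi> \<sigma>\<bar> * ((mi_fact \<alpha> / mi_fact ?d) * (\<bar>mi_power \<xi> ?d\<bar> * ?D))"
          by (intro mult_right_mono \<sigma>) auto
        \<comment> \<open>Merging the two monomials lets the \<open>G\<close> bound be applied at
          the exponent \<alpha> - \<gamma> + \<sigma>. Up to the loss in
          \<open>mi_fact_add_le\<close>, its factorial cancels the denominator
          \<open>mi_fact ?d\<close> and leaves \<open>mi_fact \<alpha>\<close>.\<close>
        also have "\<dots> = 2 ^ ?n * (mi_fact \<alpha> / mi_fact ?d) * (\<bar>mi_power \<xi> (\<lambda>j. ?d j + \<sigma> j)\<bar> * ?D)"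
          by (simp add: mi_power_add abs_mult)
        also have "\<dots> \<le> 2 ^ ?n * (mi_fact \<alpha> / mi_fact ?d) *
            (N * (6 ^ ?n * 2 ^ mi_order \<alpha> * mi_fact ?d * (c1 * exp (- h (\<nu> + 1) (mi_vec \<alpha>)))))"
        proof (intro mult_left_mono)
          have "mi_fact (\<lambda>j. ?d j + \<sigma> j) \<le> 6 ^ ?n * 2 ^ mi_order ?d * mi_fact ?d"
            by (rule mi_fact_add_le[OF \<sigma>(1)])
          also have "\<dots> \<le> 6 ^ ?n * 2 ^ mi_order \<alpha> * mi_fact ?d"
            using ord by (intro mult_right_mono mult_left_mono power_increasing) auto
          finally have 1: "mi_fact (\<lambda>j. ?d j + \<sigma> j) \<le> 6 ^ ?n * 2 ^ mi_order \<alpha> * mi_fact ?d" .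
          \<comment> \<open>Monotonicity discards \<sigma>; subadditivity then undoes the shift by
            \<gamma>, which stays within \<open>m\<close> because \<gamma> lies below
            \<beta>.\<close>
          have "h \<nu> (mi_vec ?d) \<le> h \<nu> (mi_vec (\<lambda>j. ?d j + \<sigma> j))" by (rule h_mono[OF assms]) simp
          then have 2: "exp (- h \<nu> (mi_vec (\<lambda>j. ?d j + \<sigma> j))) \<le> c1 * exp (- h (\<nu> + 1) (mi_vec \<alpha>))"
            using c1(2)[of \<gamma> \<alpha>] \<gamma>(2) ord(3) by (smt (verit) exp_le_cancel_iff)
          show "\<bar>mi_power \<xi> (\<lambda>j. ?d j + \<sigma> j)\<bar> * ?D \<le>
              N * (6 ^ ?n * 2 ^ mi_order \<alpha> * mi_fact ?d * (c1 * exp (- h (\<nu> + 1) (mi_vec \<alpha>))))"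
            by (rule order.trans[OF Nb[OF ord(1)]])
              (intro mult_left_mono mult_mono 1 2 N(1); simp)
        qed auto
        also have "\<dots> = 2 ^ ?n * 6 ^ ?n * c1 * N * mi_fact \<alpha> * (2 ^ mi_order \<alpha> * exp (- h (\<nu> + 1) (mi_vec \<alpha>)))"
          by (simp add: field_simps)
        also have "\<dots> \<le> 2 ^ ?n * 6 ^ ?n * c1 * N * mi_fact \<alpha> * (c2 * exp (- h (\<nu> + 2) (mi_vec \<alpha>)))"
          using c1(1) N(1) by (intro mult_left_mono c2) auto
        also have "\<dots> = B" by (simp add: B_def)
        finally show "weight \<xi> * (mi_fact \<alpha> / mi_fact ?d) *
            cmod (of_real (mi_power \<xi> ?d) * mi_deriv (\<lambda>j. \<beta> j - \<gamma> j) f \<xi>) \<le> B" .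
      qed (use f weight_pos[of \<xi>] in \<open>auto simp: rapid_def\<close>)
      from norm_mi_power_fourier_le[OF f this, folded K_def] have "\<bar>mi_power x \<beta>\<bar> * cmod (mi_deriv \<alpha> (fourier f) x) \<le> K * (2 ^ mi_order \<beta> * B)"
        by (simp add: norm_mult)
      also have "\<dots> \<le> K * (2 ^ m * B)"
        using \<beta>(1) K N(1) c1(1) c2(1) by (intro mult_left_mono mult_right_mono power_increasing) (auto simp: B_def)
      finally have "(1 + real ?n) ^ m * (\<bar>mi_power x \<beta>\<bar> * cmod (mi_deriv \<alpha> (fourier f) x)) \<le>
          (1 + real ?n) ^ m * (K * (2 ^ m * B))"
        by (rule mult_left_mono) simp
      then have "(1 + norm x) ^ m * cmod (mi_deriv \<alpha> (fourier f) x) \<le> (1 + real ?n) ^ m * (K * (2 ^ m * B))"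
        using mult_right_mono[OF \<beta>(2), of "cmod (mi_deriv \<alpha> (fourier f) x)"]
        unfolding mult.assoc by (rule order.trans[rotated]) simp
      also have "\<dots> = C * N * (mi_fact \<alpha> * exp (- h (\<nu> + 2) (mi_vec \<alpha>)))"
        by (simp add: B_def C_def)
      finally show ?thesis .
    qed
    then show ?thesis using \<open>C \<ge> 0\<close> N(1) by (simp add: E_norm_le_iff)
  qed
  ultimately show ?thesis by blast
qed

text \<open>The roles are exchanged: \<alpha> has order at most \<open>m\<close>, \<beta> is
  arbitrary, and \<open>2 ^ mi_order \<beta>\<close> counts the Leibniz terms. Weight and monomial
  together are dominated by the power \<open>2 * CARD('n) + m\<close> of
  \<open>1 + norm \<xi>\<close>, hence the loss in the order of the norm.\<close>

theorem fourier_E_G: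
  assumes "\<nu> \<ge> 1"
  shows "\<exists>C\<ge>0. \<forall>f N. rapid f \<longrightarrow> N \<ge> 0 \<longrightarrow> E_norm (h \<nu>) (2 * CARD('n) + m) f \<le> ennreal N \<longrightarrow>
    G_norm (h (\<nu> + 2)) m (fourier f) \<le> ennreal (C * N)"
proof -
  define K where "K = fourier_const TYPE('n)"
  have K: "K \<ge> 0" by (simp add: K_def fourier_const_nonneg)
  obtain c1 where c1: "c1 > 0"
    "\<And>\<alpha> \<gamma>. (\<And>k. \<gamma> k \<le> \<alpha> k) \<Longrightarrow> (\<And>k. \<gamma> k \<le> m) \<Longrightarrow>
      exp (- h \<nu> (mi_vec (\<lambda>k. \<alpha> k - \<gamma> k))) \<le> c1 * exp (- h (\<nu> + 1) (mi_vec \<alpha>))"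
    using h_subadditive[OF assms, of m] by blast
  obtain c2 where c2: "c2 > 0"
    "\<And>\<alpha>. 2 ^ mi_order \<alpha> * exp (- h (\<nu> + 1) (mi_vec \<alpha>)) \<le> c2 * exp (- h (\<nu> + 2) (mi_vec \<alpha>))"
    using h_decreasing[of "\<nu> + 1"] assms by (auto simp: numeral_2_eq_2)
  let ?F = "mi_fact (\<lambda>_ :: 'n. m)"
  define C where "C = K * (?F * c1 * c2)"
  have "C \<ge> 0" using K c1(1) c2(1) by (simp add: C_def)
  moreover have "G_norm (h (\<nu> + 2)) m (fourier f) \<le> ennreal (C * N)"
    if f: "rapid f" and N: "N \<ge> 0" "E_norm (h \<nu>) (2 * CARD('n) + m) f \<le> ennreal N"
    for f :: "real ^ 'n \<Rightarrow> complex" and N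
  proof -
    have Nb: "(1 + norm x) ^ (2 * CARD('n) + m) * cmod (mi_deriv \<beta> f x) \<le> N * (mi_fact \<beta> * exp (- h \<nu> (mi_vec \<beta>)))"
      for x \<beta>
      using N by (simp add: E_norm_le_iff)
    have "cmod (of_real (mi_power x \<beta>) * mi_deriv \<alpha> (fourier f) x) \<le>
        C * N * (mi_fact \<beta> * exp (- h (\<nu> + 2) (mi_vec \<beta>)))" if \<alpha>: "mi_order \<alpha> \<le> m" for x \<alpha> \<beta>
    proof -
      define B where "B = ?F * (N * (mi_fact \<beta> * (c1 * exp (- h (\<nu> + 1) (mi_vec \<beta>)))))"
      have "weight \<xi> * cmod (mi_deriv \<beta> (\<lambda>\<xi>. of_real (mi_power \<xi> \<alpha>) * f \<xi>) \<xi>) \<le> 2 ^ mi_order \<beta> * B" for \<xi>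
      proof (rule norm_mi_deriv_mi_power_times_le)
        fix \<gamma> :: "'n \<Rightarrow> nat"
        assume \<gamma>: "\<And>k. \<gamma> k \<le> \<beta> k" "\<And>k. \<gamma> k \<le> \<alpha> k"
        let ?d = "\<lambda>j. \<beta> j - \<gamma> j" and ?a = "\<lambda>j. \<alpha> j - \<gamma> j"
        have am: "\<alpha> k \<le> m" for k using mi_le_order[of \<alpha> k] \<alpha> by simp
        have "weight \<xi> * (mi_fact \<alpha> / mi_fact ?a) * cmod (of_real (mi_power \<xi> ?a) * mi_deriv ?d f \<xi>) \<le>
            mi_fact \<alpha> * ((1 + norm \<xi>) ^ (2 * CARD('n) + mi_order \<alpha>) * cmod (mi_deriv ?d f \<xi>))"
          by (rule weight_leibniz_coefficient_le)
        also have "\<dots> \<le> ?F * ((1 + norm \<xi>) ^ (2 * CARD('n) + m) * cmod (mi_deriv ?d f \<xi>))"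
          using \<alpha> am by (intro mult_mono mi_fact_mono power_increasing) auto
        also have "\<dots> \<le> ?F * (N * (mi_fact ?d * exp (- h \<nu> (mi_vec ?d))))"
          by (intro mult_left_mono Nb) simp
        \<comment> \<open>The factorial of \<open>?d\<close> is at most that of \<beta>; since
          \<gamma> lies below \<alpha>, the shift stays within \<open>m\<close> and subadditivity
          applies.\<close>
        also have "\<dots> \<le> B"
          unfolding B_def using N(1) c1(1) \<gamma>(1) order.trans[OF \<gamma>(2) am]
          by (intro mult_left_mono mult_mono mi_fact_mono c1(2)) auto
        finally show "weight \<xi> * (mi_fact \<alpha> / mi_fact ?a) *
            cmod (of_real (mi_power \<xi> ?a) * mi_deriv ?d f \<xi>) \<le> B" .
      qed (use f weight_pos[of \<xi>] in \<open>auto simp: rapid_def\<close>)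
      from norm_mi_power_fourier_le[OF f this, folded K_def]
      have "cmod (of_real (mi_power x \<beta>) * mi_deriv \<alpha> (fourier f) x) \<le> K * (2 ^ mi_order \<beta> * B)" .
      also have "\<dots> = K * ?F * c1 * N * mi_fact \<beta> * (2 ^ mi_order \<beta> * exp (- h (\<nu> + 1) (mi_vec \<beta>)))"
        by (simp add: B_def)
      also have "\<dots> \<le> K * ?F * c1 * N * mi_fact \<beta> * (c2 * exp (- h (\<nu> + 2) (mi_vec \<beta>)))"
        using K c1(1) N(1) by (intro mult_left_mono c2) auto
      finally show ?thesis by (simp add: C_def mult_ac)
    qed
    then show ?thesis using \<open>C \<ge> 0\<close> N(1) by (simp add: G_norm_le_iff)
  qed
  ultimately show ?thesis by blast
qed

end

section \<open>Inductive limits of spaces of functions\<close>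

definition lin_space :: "('x \<Rightarrow> complex) set \<Rightarrow> bool" where
  "lin_space V \<longleftrightarrow> (\<lambda>x. 0) \<in> V \<and> (\<forall>f\<in>V. \<forall>g\<in>V. (\<lambda>x. f x + g x) \<in> V) \<and>
    (\<forall>c. \<forall>f\<in>V. (\<lambda>x. c * f x) \<in> V)"

definition lin_on :: "('x \<Rightarrow> complex) set \<Rightarrow> (('x \<Rightarrow> complex) \<Rightarrow> 'y \<Rightarrow> complex) \<Rightarrow> bool" where
  "lin_on V F \<longleftrightarrow> (\<forall>f\<in>V. \<forall>g\<in>V. F (\<lambda>x. f x + g x) = (\<lambda>y. F f y + F g y)) \<and>
    (\<forall>c. \<forall>f\<in>V. F (\<lambda>x. c * f x) = (\<lambda>y. c * F f y))"

definition subadditive_norms :: "('x \<Rightarrow> complex) set \<Rightarrow> (nat \<Rightarrow> ('x \<Rightarrow> complex) \<Rightarrow> ennreal) \<Rightarrow> bool" where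
  "subadditive_norms V p \<longleftrightarrow> lin_space V \<and>
    (\<forall>m. p m (\<lambda>x. 0) = 0 \<and> (\<forall>f\<in>V. \<forall>g\<in>V. p m (\<lambda>x. f x + g x) \<le> p m f + p m g))"

lemma lin_space_add: "lin_space V \<Longrightarrow> f \<in> V \<Longrightarrow> g \<in> V \<Longrightarrow> (\<lambda>x. f x + g x) \<in> V"
  and lin_space_cmult: "lin_space V \<Longrightarrow> f \<in> V \<Longrightarrow> (\<lambda>x. c * f x) \<in> V"
  and lin_space_zero: "lin_space V \<Longrightarrow> (\<lambda>x. 0) \<in> V"
  unfolding lin_space_def by blast+

lemma lin_on_add: "lin_on V F \<Longrightarrow> f \<in> V \<Longrightarrow> g \<in> V \<Longrightarrow> F (\<lambda>x. f x + g x) = (\<lambda>y. F f y + F g y)"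
  and lin_on_cmult: "lin_on V F \<Longrightarrow> f \<in> V \<Longrightarrow> F (\<lambda>x. c * f x) = (\<lambda>y. c * F f y)"
  unfolding lin_on_def by blast+

lemma lin_space_diff: "lin_space V \<Longrightarrow> f \<in> V \<Longrightarrow> g \<in> V \<Longrightarrow> (\<lambda>x. f x - g x) \<in> V"
  using lin_space_add[of V f "\<lambda>x. - 1 * g x"] lin_space_cmult[of V g "- 1"] by simp

lemma lin_on_diff:
  assumes "lin_space V" "lin_on V F" "f \<in> V" "g \<in> V"
  shows "F (\<lambda>x. f x - g x) = (\<lambda>y. F f y - F g y)"
  using lin_on_add[OF assms(2,3) lin_space_cmult[OF assms(1,4), of "- 1"]]
    lin_on_cmult[OF assms(2,4), of "- 1"] by simp

lemma lin_on_zero: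
  assumes "lin_space V" "lin_on V F"
  shows "F (\<lambda>x. 0) = (\<lambda>y. 0)"
  using lin_on_cmult[OF assms(2) lin_space_zero[OF assms(1)], of 0] by simp

lemma subadditive_norms_add:
  "subadditive_norms V p \<Longrightarrow> f \<in> V \<Longrightarrow> g \<in> V \<Longrightarrow> p m (\<lambda>x. f x + g x) \<le> p m f + p m g"
  by (simp add: subadditive_norms_def)

lemma subadditive_norms_lin_space: "subadditive_norms V p \<Longrightarrow> lin_space V"
  by (simp add: subadditive_norms_def)

section \<open>Topologies generated by norm balls\<close>

lemma topspace_norms_topology:
  assumes "subadditive_norms V p"
  shows "topspace (norms_topology V p) = V"
proof -
  have "f \<in> {g \<in> V. p 0 (\<lambda>x. g x - f x) < ennreal 1}" if "f \<in> V" for f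
    using that assms by (simp add: subadditive_norms_def)
  moreover have "(0::real) < 1" by simp
  ultimately show ?thesis
    unfolding norms_topology_def topology_generated_by_topspace by blast
qed

text \<open>The generating balls have arbitrary centres, so the image of a point \<open>u0\<close>
  of the preimage need not be the centre \<open>f\<close>; the triangle inequality works with the
  remaining distance \<open>\<epsilon> - r\<close>. The bound is phrased through a real
  \<open>N\<close> to match the Fourier estimates.\<close>

lemma continuous_map_norms_topology:
  assumes V: "subadditive_norms V q" and W: "subadditive_norms W p"
    and F: "F ` V \<subseteq> W" "lin_on V F"
    and bound: "\<And>m. \<exists>m'. \<exists>C\<ge>0. \<forall>f\<in>V. \<forall>N\<ge>0. q m' f \<le> ennreal N \<longrightarrow> p m (F f) \<le> ennreal (C * N)"
  shows "continuous_map (norms_topology V q) (norms_topology W p) F"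
  unfolding norms_topology_def[of W]
proof (rule continuous_on_generated_topo)
  have lV: "lin_space V" and lW: "lin_space W"
    using V W by (auto simp: subadditive_norms_def)
  note tV = topspace_norms_topology[OF V]
  show "F ` topspace (norms_topology V q) \<subseteq> \<Union> {{g \<in> W. p m (\<lambda>x. g x - f x) < ennreal \<epsilon>} |f m \<epsilon>. f \<in> W \<and> 0 < \<epsilon>}"
    using topspace_norms_topology[OF W, unfolded norms_topology_def topology_generated_by_topspace] F(1)
    by (simp only: tV)
  fix U assume "U \<in> {{g \<in> W. p m (\<lambda>x. g x - f x) < ennreal \<epsilon>} |f m \<epsilon>. f \<in> W \<and> 0 < \<epsilon>}"
  then obtain f m \<epsilon> where U: "U = {g \<in> W. p m (\<lambda>x. g x - f x) < ennreal \<epsilon>}" and f: "f \<in> W" "\<epsilon> > 0"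
    by blast
  obtain m' C where C: "C \<ge> 0"
    "\<And>u N. u \<in> V \<Longrightarrow> N \<ge> 0 \<Longrightarrow> q m' u \<le> ennreal N \<Longrightarrow> p m (F u) \<le> ennreal (C * N)"
    using bound[of m] by blast
  show "openin (norms_topology V q) (F -` U \<inter> topspace (norms_topology V q))"
    unfolding tV
  proof (subst openin_subopen, rule ballI)
    fix u0 assume u0: "u0 \<in> F -` U \<inter> V"
    then have "p m (\<lambda>x. F u0 x - f x) < ennreal \<epsilon>" by (simp add: U)
    then obtain r where r: "p m (\<lambda>x. F u0 x - f x) = ennreal r" "0 \<le> r" "r < \<epsilon>"
      using f(2) by (cases "p m (\<lambda>x. F u0 x - f x)") (auto simp: ennreal_less_iff)
    \<comment> \<open>Dividing by \<open>C + 1\<close> instead of \<open>C\<close> covers C = 0 and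
      makes the resulting inequality strict.\<close>
    define \<delta> where "\<delta> = (\<epsilon> - r) / (C + 1)"
    have \<delta>: "\<delta> > 0" using r C(1) by (simp add: \<delta>_def)
    have C\<delta>: "C * \<delta> + r < \<epsilon>"
    proof -
      have "C * \<delta> < (C + 1) * \<delta>" using \<delta> by simp
      also have "(C + 1) * \<delta> = \<epsilon> - r" using C(1) by (simp add: \<delta>_def)
      finally show ?thesis by simp
    qed
    define B where "B = {u \<in> V. q m' (\<lambda>x. u x - u0 x) < ennreal \<delta>}"
    have "openin (norms_topology V q) B"
      unfolding norms_topology_def B_def using u0 \<delta> by (intro topology_generated_by_Basis) blast
    moreover have "u0 \<in> B"
      using u0 \<delta> V by (simp add: B_def subadditive_norms_def)
    moreover have "B \<subseteq> F -` U \<inter> V"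
    proof
      fix u assume u: "u \<in> B"
      then have uV: "u \<in> V" "q m' (\<lambda>x. u x - u0 x) \<le> ennreal \<delta>" by (auto simp: B_def)
      have d: "(\<lambda>x. F u x - F u0 x) \<in> W" "(\<lambda>x. F u0 x - f x) \<in> W" "F u \<in> W"
        using u0 uV F(1) f lW by (auto intro!: lin_space_diff)
      have "p m (\<lambda>x. F u x - f x) = p m (\<lambda>x. (F u x - F u0 x) + (F u0 x - f x))" by simp
      also have "\<dots> \<le> p m (\<lambda>x. F u x - F u0 x) + p m (\<lambda>x. F u0 x - f x)"
        by (rule subadditive_norms_add[OF W d(1,2)])
      also have "\<dots> \<le> ennreal (C * \<delta>) + ennreal r"
      proof (intro add_mono)
        have "p m (F (\<lambda>x. u x - u0 x)) \<le> ennreal (C * \<delta>)"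
          using u0 uV \<delta> lV by (intro C(2) lin_space_diff) auto
        then show "p m (\<lambda>x. F u x - F u0 x) \<le> ennreal (C * \<delta>)"
          using u0 uV by (simp add: lin_on_diff[OF lV F(2)])
      qed (simp add: r)
      also have "\<dots> = ennreal (C * \<delta> + r)" using C(1) \<delta> r by simp
      also have "\<dots> < ennreal \<epsilon>" using C\<delta> C(1) \<delta> r by (intro ennreal_lessI) auto
      finally show "u \<in> F -` U \<inter> V" using uV d by (simp add: U)
    qed
    ultimately show "\<exists>T. openin (norms_topology V q) T \<and> u0 \<in> T \<and> T \<subseteq> F -` U \<inter> V" by blast
  qed
qed

text \<open>Linearity of \<open>F\<close> moves the vector operations to the target, where they are
  continuous, and makes preimages of convex sets convex. The pullbacks serve as competing topologies
  on the source in the universal property of the inductive limit.\<close>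

lemma locally_convex_pullback:
  assumes S: "locally_convex_topology W S" and V: "lin_space V"
    and F: "F ` V \<subseteq> W" "lin_on V F"
  shows "locally_convex_topology V (pullback_topology V F S)"
proof -
  let ?T = "pullback_topology V F S"
  have tS: "topspace S = W" using S by (simp add: locally_convex_topology_def)
  have tT: "topspace ?T = V"
    using F(1) tS by (auto simp: topspace_pullback_topology)
  have cF: "continuous_map ?T S F"
    using continuous_map_pullback[OF continuous_map_id, of V F S] by simp
  have add: "continuous_map (prod_topology ?T ?T) ?T (\<lambda>(f, g). \<lambda>x. f x + g x)"
  proof (rule continuous_map_pullback')
    have "continuous_map (prod_topology ?T ?T) (prod_topology S S) (\<lambda>z. (F (fst z), F (snd z)))"
      using continuous_map_compose[OF continuous_map_fst cF, of ?T]
        continuous_map_compose[OF continuous_map_snd cF, of ?T]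
      by (simp add: continuous_map_paired o_def)
    moreover have "continuous_map (prod_topology S S) S (\<lambda>(f, g). \<lambda>x. f x + g x)"
      using S by (simp add: locally_convex_topology_def)
    ultimately have "continuous_map (prod_topology ?T ?T) S ((\<lambda>(f, g). \<lambda>x. f x + g x) \<circ> (\<lambda>z. (F (fst z), F (snd z))))"
      by (rule continuous_map_compose)
    then show "continuous_map (prod_topology ?T ?T) S (F \<circ> (\<lambda>(f, g). \<lambda>x. f x + g x))"
      by (rule continuous_map_eq) (use F(2) in \<open>auto simp: tT lin_on_def\<close>)
    show "topspace (prod_topology ?T ?T) \<subseteq> (\<lambda>(f, g). \<lambda>x. f x + g x) -` V"
      using V by (auto simp: tT lin_space_def)
  qed
  have cmult: "continuous_map (prod_topology euclidean ?T) ?T (\<lambda>(c, f). \<lambda>x. c * f x)"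
  proof (rule continuous_map_pullback')
    have "continuous_map (prod_topology euclidean ?T) (prod_topology euclidean S) (\<lambda>z. (fst z, F (snd z)))"
      using continuous_map_fst[of euclidean ?T]
        continuous_map_compose[OF continuous_map_snd cF, of "euclidean"]
      by (simp add: continuous_map_paired o_def)
    moreover have "continuous_map (prod_topology euclidean S) S (\<lambda>(c, f). \<lambda>x. c * f x)"
      using S by (simp add: locally_convex_topology_def)
    ultimately have "continuous_map (prod_topology euclidean ?T) S ((\<lambda>(c, f). \<lambda>x. c * f x) \<circ> (\<lambda>z. (fst z, F (snd z))))"
      by (rule continuous_map_compose)
    then show "continuous_map (prod_topology euclidean ?T) S (F \<circ> (\<lambda>(c, f). \<lambda>x. c * f x))"
      by (rule continuous_map_eq) (use F(2) in \<open>auto simp: tT lin_on_def\<close>)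
    show "topspace (prod_topology euclidean ?T) \<subseteq> (\<lambda>(c, f). \<lambda>x. c * f x) -` V"
      using V by (auto simp: tT lin_space_def)
  qed
  have convex: "\<exists>B. openin ?T B \<and> (\<lambda>x. 0) \<in> B \<and> B \<subseteq> U \<and>
      (\<forall>f\<in>B. \<forall>g\<in>B. \<forall>t\<in>{0..1::real}. (\<lambda>x. of_real (1 - t) * f x + of_real t * g x) \<in> B)"
    if U: "openin ?T U" "(\<lambda>x. 0) \<in> U" for U
  proof -
    obtain U' where U': "openin S U'" "U = F -` U' \<inter> V"
      using U(1) by (auto simp: openin_pullback_topology)
    have F0: "F (\<lambda>x. 0) = (\<lambda>y. 0)" by (rule lin_on_zero[OF V F(2)])
    have "(\<lambda>y. 0) \<in> U'" using U(2) U'(2) F0 by auto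
    then obtain B where B: "openin S B" "(\<lambda>y. 0) \<in> B" "B \<subseteq> U'"
      "\<And>f g t. f \<in> B \<Longrightarrow> g \<in> B \<Longrightarrow> t \<in> {0..1::real} \<Longrightarrow>
        (\<lambda>x. of_real (1 - t) * f x + of_real t * g x) \<in> B"
      using S[unfolded locally_convex_topology_def, THEN conjunct2, THEN conjunct2, THEN conjunct2,
          rule_format, OF conjI, OF U'(1)] by blast
    have "openin ?T (F -` B \<inter> V)"
      using B(1) by (auto simp: openin_pullback_topology)
    moreover have "(\<lambda>x. 0) \<in> F -` B \<inter> V" using B(2) F0 V by (auto simp: lin_space_def)
    moreover have "F -` B \<inter> V \<subseteq> U" using B(3) U'(2) by auto
    moreover have "\<forall>f\<in>F -` B \<inter> V. \<forall>g\<in>F -` B \<inter> V. \<forall>t\<in>{0..1::real}.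
        (\<lambda>x. of_real (1 - t) * f x + of_real t * g x) \<in> F -` B \<inter> V"
    proof (intro ballI)
      fix f g and t :: real
      assume that: "f \<in> F -` B \<inter> V" "g \<in> F -` B \<inter> V" "t \<in> {0..1}"
      have c: "(\<lambda>x. of_real (1 - t) * f x) \<in> V" "(\<lambda>x. of_real t * g x) \<in> V"
        using that V by (auto intro: lin_space_cmult simp del: of_real_diff)
      have "F (\<lambda>x. of_real (1 - t) * f x + of_real t * g x) =
          (\<lambda>y. F (\<lambda>x. of_real (1 - t) * f x) y + F (\<lambda>x. of_real t * g x) y)"
        by (rule lin_on_add[OF F(2) c])
      also have "F (\<lambda>x. of_real (1 - t) * f x) = (\<lambda>y. of_real (1 - t) * F f y)"
        using that by (intro lin_on_cmult[OF F(2)]) simp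
      also have "F (\<lambda>x. of_real t * g x) = (\<lambda>y. of_real t * F g y)"
        using that by (intro lin_on_cmult[OF F(2)]) simp
      finally have "F (\<lambda>x. of_real (1 - t) * f x + of_real t * g x) \<in> B"
        using that by (simp add: B(4) del: of_real_diff)
      moreover have "(\<lambda>x. of_real (1 - t) * f x + of_real t * g x) \<in> V"
        by (rule lin_space_add[OF V c])
      ultimately show "(\<lambda>x. of_real (1 - t) * f x + of_real t * g x) \<in> F -` B \<inter> V" by simp
    qed
    ultimately show ?thesis by (intro exI[of _ "F -` B \<inter> V"] conjI)
  qed
  show ?thesis
    unfolding locally_convex_topology_def
  proof (intro conjI allI impI)
    fix U assume "openin ?T U \<and> (\<lambda>x. 0) \<in> U"
    then have U: "openin ?T U" "(\<lambda>x. 0) \<in> U" by auto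
    show "\<exists>B. openin ?T B \<and> (\<lambda>x. 0) \<in> B \<and> B \<subseteq> U \<and>
      (\<forall>f\<in>B. \<forall>g\<in>B. \<forall>t\<in>{0..1::real}. (\<lambda>x. of_real (1 - t) * f x + of_real t * g x) \<in> B)"
      using convex[OF U] .
  qed (fact tT add cmult)+
qed

text \<open>The indiscrete topology witnesses that the inductive limit topology lives on the whole union.\<close>

lemma topspace_inductive_limit_topology:
  assumes V: "lin_space (\<Union>i\<in>I. V i)" and T: "\<And>i. i \<in> I \<Longrightarrow> topspace (T i) = V i"
  shows "topspace (inductive_limit_topology I V T) = (\<Union>i\<in>I. V i)"
proof -
  let ?V = "\<Union>i\<in>I. V i"
  \<comment> \<open>Every map with values in the union is continuous into this pullback from a
    point, in particular both vector operations, and the only neighbourhood of 0 is the whole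
    union.\<close>
  let ?S = "pullback_topology ?V (\<lambda>_. ()) (discrete_topology UNIV)"
  have op: "openin ?S U \<longleftrightarrow> U = {} \<or> U = ?V" for U
  proof
    assume "openin ?S U"
    then obtain A where "U = (\<lambda>_. ()) -` A \<inter> ?V" by (auto simp: openin_pullback_topology)
    then show "U = {} \<or> U = ?V" by (cases "() \<in> A") auto
  next
    assume "U = {} \<or> U = ?V"
    then show "openin ?S U"
      unfolding openin_pullback_topology by (auto intro: exI[of _ "{}"] exI[of _ UNIV])
  qed
  have tS: "topspace ?S = ?V" by (simp add: topspace_pullback_topology)
  have cont: "continuous_map X ?S g" if "\<And>x. x \<in> topspace X \<Longrightarrow> g x \<in> ?V" for X :: "'z topology" and g
    using that by (intro continuous_map_pullback') (auto simp: o_def)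
  have "locally_convex_topology ?V ?S"
    unfolding locally_convex_topology_def
  proof (intro conjI allI impI)
    show "continuous_map (prod_topology ?S ?S) ?S (\<lambda>(f, g). \<lambda>x. f x + g x)"
      by (rule cont) (use V tS in \<open>auto simp: lin_space_def\<close>)
    show "continuous_map (prod_topology euclidean ?S) ?S (\<lambda>(c, f). \<lambda>x. c * f x)"
      by (rule cont) (use V tS in \<open>auto simp: lin_space_def\<close>)
    fix U assume U: "openin ?S U \<and> (\<lambda>x. 0) \<in> U"
    then have "U = ?V" unfolding op by auto
    have "(\<lambda>x. of_real (1 - t) * f x + of_real t * g x) \<in> ?V" if "f \<in> ?V" "g \<in> ?V" for f g and t :: real
      by (intro lin_space_add[OF V] lin_space_cmult[OF V] that)
    then show "\<exists>B. openin ?S B \<and> (\<lambda>x. 0) \<in> B \<and> B \<subseteq> U \<and>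
      (\<forall>f\<in>B. \<forall>g\<in>B. \<forall>t\<in>{0..1::real}. (\<lambda>x. of_real (1 - t) * f x + of_real t * g x) \<in> B)"
      using U unfolding \<open>U = ?V\<close> by (intro exI[of _ ?V] conjI ballI subset_refl) (simp_all only:)
  qed (rule tS)
  moreover have "continuous_map (T i) ?S (\<lambda>f. f)" if "i \<in> I" for i
    by (rule cont) (use that T in auto)
  moreover have "openin ?S ?V" unfolding op by simp
  ultimately have "?V \<subseteq> topspace (inductive_limit_topology I V T)"
    unfolding inductive_limit_topology_def topology_generated_by_topspace by blast
  moreover have "topspace (inductive_limit_topology I V T) \<subseteq> ?V"
    unfolding inductive_limit_topology_def topology_generated_by_topspace
    using openin_subset by (fastforce simp: locally_convex_topology_def)
  ultimately show ?thesis by blast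
qed

text \<open>An admissible topology \<open>R\<close> on the target pulls back to an admissible one on
  the source, because on each step \<open>F\<close> factors through some \<open>S j\<close>. Hence
  preimages of generators are generators. The index \<open>j\<close> may vary with \<open>i\<close>,
  which leaves room for a shift of the weight.\<close>

lemma continuous_map_inductive_limit_topology:
  fixes V :: "'i \<Rightarrow> ('x \<Rightarrow> complex) set" and W :: "'j \<Rightarrow> ('y \<Rightarrow> complex) set"
  assumes V: "lin_space (\<Union>i\<in>I. V i)" and W: "lin_space (\<Union>j\<in>J. W j)"
    and T: "\<And>i. i \<in> I \<Longrightarrow> topspace (T i) = V i" and S: "\<And>j. j \<in> J \<Longrightarrow> topspace (S j) = W j"
    and F: "lin_on (\<Union>i\<in>I. V i) F"
    and cont: "\<And>i. i \<in> I \<Longrightarrow> \<exists>j\<in>J. continuous_map (T i) (S j) F"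
  shows "continuous_map (inductive_limit_topology I V T) (inductive_limit_topology J W S) F"
proof -
  let ?V = "\<Union>i\<in>I. V i" and ?W = "\<Union>j\<in>J. W j"
  have tV: "topspace (inductive_limit_topology I V T) = ?V"
    by (rule topspace_inductive_limit_topology[OF V]) (rule T)
  have tW: "topspace (inductive_limit_topology J W S) = ?W"
    by (rule topspace_inductive_limit_topology[OF W]) (rule S)
  have FV: "F ` ?V \<subseteq> ?W"
  proof clarify
    fix i f assume i: "i \<in> I" "f \<in> V i"
    obtain j where j: "j \<in> J" "continuous_map (T i) (S j) F" using cont[OF i(1)] by blast
    then have "F f \<in> topspace (S j)"
      using i T[OF i(1)] by (auto simp: continuous_map_def)
    then show "F f \<in> ?W" using j(1) S by auto
  qed
  show ?thesis
    unfolding inductive_limit_topology_def[of J]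
  proof (rule continuous_on_generated_topo)
    show "F ` topspace (inductive_limit_topology I V T) \<subseteq>
        \<Union> {U. \<exists>R. locally_convex_topology ?W R \<and> (\<forall>j\<in>J. continuous_map (S j) R (\<lambda>f. f)) \<and> openin R U}"
      using FV tW[unfolded inductive_limit_topology_def topology_generated_by_topspace]
      by (simp only: tV)
    fix U assume "U \<in> {U. \<exists>R. locally_convex_topology ?W R \<and> (\<forall>j\<in>J. continuous_map (S j) R (\<lambda>f. f)) \<and> openin R U}"
    then obtain R where R: "locally_convex_topology ?W R" "\<And>j. j \<in> J \<Longrightarrow> continuous_map (S j) R (\<lambda>f. f)"
      "openin R U" by blast
    let ?P = "pullback_topology ?V F R"
    have "locally_convex_topology ?V ?P"
      by (rule locally_convex_pullback[OF R(1) V FV F])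
    moreover have "continuous_map (T i) ?P (\<lambda>f. f)" if i: "i \<in> I" for i
    proof (rule continuous_map_pullback')
      obtain j where j: "j \<in> J" "continuous_map (T i) (S j) F" using cont[OF i] by blast
      show "continuous_map (T i) R (F \<circ> (\<lambda>f. f))"
        using continuous_map_compose[OF j(2) R(2)[OF j(1)]] by (simp add: o_def)
      show "topspace (T i) \<subseteq> (\<lambda>f. f) -` ?V" using T i by auto
    qed
    moreover have "openin ?P (F -` U \<inter> ?V)" using R(3) by (auto simp: openin_pullback_topology)
    ultimately show "openin (inductive_limit_topology I V T) (F -` U \<inter> topspace (inductive_limit_topology I V T))"
      unfolding tV unfolding inductive_limit_topology_def by (intro topology_generated_by_Basis) blast
  qed
qed

lemma chain_le:
  assumes chain: "\<And>\<nu>::nat. \<nu> \<ge> 1 \<Longrightarrow> A \<nu> \<subseteq> A (\<nu> + 1)" and "1 \<le> \<nu>" "\<nu> \<le> \<mu>"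
  shows "A \<nu> \<subseteq> A \<mu>"
  using assms(3)
proof (induction rule: dec_induct)
  case base
  show ?case by (rule subset_refl)
next
  case (step n)
  have "A n \<subseteq> A (Suc n)" using assms(2) step(1) chain[of n] by simp
  then show ?case using step.IH by (rule subset_trans[rotated])
qed

text \<open>Two functions from different steps lie together in the later one, so the union of an
  increasing chain is closed under addition.\<close>

lemma lin_space_Union_chain:
  assumes lin: "\<And>\<nu>::nat. \<nu> \<ge> 1 \<Longrightarrow> lin_space (A \<nu>)" and chain: "\<And>\<nu>. \<nu> \<ge> 1 \<Longrightarrow> A \<nu> \<subseteq> A (\<nu> + 1)"
  shows "lin_space (\<Union>\<nu>\<in>{1..}. A \<nu>)"
  unfolding lin_space_def
proof (intro conjI ballI allI)
  show "(\<lambda>x. 0) \<in> (\<Union>\<nu>\<in>{1..}. A \<nu>)" using lin_space_zero[OF lin[of 1]] by auto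
next
  fix f g assume "f \<in> (\<Union>\<nu>\<in>{1..}. A \<nu>)" "g \<in> (\<Union>\<nu>\<in>{1..}. A \<nu>)"
  then obtain \<nu> \<mu> where fg: "f \<in> A \<nu>" "g \<in> A \<mu>" "\<nu> \<ge> 1" "\<mu> \<ge> 1" by auto
  then have "f \<in> A (max \<nu> \<mu>)" "g \<in> A (max \<nu> \<mu>)"
    using chain_le[of A \<nu> "max \<nu> \<mu>", OF chain] chain_le[of A \<mu> "max \<nu> \<mu>", OF chain] by auto
  then have "(\<lambda>x. f x + g x) \<in> A (max \<nu> \<mu>)" using lin fg by (intro lin_space_add) auto
  then show "(\<lambda>x. f x + g x) \<in> (\<Union>\<nu>\<in>{1..}. A \<nu>)" using fg(3) by (intro UN_I[of "max \<nu> \<mu>"]) auto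
next
  fix f c assume "f \<in> (\<Union>\<nu>\<in>{1..}. A \<nu>)"
  then obtain \<nu> where f: "f \<in> A \<nu>" "\<nu> \<ge> 1" by auto
  then show "(\<lambda>x. c * f x) \<in> (\<Union>\<nu>\<in>{1..}. A \<nu>)"
    using lin_space_cmult[OF lin f(1)] by (intro UN_I[of \<nu>]) auto
qed

section \<open>Vector space structure and triangle inequality for both scales of spaces\<close>

lemma subadditive_norms_G: "subadditive_norms (G_space h) (G_norm h)"
proof -
  have z: "G_norm h m (\<lambda>x. 0) = 0" for m
    using G_norm_le_iff[of 0 h m "\<lambda>x. 0"] by simp
  have add: "G_norm h m (\<lambda>x. f x + g x) \<le> G_norm h m f + G_norm h m g"
    if fg: "smooth f" "smooth g" "G_norm h m f < \<infinity>" "G_norm h m g < \<infinity>" for m f g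
  proof -
    obtain N M where N: "N \<ge> 0" "G_norm h m f = ennreal N" "M \<ge> 0" "G_norm h m g = ennreal M"
      using ennreal_finite_le[OF fg(3)] ennreal_finite_le[OF fg(4)] by blast
    have "cmod (of_real (mi_power x \<beta>) * mi_deriv \<alpha> (\<lambda>x. f x + g x) x) \<le>
        (N + M) * (mi_fact \<beta> * exp (- h (mi_vec \<beta>)))" if "mi_order \<alpha> \<le> m" for x \<alpha> \<beta>
      using N G_norm_le_iff[of N h m f] G_norm_le_iff[of M h m g] that
      by (auto simp: mi_deriv_add fg ring_distribs intro!: order.trans[OF norm_triangle_ineq] add_mono)
    then have "G_norm h m (\<lambda>x. f x + g x) \<le> ennreal (N + M)"
      using N by (subst G_norm_le_iff) auto
    then show ?thesis using N by (simp only: ennreal_plus)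
  qed
  have scale: "G_norm h m (\<lambda>x. c * f x) < \<infinity>" if f: "smooth f" "G_norm h m f < \<infinity>" for m c f
  proof -
    obtain N where N: "N \<ge> 0" "G_norm h m f = ennreal N" using ennreal_finite_le[OF f(2)] by blast
    have "cmod (of_real (mi_power x \<beta>) * mi_deriv \<alpha> (\<lambda>x. c * f x) x) \<le>
        (cmod c * N) * (mi_fact \<beta> * exp (- h (mi_vec \<beta>)))" if "mi_order \<alpha> \<le> m" for x \<alpha> \<beta>
    proof -
      have "cmod c * cmod (of_real (mi_power x \<beta>) * mi_deriv \<alpha> f x) \<le>
          cmod c * (N * (mi_fact \<beta> * exp (- h (mi_vec \<beta>))))"
        using N G_norm_le_iff[of N h m f] that by (intro mult_left_mono) auto
      then show ?thesis by (simp add: mi_deriv_cmult f norm_mult mult_ac)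
    qed
    then have "G_norm h m (\<lambda>x. c * f x) \<le> ennreal (cmod c * N)"
      using N by (simp add: G_norm_le_iff)
    then show ?thesis by (simp add: le_less_trans)
  qed
  have "lin_space (G_space h)"
    unfolding lin_space_def
  proof (intro conjI ballI allI)
    fix f g c assume f: "f \<in> G_space h" and g: "g \<in> G_space h"
    have "G_norm h m (\<lambda>x. f x + g x) < \<infinity>" for m
      using f g by (intro le_less_trans[OF add]) (auto simp: G_space_iff)
    then show "(\<lambda>x. f x + g x) \<in> G_space h"
      using f g by (simp add: G_space_iff smooth_add)
  next
    fix f c assume "f \<in> G_space h"
    then show "(\<lambda>x. c * f x) \<in> G_space h"
      using scale by (simp add: G_space_iff smooth_cmult)
  qed (simp add: G_space_iff z)
  then show ?thesis unfolding subadditive_norms_def using z add by (auto simp: G_space_iff)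
qed

lemma subadditive_norms_E: "subadditive_norms (E_space h) (E_norm h)"
proof -
  have z: "E_norm h m (\<lambda>x. 0) = 0" for m
    using E_norm_le_iff[of 0 h m "\<lambda>x. 0"] by simp
  have add: "E_norm h m (\<lambda>x. f x + g x) \<le> E_norm h m f + E_norm h m g"
    if fg: "smooth f" "smooth g" "E_norm h m f < \<infinity>" "E_norm h m g < \<infinity>" for m f g
  proof -
    obtain N M where N: "N \<ge> 0" "E_norm h m f = ennreal N" "M \<ge> 0" "E_norm h m g = ennreal M"
      using ennreal_finite_le[OF fg(3)] ennreal_finite_le[OF fg(4)] by blast
    have "(1 + norm x) ^ m * cmod (mi_deriv \<alpha> (\<lambda>x. f x + g x) x) \<le>
        (N + M) * (mi_fact \<alpha> * exp (- h (mi_vec \<alpha>)))" for x \<alpha>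
    proof -
      have "(1 + norm x) ^ m * cmod (mi_deriv \<alpha> (\<lambda>x. f x + g x) x) \<le>
          (1 + norm x) ^ m * (cmod (mi_deriv \<alpha> f x) + cmod (mi_deriv \<alpha> g x))"
        by (intro mult_left_mono) (auto simp: mi_deriv_add fg norm_triangle_ineq)
      also have "\<dots> \<le> (N + M) * (mi_fact \<alpha> * exp (- h (mi_vec \<alpha>)))"
        using N E_norm_le_iff[of N h m f] E_norm_le_iff[of M h m g]
        by (auto simp: ring_distribs intro!: add_mono)
      finally show ?thesis .
    qed
    then have "E_norm h m (\<lambda>x. f x + g x) \<le> ennreal (N + M)"
      using N by (subst E_norm_le_iff) auto
    then show ?thesis using N by (simp only: ennreal_plus)
  qed
  have scale: "E_norm h m (\<lambda>x. c * f x) < \<infinity>" if f: "smooth f" "E_norm h m f < \<infinity>" for m c f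
  proof -
    obtain N where N: "N \<ge> 0" "E_norm h m f = ennreal N" using ennreal_finite_le[OF f(2)] by blast
    have "(1 + norm x) ^ m * cmod (mi_deriv \<alpha> (\<lambda>x. c * f x) x) \<le>
        (cmod c * N) * (mi_fact \<alpha> * exp (- h (mi_vec \<alpha>)))" for x \<alpha>
    proof -
      have "cmod c * ((1 + norm x) ^ m * cmod (mi_deriv \<alpha> f x)) \<le>
          cmod c * (N * (mi_fact \<alpha> * exp (- h (mi_vec \<alpha>))))"
        using N E_norm_le_iff[of N h m f] by (intro mult_left_mono) auto
      then show ?thesis by (simp add: mi_deriv_cmult f norm_mult mult_ac)
    qed
    then have "E_norm h m (\<lambda>x. c * f x) \<le> ennreal (cmod c * N)"
      using N by (simp add: E_norm_le_iff)
    then show ?thesis by (simp add: le_less_trans)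
  qed
  have "lin_space (E_space h)"
    unfolding lin_space_def
  proof (intro conjI ballI allI)
    fix f g c assume f: "f \<in> E_space h" and g: "g \<in> E_space h"
    have "E_norm h m (\<lambda>x. f x + g x) < \<infinity>" for m
      using f g by (intro le_less_trans[OF add]) (auto simp: E_space_iff)
    then show "(\<lambda>x. f x + g x) \<in> E_space h"
      using f g by (simp add: E_space_iff smooth_add)
  next
    fix f c assume "f \<in> E_space h"
    then show "(\<lambda>x. c * f x) \<in> E_space h"
      using scale by (simp add: E_space_iff smooth_cmult)
  qed (simp add: E_space_iff z)
  then show ?thesis unfolding subadditive_norms_def using z add by (auto simp: E_space_iff)
qed

section \<open>The isomorphism between the inductive limits\<close>

context weight_sequence
begin

lemma G_space_chain:
  assumes "\<nu> \<ge> 1"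
  shows "G_space (h \<nu>) \<subseteq> G_space (h (\<nu> + 1))"
proof
  fix f assume f: "f \<in> G_space (h \<nu>)"
  obtain c where c: "c > 0" "\<And>\<alpha>. exp (- h \<nu> (mi_vec \<alpha>)) \<le> c * exp (- h (\<nu> + 1) (mi_vec \<alpha>))"
    using h_decreasing'[OF assms] by blast
  have "G_norm (h (\<nu> + 1)) m f < \<infinity>" for m
  proof -
    obtain N where N: "N \<ge> 0" "G_norm (h \<nu>) m f = ennreal N"
      using f ennreal_finite_le unfolding G_space_iff by blast
    have "N * (mi_fact \<beta> * exp (- h \<nu> (mi_vec \<beta>))) \<le> (N * c) * (mi_fact \<beta> * exp (- h (\<nu> + 1) (mi_vec \<beta>)))" for \<beta>
      using mult_left_mono[OF c(2), of "N * mi_fact \<beta>" \<beta>] N(1) by (simp add: mult_ac)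
    note le = order.trans[OF _ this]
    have "cmod (of_real (mi_power x \<beta>) * mi_deriv \<alpha> f x) \<le> (N * c) * (mi_fact \<beta> * exp (- h (\<nu> + 1) (mi_vec \<beta>)))"
      if "mi_order \<alpha> \<le> m" for x \<beta> \<alpha>
      by (rule le) (use iffD1[OF G_norm_le_iff[OF N(1)], of "h \<nu>" m f] N that in simp)
    then have "G_norm (h (\<nu> + 1)) m f \<le> ennreal (N * c)"
      using N(1) c(1) by (subst G_norm_le_iff) auto
    then show ?thesis by (simp add: le_less_trans)
  qed
  then show "f \<in> G_space (h (\<nu> + 1))" using f by (simp add: G_space_iff)
qed

lemma E_space_chain:
  assumes "\<nu> \<ge> 1"
  shows "E_space (h \<nu>) \<subseteq> E_space (h (\<nu> + 1))"
proof
  fix f assume f: "f \<in> E_space (h \<nu>)"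
  obtain c where c: "c > 0" "\<And>\<alpha>. exp (- h \<nu> (mi_vec \<alpha>)) \<le> c * exp (- h (\<nu> + 1) (mi_vec \<alpha>))"
    using h_decreasing'[OF assms] by blast
  have "E_norm (h (\<nu> + 1)) m f < \<infinity>" for m
  proof -
    obtain N where N: "N \<ge> 0" "E_norm (h \<nu>) m f = ennreal N"
      using f ennreal_finite_le unfolding E_space_iff by blast
    have "N * (mi_fact \<beta> * exp (- h \<nu> (mi_vec \<beta>))) \<le> (N * c) * (mi_fact \<beta> * exp (- h (\<nu> + 1) (mi_vec \<beta>)))" for \<beta>
      using mult_left_mono[OF c(2), of "N * mi_fact \<beta>" \<beta>] N(1) by (simp add: mult_ac)
    note le = order.trans[OF _ this]
    have "(1 + norm x) ^ m * cmod (mi_deriv \<alpha> f x) \<le> (N * c) * (mi_fact \<alpha> * exp (- h (\<nu> + 1) (mi_vec \<alpha>)))"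
      for x \<alpha>
      by (rule le) (use iffD1[OF E_norm_le_iff[OF N(1)], of "h \<nu>" m f] N in simp)
    then have "E_norm (h (\<nu> + 1)) m f \<le> ennreal (N * c)"
      using N(1) c(1) by (subst E_norm_le_iff) auto
    then show ?thesis by (simp add: le_less_trans)
  qed
  then show "f \<in> E_space (h (\<nu> + 1))" using f by (simp add: E_space_iff)
qed

lemma lin_space_G_union: "lin_space (G_union h)"
  unfolding G_union_def
  by (rule lin_space_Union_chain[where A = "\<lambda>\<nu>. G_space (h \<nu>)",
      OF subadditive_norms_lin_space[OF subadditive_norms_G] G_space_chain])

lemma lin_space_E_union: "lin_space (E_union h)"
  unfolding E_union_def
  by (rule lin_space_Union_chain[where A = "\<lambda>\<nu>. E_space (h \<nu>)",
      OF subadditive_norms_lin_space[OF subadditive_norms_E] E_space_chain])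

lemma G_union_rapid: "f \<in> G_union h \<Longrightarrow> rapid f"
  using G_space_rapid by (auto simp: G_union_def)

lemma E_union_rapid: "f \<in> E_union h \<Longrightarrow> rapid f"
  using E_space_rapid by (auto simp: E_union_def)

text \<open>This is the transform with the conjugate kernel; the symmetric normalisation makes it
  the inverse without a further constant. Expressed through \<open>fourier\<close>, it inherits the
  estimate from \<open>E\<close> to \<open>G\<close>, as reflection does not increase the
  norms.\<close>

definition inv_fourier :: "(real ^ 'n \<Rightarrow> complex) \<Rightarrow> real ^ 'n \<Rightarrow> complex" where
  "inv_fourier g = (\<lambda>x. fourier g (- x))"

lemma lin_on_fourier: "(\<And>f. f \<in> V \<Longrightarrow> rapid f) \<Longrightarrow> lin_on V fourier"
  unfolding lin_on_def by (intro conjI ballI allI fourier_add fourier_cmult rapid_integrable)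

lemma lin_on_inv_fourier: "(\<And>f. f \<in> V \<Longrightarrow> rapid f) \<Longrightarrow> lin_on V inv_fourier"
  using lin_on_fourier[of V] unfolding lin_on_def inv_fourier_def by simp

lemma inv_fourier_fourier: "rapid f \<Longrightarrow> inv_fourier (fourier f) = f"
  by (simp add: inv_fourier_def rapid_fourier_fourier)

text \<open>Reflection commutes with the transform, so the two reflections cancel.\<close>

lemma fourier_inv_fourier: "rapid f \<Longrightarrow> fourier (inv_fourier f) = f"
  by (simp add: inv_fourier_def fourier_minus_arg rapid_integrable rapid_fourier rapid_fourier_fourier)

text \<open>One shift of the index serves every \<open>m\<close>, so the whole intersection over
  \<open>m\<close> is mapped into a single step space. The estimate behind continuity also yields
  finiteness of the target norms.\<close>

lemma fourier_continuous_step: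
  assumes \<nu>: "\<nu> \<ge> 1"
  shows "continuous_map (G_topology (h \<nu>)) (E_topology (h (\<nu> + 2))) fourier"
  unfolding G_topology_def E_topology_def
proof (rule continuous_map_norms_topology[OF subadditive_norms_G subadditive_norms_E])
  have r: "rapid f" if "f \<in> G_space (h \<nu>)" for f using G_space_rapid[OF \<nu> that] .
  show "lin_on (G_space (h \<nu>)) fourier" by (rule lin_on_fourier[OF r])
  show "\<exists>m'. \<exists>C\<ge>0. \<forall>f\<in>G_space (h \<nu>). \<forall>N\<ge>0. G_norm (h \<nu>) m' f \<le> ennreal N \<longrightarrow>
      E_norm (h (\<nu> + 2)) m (fourier f) \<le> ennreal (C * N)" for m
    using fourier_G_E[OF \<nu>, of m] r by blast
  have "E_norm (h (\<nu> + 2)) m (fourier f) < \<infinity>" if f: "f \<in> G_space (h \<nu>)" for f m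
  proof -
    obtain N where "N \<ge> 0" "G_norm (h \<nu>) m f = ennreal N"
      using f ennreal_finite_le unfolding G_space_iff by blast
    then obtain C where "E_norm (h (\<nu> + 2)) m (fourier f) \<le> ennreal (C * N)"
      using fourier_G_E[OF \<nu>, of m] r[OF f] by (metis order_refl)
    then show ?thesis by (simp add: le_less_trans)
  qed
  then show "fourier ` G_space (h \<nu>) \<subseteq> E_space (h (\<nu> + 2))"
    using smooth_fourier[OF r] by (auto simp: E_space_iff)
qed

text \<open>The order of the norm drops from \<open>2 * CARD('n) + m\<close> to \<open>m\<close>; as
  a step space carries norms of all orders, this does not affect continuity.\<close>

lemma inv_fourier_continuous_step:
  assumes \<nu>: "\<nu> \<ge> 1"
  shows "continuous_map (E_topology (h \<nu>)) (G_topology (h (\<nu> + 2))) inv_fourier"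
  unfolding G_topology_def E_topology_def
proof (rule continuous_map_norms_topology[OF subadditive_norms_E subadditive_norms_G])
  have r: "rapid f" if "f \<in> E_space (h \<nu>)" for f using E_space_rapid[OF that] .
  show "lin_on (E_space (h \<nu>)) inv_fourier" by (rule lin_on_inv_fourier[OF r])
  have b: "\<exists>C\<ge>0. \<forall>f\<in>E_space (h \<nu>). \<forall>N\<ge>0. E_norm (h \<nu>) (2 * CARD('n) + m) f \<le> ennreal N \<longrightarrow>
      G_norm (h (\<nu> + 2)) m (inv_fourier f) \<le> ennreal (C * N)" for m
  proof -
    obtain C where C: "C \<ge> 0" "\<And>f N. rapid f \<Longrightarrow> N \<ge> 0 \<Longrightarrow>
        E_norm (h \<nu>) (2 * CARD('n) + m) f \<le> ennreal N \<Longrightarrow>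
        G_norm (h (\<nu> + 2)) m (fourier f) \<le> ennreal (C * N)"
      using fourier_E_G[OF \<nu>, of m] by blast
    show ?thesis unfolding inv_fourier_def
      using C(1) by (intro exI[of _ C] conjI ballI allI impI
          order.trans[OF G_norm_minus_arg C(2)] smooth_fourier r)
  qed
  then show "\<exists>m'. \<exists>C\<ge>0. \<forall>f\<in>E_space (h \<nu>). \<forall>N\<ge>0. E_norm (h \<nu>) m' f \<le> ennreal N \<longrightarrow>
      G_norm (h (\<nu> + 2)) m (inv_fourier f) \<le> ennreal (C * N)" for m
    by blast
  have "G_norm (h (\<nu> + 2)) m (inv_fourier f) < \<infinity>" if f: "f \<in> E_space (h \<nu>)" for f m
  proof -
    obtain N where "N \<ge> 0" "E_norm (h \<nu>) (2 * CARD('n) + m) f = ennreal N"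
      using f ennreal_finite_le unfolding E_space_iff by blast
    then obtain C where "G_norm (h (\<nu> + 2)) m (inv_fourier f) \<le> ennreal (C * N)"
      using b[of m] f by (metis order_refl)
    then show ?thesis by (simp add: le_less_trans)
  qed
  then show "inv_fourier ` E_space (h \<nu>) \<subseteq> G_space (h (\<nu> + 2))"
    using smooth_fourier[OF r] unfolding inv_fourier_def by (auto simp: G_space_iff smooth_minus_arg)
qed

theorem fourier_isomorphism:
  "tvs_isomorphism (G_union h) (G_lim_topology h) (E_union h) (E_lim_topology h) fourier"
proof -
  have tG: "topspace (G_topology (h \<nu>)) = G_space (h \<nu>)" for \<nu>
    unfolding G_topology_def by (rule topspace_norms_topology[OF subadditive_norms_G])
  have tE: "topspace (E_topology (h \<nu>)) = E_space (h \<nu>)" for \<nu>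
    unfolding E_topology_def by (rule topspace_norms_topology[OF subadditive_norms_E])
  note lG = lin_space_G_union[unfolded G_union_def] and lE = lin_space_E_union[unfolded E_union_def]
  have tGl: "topspace (G_lim_topology h) = G_union h"
    unfolding G_lim_topology_def G_union_def by (rule topspace_inductive_limit_topology[OF lG tG])
  have tEl: "topspace (E_lim_topology h) = E_union h"
    unfolding E_lim_topology_def E_union_def by (rule topspace_inductive_limit_topology[OF lE tE])
  have cF: "continuous_map (G_lim_topology h) (E_lim_topology h) fourier"
    unfolding G_lim_topology_def E_lim_topology_def
  proof (rule continuous_map_inductive_limit_topology[OF lG lE tG tE])
    show "lin_on (\<Union>\<nu>\<in>{1..}. G_space (h \<nu>)) fourier"
      by (rule lin_on_fourier, rule G_union_rapid) (simp add: G_union_def)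
    show "\<exists>\<mu>\<in>{1..}. continuous_map (G_topology (h \<nu>)) (E_topology (h \<mu>)) fourier" if "\<nu> \<in> {1..}" for \<nu>
      using fourier_continuous_step[of \<nu>] that by (intro bexI[of _ "\<nu> + 2"]) auto
  qed
  have cI: "continuous_map (E_lim_topology h) (G_lim_topology h) inv_fourier"
    unfolding G_lim_topology_def E_lim_topology_def
  proof (rule continuous_map_inductive_limit_topology[OF lE lG tE tG])
    show "lin_on (\<Union>\<nu>\<in>{1..}. E_space (h \<nu>)) inv_fourier"
      by (rule lin_on_inv_fourier, rule E_union_rapid) (simp add: E_union_def)
    show "\<exists>\<mu>\<in>{1..}. continuous_map (E_topology (h \<nu>)) (G_topology (h \<mu>)) inv_fourier" if "\<nu> \<in> {1..}" for \<nu>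
      using inv_fourier_continuous_step[of \<nu>] that by (intro bexI[of _ "\<nu> + 2"]) auto
  qed
  have "homeomorphic_maps (G_lim_topology h) (E_lim_topology h) fourier inv_fourier"
    unfolding homeomorphic_maps_def tGl tEl
    by (simp add: cF cI inv_fourier_fourier fourier_inv_fourier G_union_rapid E_union_rapid)
  then have hom: "homeomorphic_map (G_lim_topology h) (E_lim_topology h) fourier"
    by (rule homeomorphic_maps_imp_map)
  have "bij_betw fourier (G_union h) (E_union h)"
    using hom unfolding homeomorphic_eq_everything_map bij_betw_def tGl tEl by blast
  moreover have "lin_on (G_union h) fourier" by (rule lin_on_fourier[OF G_union_rapid])
  ultimately show ?thesis
    using hom tGl tEl unfolding tvs_isomorphism_def lin_on_def by blast
qed

end

theorem theorem3:
  fixes h :: "nat \<Rightarrow> real ^ 'n::finite \<Rightarrow> real"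
  assumes convex: "\<And>\<nu>. \<nu> \<ge> 1 \<Longrightarrow> convex_on UNIV (h \<nu>)"
    and even: "\<And>\<nu> x. \<nu> \<ge> 1 \<Longrightarrow> h \<nu> x = h \<nu> (\<chi> j. \<bar>x $ j\<bar>)"
    and nondecreasing: "\<And>\<nu> x i t. \<nu> \<ge> 1 \<Longrightarrow> (\<forall>j. 0 \<le> x $ j) \<Longrightarrow> x $ i \<le> t \<Longrightarrow>
      h \<nu> x \<le> h \<nu> (\<chi> j. if j = i then t else x $ j)"
    and superlinear: "\<And>\<nu>. \<nu> \<ge> 1 \<Longrightarrow> filterlim (\<lambda>x. h \<nu> x / norm x) at_top at_infinity"
    and upper_bound: "\<And>\<nu> M. \<nu> \<ge> 1 \<Longrightarrow> M > 0 \<Longrightarrow> \<exists>A>0. \<forall>x. (\<forall>j. 0 \<le> x $ j) \<longrightarrow>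
      h \<nu> x \<le> (\<Sum>j\<in>{j. x $ j \<noteq> 0}. x $ j * ln (x $ j / M)) + A"
    and decreasing: "\<And>\<nu>. \<nu> \<ge> 1 \<Longrightarrow> \<exists>\<gamma>. \<forall>x. (\<forall>j. 0 \<le> x $ j) \<longrightarrow>
      h \<nu> x - h (\<nu> + 1) x \<ge> ln 2 * (\<Sum>j\<in>UNIV. x $ j) - \<gamma>"
    and subadditive: "\<And>\<nu>. \<nu> \<ge> 1 \<Longrightarrow> \<exists>l. \<forall>x y. (\<forall>j. 0 \<le> x $ j) \<longrightarrow> (\<forall>j. 0 \<le> y $ j) \<longrightarrow>
      h (\<nu> + 1) (x + y) \<le> h \<nu> x + h \<nu> y + l"
  shows "tvs_isomorphism (G_union h) (G_lim_topology h) (E_union h) (E_lim_topology h) fourier"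
proof -
  interpret weight_sequence h
    by (rule weight_sequence.intro, fact nondecreasing, fact decreasing, fact subadditive)
  show ?thesis by (rule fourier_isomorphism)
qed

end
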